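(* Let $L_2=C_1\cup C_2\subset D^3$ be the coaxial pair of circles and $\Sigma_1\in\operatorname{MCG}(D^3,L_2)$ the elementary braid permutation. The image $\boldsymbol\Sigma$ of $\Sigma_1$ in $\operatorname{Aut}\big(\pi_{(1,2)}(D^3\setminus L_2,\ast)\big)$ is given by $$\boldsymbol\Sigma(x_2)=x_2^{-1}x_1x_2,\qquad \boldsymbol\Sigma(x_1)=x_2,\qquad \boldsymbol\Sigma(K_2)=x_2^{-1}\triangleright K_1,$$ and the image of $K_1$ is determined by these since $\boldsymbol\Sigma$ fixes $K_1+K_2$.
   Context: **$\pi$-modules.** A $\pi$-module is a triple $(G,A,\triangleright)$ with $G$ a group, $A$ an abelian group, and $\triangleright$ a left action of $G$ on $A$ by automorphisms; morphisms are pairs of group homomorphisms $(f^1,f^2)$ with $f^2(g\triangleright a)=f^1(g)\triangleright' f^2(a)$, and $\operatorname{Aut}$ denotes the group of invertible self-morphisms. For a pointed space $(X,\ast)$, $\pi_{(1,2)}(X,\ast)=(\pi_1(X,\ast),\pi_2(X,\ast),\triangleright)$ with the usual action of $\pi_1$ on $\pi_2$. **Mapping class groups.** For a manifold $X$ with boundary and a subset $A$ of its interior, $\operatorname{MCG}(X,A)$ is the group of orientation-preserving homeomorphisms of $X$ fixing $\partial X$ pointwise and mapping $A$ onto itself, modulo isotopy through such homeomorphisms. Elements of $\operatorname{MCG}(D^3,L_2)$ act on $\pi_{(1,2)}(D^3\setminus L_2,\ast)$, $\ast\in\partial D^3$, by restricting homeomorphisms to $D^3\setminus L_2$; for an induced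 morphism the same symbol is used for both components. **Coaxial configuration.** Let $D^2=[0,1]^2$ and let $d_2=\{p_1,p_2\}$ be two interior points on a common vertical line, $p_1$ above $p_2$. Rotating $D^2$ about its left edge $\{0\}\times[0,1]$ (the axis) gives a topological 3-ball, denoted $D^3$, and $p_1,p_2$ sweep out coaxial circles $C_1,C_2$ with $C_1$ above $C_2$; $L_2=C_1\cup C_2$. Let $\ast\in\partial D^2$ be a point on the right edge of $D^2$, so $\ast\in\partial D^3$. For $i=1,2$ let $s_i$ be the horizontal segment from $p_i$ to the axis and $\Delta_i$ the flat disc bounded by $C_i$ obtained by rotating $s_i$. Let $x_i\in\pi_1(D^2\setminus d_2,\ast)$ be the class of a simple loop encircling $p_i$ once, crossing $s_i$ exactly once and not meeting the other segment, with both loops oriented in the same sense, the sense being chosen so that $x_1x_2$ is the class of a loop traversing $\partial D^2$ once. The same symbol $x_i$ denotes the image of this class in $\pi_1(D^3\setminus L_2,\ast)$; this group is free on $x_1,x_2$. **The classes $K_i$.** Let $b_i\subset D^3\setminus L_2$ be a 2-sphere obtained by rotating an arc in $D^2$ with endpoints on the axis that, together with the axis, encloses $p_i$ (and $s_i$) but not the other marked point or segment; orient $b_i$ by its exterior normal. $K_i\in\pi_2(D^3\setminus L_2,\ast)$ is the class of a positively oriented parametrisation of $b_i$ based at a point $\ast_i\in b_i$ on the axis, transported to $\ast$ along a path from $\ast$ to $\ast_i$ not crossing the discs $\Delta_1,\Delta_2$. $\pi_2(D^3\setminus L_2,\ast)$ is the free $\mathbb Z[\pi_1(D^3\setminus L_2,\ast)]$-module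 on $K_1,K_2$. **Elementary braid permutation.** Rotating homeomorphisms of $(D^2,d_2)$ about the axis (keeping the axis pointwise fixed) defines a homomorphism $r\colon\operatorname{MCG}(D^2,d_2)\to\operatorname{MCG}(D^3,L_2)$. The half-twist in $\operatorname{MCG}(D^2,d_2)$ exchanging $p_1$ and $p_2$, with $p_2$ moving up on the axis side of $p_1$, is the unique (by Artin's theorem) class acting on $\pi_1(D^2\setminus d_2,\ast)$ by $x_1\mapsto x_2$, $x_2\mapsto x_2^{-1}x_1x_2$. Its image under $r$ is the elementary braid permutation $\Sigma_1\in\operatorname{MCG}(D^3,L_2)$: the two coaxial circles exchange places, with $C_2$ passing up through $C_1$. *)

theory Defs
  imports "HOL-Complex_Analysis.Winding_Numbers" "HOL-Algebra.Group"
begin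

section \<open>Pi-modules\<close>

text \<open>The record carries only the data of a \<open>\<pi>\<close>-module \<open>(G, A, \<triangleright>)\<close>, with the abelian group \<open>A\<close>
  written multiplicatively. The laws are not built into the type, just as the group laws are not
  built into the type of monoids.\<close>

record ('g, 'a) pi_module =
  Grp :: "'g monoid"
  Ab  :: "'a monoid"
  act :: "'g \<Rightarrow> 'a \<Rightarrow> 'a"

definition pi_mor :: "('g, 'a) pi_module \<Rightarrow> ('h, 'b) pi_module \<Rightarrow> (('g \<Rightarrow> 'h) \<times> ('a \<Rightarrow> 'b)) set" where
  "pi_mor M N = {(f1, f2).
     f1 \<in> hom (Grp M) (Grp N) \<and> f1 \<in> extensional (carrier (Grp M)) \<and>
     f2 \<in> hom (Ab M) (Ab N) \<and> f2 \<in> extensional (carrier (Ab M)) \<and>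
     (\<forall>g\<in>carrier (Grp M). \<forall>a\<in>carrier (Ab M). f2 (act M g a) = act N (f1 g) (f2 a))}"

definition pi_id :: "('g, 'a) pi_module \<Rightarrow> ('g \<Rightarrow> 'g) \<times> ('a \<Rightarrow> 'a)" where
  "pi_id M = (restrict id (carrier (Grp M)), restrict id (carrier (Ab M)))"

definition pi_comp ::
  "('g, 'a) pi_module \<Rightarrow> ('g \<Rightarrow> 'g) \<times> ('a \<Rightarrow> 'a) \<Rightarrow> ('g \<Rightarrow> 'g) \<times> ('a \<Rightarrow> 'a) \<Rightarrow> ('g \<Rightarrow> 'g) \<times> ('a \<Rightarrow> 'a)"
where
  "pi_comp M \<phi> \<psi> =
     (compose (carrier (Grp M)) (fst \<phi>) (fst \<psi>), compose (carrier (Ab M)) (snd \<phi>) (snd \<psi>))"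

definition pi_Aut :: "('g, 'a) pi_module \<Rightarrow> (('g \<Rightarrow> 'g) \<times> ('a \<Rightarrow> 'a)) monoid" where
  "pi_Aut M =
     \<lparr>carrier = {\<phi> \<in> pi_mor M M. \<exists>\<psi>\<in>pi_mor M M. pi_comp M \<phi> \<psi> = pi_id M \<and> pi_comp M \<psi> \<phi> = pi_id M},
      monoid.mult = pi_comp M,
      one = pi_id M\<rparr>"

section \<open>The fundamental group\<close>

definition loop_class :: "'a::topological_space set \<Rightarrow> (real \<Rightarrow> 'a) \<Rightarrow> (real \<Rightarrow> 'a) set" where
  "loop_class X p = {q. homotopic_paths X p q}"

text \<open>A product \<open>\<gamma>\<delta>\<close> traverses \<open>\<gamma>\<close> first.\<close>

definition pi1 :: "'a::topological_space set \<Rightarrow> 'a \<Rightarrow> (real \<Rightarrow> 'a) set monoid" where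
  "pi1 X x =
     \<lparr>carrier = {loop_class X p | p. path p \<and> path_image p \<subseteq> X \<and> pathstart p = x \<and> pathfinish p = x},
      monoid.mult = (\<lambda>\<gamma> \<delta>. {r. \<exists>p\<in>\<gamma>. \<exists>q\<in>\<delta>. homotopic_paths X (p +++ q) r}),
      one = loop_class X (\<lambda>_. x)\<rparr>"

text \<open>Maps act on homotopy classes through sets \<open>F\<close> of maps: \<open>F\<close> is a singleton or a mapping class,
  all of whose members induce the same map.\<close>

definition pi1_map ::
  "('a::topological_space \<Rightarrow> 'b::topological_space) set \<Rightarrow> 'b set \<Rightarrow> (real \<Rightarrow> 'a) set \<Rightarrow> (real \<Rightarrow> 'b) set"
where
  "pi1_map F Y \<gamma> = {q. \<exists>f\<in>F. \<exists>p\<in>\<gamma>. homotopic_paths Y (f \<circ> p) q}"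

section \<open>The second homotopy group and the action of the fundamental group\<close>

text \<open>Spheroids are maps on the square \<open>[-1,1]\<^sup>2\<close>, viewed in the complex plane, that send the boundary
  to the base point. \<open>sqnorm\<close> is the maximum norm, so the boundary of the square is \<open>sqnorm w = 1\<close>.\<close>

definition square :: "complex set" where
  "square = cbox (Complex (-1) (-1)) (Complex 1 1)"

definition sqnorm :: "complex \<Rightarrow> real" where
  "sqnorm w = max \<bar>Re w\<bar> \<bar>Im w\<bar>"

definition spheroid :: "'a::topological_space set \<Rightarrow> 'a \<Rightarrow> (complex \<Rightarrow> 'a) \<Rightarrow> bool" where
  "spheroid X x f \<longleftrightarrow> continuous_on square f \<and> f ` square \<subseteq> X \<and> (\<forall>w\<in>frontier square. f w = x)"

definition homotopic_spheroids ::
  "'a::topological_space set \<Rightarrow> 'a \<Rightarrow> (complex \<Rightarrow> 'a) \<Rightarrow> (complex \<Rightarrow> 'a) \<Rightarrow> bool" where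
  "homotopic_spheroids X x f g \<longleftrightarrow>
     homotopic_with_canon (\<lambda>k. \<forall>w\<in>frontier square. k w = x) square X f g"

definition spheroid_class ::
  "'a::topological_space set \<Rightarrow> 'a \<Rightarrow> (complex \<Rightarrow> 'a) \<Rightarrow> (complex \<Rightarrow> 'a) set" where
  "spheroid_class X x f = {g. homotopic_spheroids X x f g}"

definition spheroid_join :: "(complex \<Rightarrow> 'a) \<Rightarrow> (complex \<Rightarrow> 'a) \<Rightarrow> complex \<Rightarrow> 'a" where
  "spheroid_join f g w =
     (if Re w \<le> 0 then f (Complex (2 * Re w + 1) (Im w)) else g (Complex (2 * Re w - 1) (Im w)))"

text \<open>Transport of a spheroid based at the end of \<open>\<beta>\<close> to the start of \<open>\<beta>\<close>: the spheroid is shrunk to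
  the concentric half-size square, and on the remaining collar \<open>\<beta>\<close> is followed radially inwards.\<close>

definition transport :: "(real \<Rightarrow> 'a) \<Rightarrow> (complex \<Rightarrow> 'a) \<Rightarrow> complex \<Rightarrow> 'a" where
  "transport \<beta> f w = (if sqnorm w \<le> 1/2 then f (2 * w) else \<beta> (2 - 2 * sqnorm w))"

definition pi2 :: "'a::topological_space set \<Rightarrow> 'a \<Rightarrow> (complex \<Rightarrow> 'a) set monoid" where
  "pi2 X x =
     \<lparr>carrier = {spheroid_class X x f | f. spheroid X x f},
      monoid.mult = (\<lambda>\<kappa> \<mu>. {k. \<exists>f\<in>\<kappa>. \<exists>g\<in>\<mu>. homotopic_spheroids X x (spheroid_join f g) k}),
      one = spheroid_class X x (\<lambda>_. x)\<rparr>"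

definition pi2_map ::
  "('a::topological_space \<Rightarrow> 'b::topological_space) set \<Rightarrow> 'b set \<Rightarrow> 'b \<Rightarrow>
   (complex \<Rightarrow> 'a) set \<Rightarrow> (complex \<Rightarrow> 'b) set"
where
  "pi2_map F Y y \<kappa> = {k. \<exists>f\<in>F. \<exists>g\<in>\<kappa>. homotopic_spheroids Y y (f \<circ> g) k}"

definition pi12 ::
  "'a::topological_space set \<Rightarrow> 'a \<Rightarrow> ((real \<Rightarrow> 'a) set, (complex \<Rightarrow> 'a) set) pi_module" where
  "pi12 X x =
     \<lparr>Grp = pi1 X x,
      Ab = pi2 X x,
      act = (\<lambda>\<gamma> \<kappa>. {k. \<exists>p\<in>\<gamma>. \<exists>f\<in>\<kappa>. homotopic_spheroids X x (transport p f) k})\<rparr>"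

section \<open>Mapping class groups\<close>

text \<open>Only full-dimensional balls \<open>X\<close> in a Euclidean space are used, so that the manifold boundary is
  the topological frontier. A homeomorphism of a ball fixing its boundary pointwise
  preserves orientation, so no separate orientation condition is needed.\<close>

definition homeos :: "'a::euclidean_space set \<Rightarrow> 'a set \<Rightarrow> ('a \<Rightarrow> 'a) set" where
  "homeos X A = {f. (\<exists>g. homeomorphism X X f g) \<and> (\<forall>x\<in>frontier X. f x = x) \<and> f ` A = A}"

definition isotopic :: "'a::euclidean_space set \<Rightarrow> 'a set \<Rightarrow> ('a \<Rightarrow> 'a) \<Rightarrow> ('a \<Rightarrow> 'a) \<Rightarrow> bool" where
  "isotopic X A f g \<longleftrightarrow> homotopic_with_canon (\<lambda>h. h \<in> homeos X A) X X f g"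

definition MCG :: "'a::euclidean_space set \<Rightarrow> 'a set \<Rightarrow> ('a \<Rightarrow> 'a) set monoid" where
  "MCG X A =
     \<lparr>carrier = {{g. isotopic X A f g} | f. f \<in> homeos X A},
      monoid.mult = (\<lambda>\<sigma> \<tau>. {k. \<exists>f\<in>\<sigma>. \<exists>g\<in>\<tau>. isotopic X A (f \<circ> g) k}),
      one = {g. isotopic X A id g}\<rparr>"

text \<open>The action on the \<open>\<pi>\<close>-module of the complement \<open>Y\<close> (the ambient ball minus \<open>A\<close>).\<close>

definition induced_pi12 ::
  "('a::euclidean_space \<Rightarrow> 'a) set \<Rightarrow> 'a set \<Rightarrow> 'a \<Rightarrow>
   ((real \<Rightarrow> 'a) set \<Rightarrow> (real \<Rightarrow> 'a) set) \<times> ((complex \<Rightarrow> 'a) set \<Rightarrow> (complex \<Rightarrow> 'a) set)"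
where
  "induced_pi12 \<sigma> Y y =
     (restrict (pi1_map \<sigma> Y) (carrier (pi1 Y y)), restrict (pi2_map \<sigma> Y y) (carrier (pi2 Y y)))"

section \<open>Rotation about the left edge of the square\<close>

definition D2 :: "complex set" where
  "D2 = cbox 0 (Complex 1 1)"

definition axis2 :: "complex set" where
  "axis2 = {w \<in> D2. Re w = 0}"

text \<open>Three-space is \<open>complex \<times> real\<close>, oriented by the coordinates \<open>(Re z, Im z, t)\<close>; the axis is
  \<open>z = 0\<close>, and a point \<open>w\<close> of the half-plane \<open>Re w \<ge> 0\<close> lies at distance \<open>Re w\<close> from the axis and
  height \<open>Im w\<close>. The half-plane itself is placed in three-space by \<open>emb\<close>.\<close>

definition emb :: "complex \<Rightarrow> complex \<times> real" where
  "emb w = (of_real (Re w), Im w)"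

definition rotate_set :: "complex set \<Rightarrow> (complex \<times> real) set" where
  "rotate_set S = {(u * of_real (Re w), Im w) | u w. cmod u = 1 \<and> w \<in> S}"

definition D3 :: "(complex \<times> real) set" where
  "D3 = rotate_set D2"

text \<open>On the axis \<open>sgn z = 0\<close>, which is harmless when \<open>h\<close> fixes the axis.\<close>

definition rotate_map :: "(complex \<Rightarrow> complex) \<Rightarrow> complex \<times> real \<Rightarrow> complex \<times> real" where
  "rotate_map h = (\<lambda>(z, t). let w = h (Complex (cmod z) t) in (sgn z * of_real (Re w), Im w))"

text \<open>The homomorphism \<open>r\<close> from \<open>MCG D2 A\<close> to \<open>MCG D3 (rotate_set A)\<close>.\<close>

definition rotate_MCG ::
  "complex set \<Rightarrow> (complex \<Rightarrow> complex) set \<Rightarrow> (complex \<times> real \<Rightarrow> complex \<times> real) set" where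
  "rotate_MCG A \<tau> = {k. \<exists>h\<in>\<tau>. isotopic D3 (rotate_set A) (rotate_map h) k}"

section \<open>The coaxial pair of circles\<close>

text \<open>The horizontal segment from \<open>p\<close> to the axis.\<close>

definition seg :: "complex \<Rightarrow> complex set" where
  "seg p = closed_segment p (Complex 0 (Im p))"

text \<open>A simple loop at \<open>b\<close> encircling \<open>p\<close> once counterclockwise, crossing \<open>seg p\<close> once and missing
  \<open>seg q\<close>.\<close>

definition encircling_loop :: "complex \<Rightarrow> complex \<Rightarrow> complex \<Rightarrow> (real \<Rightarrow> complex) \<Rightarrow> bool" where
  "encircling_loop b p q g \<longleftrightarrow>
     simple_path g \<and> pathstart g = b \<and> pathfinish g = b \<and> path_image g \<subseteq> D2 - {p, q} \<and>
     winding_number g p = 1 \<and> is_singleton (path_image g \<inter> seg p) \<and> path_image g \<inter> seg q = {}"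

text \<open>The classes \<open>x\<^sub>1, x\<^sub>2\<close>. As \<open>p1\<close> lies above \<open>p2\<close>, \<open>b\<close> lies on the right edge and products
  are read from left to right, the sense for which \<open>x\<^sub>1 x\<^sub>2\<close> is the boundary loop is the counterclockwise
  one.\<close>

definition standard_generators ::
  "complex \<Rightarrow> complex \<Rightarrow> complex \<Rightarrow> (real \<Rightarrow> complex) set \<Rightarrow> (real \<Rightarrow> complex) set \<Rightarrow> bool" where
  "standard_generators b p1 p2 x1 x2 \<longleftrightarrow>
     (\<exists>g1 g2 d.
        encircling_loop b p1 p2 g1 \<and> x1 = loop_class (D2 - {p1, p2}) g1 \<and>
        encircling_loop b p2 p1 g2 \<and> x2 = loop_class (D2 - {p1, p2}) g2 \<and>
        simple_path d \<and> pathstart d = b \<and> pathfinish d = b \<and> path_image d = frontier D2 \<and>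
        x1 \<otimes>\<^bsub>pi1 (D2 - {p1, p2}) b\<^esub> x2 = loop_class (D2 - {p1, p2}) d)"

text \<open>An arc, traversed upwards from axis to axis, that together with the axis encloses \<open>p\<close> and
  \<open>seg p\<close> (apart from the end of \<open>seg p\<close> on the axis) but not \<open>q\<close> and \<open>seg q\<close>.\<close>

definition enclosing_arc :: "complex \<Rightarrow> complex \<Rightarrow> (real \<Rightarrow> complex) \<Rightarrow> bool" where
  "enclosing_arc p q a \<longleftrightarrow>
     arc a \<and> path_image a \<subseteq> D2 \<and> path_image a \<inter> axis2 = {pathstart a, pathfinish a} \<and>
     Im (pathstart a) < Im (pathfinish a) \<and>
     path_image a \<inter> (seg p \<union> seg q) = {} \<and>
     (let C = path_image a \<union> closed_segment (pathstart a) (pathfinish a)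
      in seg p - axis2 \<subseteq> inside C \<and> seg q \<inter> (C \<union> inside C) = {})"

text \<open>Parametrisation of the sphere swept out by \<open>a\<close>: concentric squares go to circles of latitude, the
  boundary of the square to \<open>pathstart a\<close> and its centre to \<open>pathfinish a\<close>. Near the centre the
  coordinates \<open>(Re w, Im w)\<close> of the square go to those of the horizontal plane with the same
  orientation, so for an arc traversed upwards, whose end is the north pole, the parametrisation is
  positive for the exterior normal.\<close>

definition rotate_arc :: "(real \<Rightarrow> complex) \<Rightarrow> complex \<Rightarrow> complex \<times> real" where
  "rotate_arc a w = (sgn w * of_real (Re (a (1 - sqnorm w))), Im (a (1 - sqnorm w)))"

text \<open>\<open>K\<close> is the class of the sphere around the circle swept out by \<open>p\<close>, with exterior normal, in the
  complement of the circles swept out by \<open>p\<close> and \<open>q\<close>.\<close>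

definition sphere_around ::
  "complex \<Rightarrow> complex \<Rightarrow> complex \<Rightarrow> (complex \<Rightarrow> complex \<times> real) set \<Rightarrow> bool" where
  "sphere_around b p q K \<longleftrightarrow>
     (\<exists>a \<beta>. enclosing_arc p q a \<and>
        path \<beta> \<and> path_image \<beta> \<subseteq> D3 - (rotate_set (seg p) \<union> rotate_set (seg q)) \<and>
        pathstart \<beta> = emb b \<and> pathfinish \<beta> = emb (pathstart a) \<and>
        K = spheroid_class (D3 - rotate_set {p, q}) (emb b) (transport \<beta> (rotate_arc a)))"

text \<open>The half-twist: some representative is the end of an isotopy of \<open>D2\<close> relative to its
  boundary that starts at the identity and moves \<open>p1\<close> and \<open>p2\<close> into each other's places, with
  \<open>p2\<close> on the axis side of \<open>p1\<close> throughout the motion. When \<open>p1\<close> lies above \<open>p2\<close>, this is the class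
  acting by \<open>x\<^sub>1 \<mapsto> x\<^sub>2\<close>, \<open>x\<^sub>2 \<mapsto> x\<^sub>2\<inverse> x\<^sub>1 x\<^sub>2\<close>.\<close>

definition half_twist :: "complex \<Rightarrow> complex \<Rightarrow> (complex \<Rightarrow> complex) set \<Rightarrow> bool" where
  "half_twist p1 p2 \<tau> \<longleftrightarrow>
     \<tau> \<in> carrier (MCG D2 {p1, p2}) \<and>
     (\<exists>H. continuous_on ({0..1} \<times> D2) (\<lambda>(t, w). H t w) \<and>
        (\<forall>t\<in>{0..1}. H t \<in> homeos D2 {}) \<and>
        (\<forall>w\<in>D2. H 0 w = w) \<and> H 1 \<in> \<tau> \<and>
        H 1 p1 = p2 \<and> H 1 p2 = p1 \<and>
        (\<forall>t\<in>{0<..<1::real}. Re (H t p2) < Re (H t p1)))"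

end

theory Submission
  imports Defs "HOL-Complex_Analysis.Riemann_Mapping"
begin

text \<open>Both homotopy groups are computed in the half-plane that is rotated.

  \<^emph>\<open>From paths to spheres.\<close> A path \<open>a\<close> in the twice punctured square that starts and ends on the axis
  sweeps out a sphere \<open>rotate_arc a\<close>. Homotopies of \<open>a\<close> relative to its ends give homotopies of the sphere
  (\<open>homotopic_rotate_arc_paths\<close>). A piece of \<open>a\<close> at its start that runs in the axis acts as transport of the
  base point (\<open>rotate_arc_whisker\<close>), and such a piece at its end can be dropped (\<open>rotate_arc_tail\<close>). The
  rotation of a homeomorphism \<open>h\<close> takes the sphere of \<open>a\<close> to the sphere of \<open>h \<circ> a\<close>. Hence all that has to be
  known is what the half-twist \<open>h\<close> does to paths in the punctured square.

  \<^emph>\<open>The fundamental group.\<close> Let \<open>p1(t), p2(t)\<close> be the positions of the points during the motion. The complex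
  affine map that sends them to \<open>0\<close> and \<open>1\<close> sends \<open>b\<close> to \<open>(b - p1(t)) / (p2(t) - p1(t))\<close>. Because \<open>p2(t)\<close> stays on
  the axis side of \<open>p1(t)\<close>, and \<open>b\<close> on the other side, this quotient never lies on the ray \<open>[0, \<infinity>)\<close>, so the base
  point moves in a simply connected set. Comparing the two ends of the motion shows that \<open>h\<close> takes \<open>x1\<close> to the
  point reflection of \<open>x1\<close> in the midpoint of \<open>p1\<close> and \<open>p2\<close>, joined to \<open>b\<close> by a path that avoids the ray from
  \<open>p1\<close> away from \<open>p2\<close>. In the complement of such a ray loops around the other point are classified by their
  winding number, and the result is \<open>x2\<close> (\<open>half_twist_generator\<close>). As \<open>x1 x2\<close> is a boundary loop, it is fixed;
  this determines the image of \<open>x2\<close>.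

  \<^emph>\<open>The second homotopy group.\<close> Let \<open>low\<close>, \<open>mid\<close>, \<open>up\<close> lead from \<open>b\<close> to the axis below, between and above the two
  segments. The square slit along the segments and the ball minus the two discs are simply connected, so the
  choices in the definition of \<open>K1\<close> and \<open>K2\<close> do not matter: \<open>K1\<close> is the sphere of \<open>mid\<inverse> up\<close> transported along
  \<open>mid\<close>, and \<open>K2\<close> is the sphere of \<open>low\<inverse> mid\<close> transported along \<open>low\<close>. Now \<open>h\<close> fixes \<open>low\<close>, \<open>up\<close> and the axis, and
  \<open>x1\<close>, \<open>x2\<close> are composed of \<open>low\<close>, \<open>mid\<close>, \<open>up\<close> and pieces of the axis; solving \<open>h(x1) = x2\<close> for \<open>h(mid)\<close> shows that
  \<open>h(low\<inverse> mid)\<close> is \<open>mid\<inverse> up\<close> between two pieces of the axis (\<open>image_of_lower_arc\<close>). Its sphere is thus that of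
  \<open>K1\<close>, transported along \<open>low\<close> and the axis up to the start of \<open>mid\<inverse> up\<close>, which is homotopic to \<open>x2\<inverse> mid\<close>.
  Therefore \<open>K2\<close> goes to \<open>x2\<inverse> \<triangleright> K1\<close>. Finally \<open>K1 + K2\<close> is the sphere of \<open>low\<inverse> up\<close> (\<open>sum_of_spheres\<close>), which lies in
  the boundary and is fixed pointwise. The geometric content of that sum is \<open>homotopic_spheroids_insert\<close>: a
  spheroid that carries a second one at its centre represents a product in the second homotopy group.\<close>

section \<open>Moving loops and winding numbers\<close>
lemma continuous_on_path_compose:
  assumes "path g" "continuous_on S f" "\<And>x. x \<in> S \<Longrightarrow> f x \<in> {0..1}"
  shows "continuous_on S (\<lambda>x. g (f x))"
  by (rule continuous_on_compose2[of "{0..1}" g S f]) (use assms in \<open>auto simp: path_def\<close>)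

text \<open>The square is convex, so one edge is homotopic to the path along the other three; apply \<open>F\<close>.\<close>
lemma homotopic_paths_square:
  fixes F :: "real \<times> real \<Rightarrow> 'a::topological_space"
  assumes cont: "continuous_on ({0..1} \<times> {0..1}) F" and sub: "F ` ({0..1} \<times> {0..1}) \<subseteq> Z"
  shows "homotopic_paths Z (\<lambda>s. F (0, s))
           ((\<lambda>t. F (t, 0)) +++ (\<lambda>s. F (1, s)) +++ reversepath (\<lambda>t. F (t, 1)))"
proof -
  let ?Q = "{0..1::real} \<times> {0..1::real}"
  define p where "p = linepath (0::real, 0::real) (0, 1)"
  define q where "q = linepath (0::real, 0::real) (1, 0) +++ linepath (1, 0) (1, 1) +++ linepath (1, 1) (0, 1)"
  have cvx: "convex ?Q"
    by (intro convex_Times convex_real_interval)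
  have seg: "closed_segment x y \<subseteq> ?Q" if "x \<in> ?Q" "y \<in> ?Q" for x y
    using cvx that convex_contains_segment by blast
  have "homotopic_paths ?Q p q"
  proof -
    have "path_image p \<subseteq> ?Q"
      unfolding p_def path_image_linepath by (rule seg) auto
    moreover have "path_image q \<subseteq> ?Q"
      unfolding q_def by (intro subset_path_image_join; unfold path_image_linepath; rule seg; simp)
    ultimately show ?thesis
      using convex_imp_simply_connected[OF cvx]
      unfolding simply_connected_eq_homotopic_paths by (auto simp: p_def q_def)
  qed
  then have "homotopic_paths Z (F \<circ> p) (F \<circ> q)"
    using cont sub by (intro homotopic_paths_continuous_image) auto
  moreover have "F \<circ> p = (\<lambda>s. F (0, s))"
    by (auto simp: p_def linepath_def)
  moreover have "F \<circ> q = (\<lambda>t. F (t, 0)) +++ (\<lambda>s. F (1, s)) +++ reversepath (\<lambda>t. F (t, 1))"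
    unfolding q_def path_compose_join
    by (auto simp: linepath_def reversepath_def fun_eq_iff joinpaths_def)
  ultimately show ?thesis by simp
qed

text \<open>A deformation of \<open>Y\<close> that starts at the identity detects homotopy of paths by its final map, even if it
  moves the end points: both paths are conjugate to their images by the same two tracks of end points.\<close>
lemma homotopic_paths_deformation:
  fixes D :: "real \<times> 'a::topological_space \<Rightarrow> 'a"
  assumes cont: "continuous_on ({0..1} \<times> Y) D" and sub: "D ` ({0..1} \<times> Y) \<subseteq> Z"
    and D0: "\<And>y. y \<in> Y \<Longrightarrow> D (0, y) = y"
    and g: "path g" "path_image g \<subseteq> Y" and h: "path h" "path_image h \<subseteq> Y"
    and ends: "pathstart h = pathstart g" "pathfinish h = pathfinish g"
    and hom: "homotopic_paths Z ((\<lambda>y. D (1, y)) \<circ> g) ((\<lambda>y. D (1, y)) \<circ> h)"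
  shows "homotopic_paths Z g h"
proof -
  define c where "c = (\<lambda>t. D (t, pathstart g))"
  define d where "d = (\<lambda>t. D (t, pathfinish g))"
  have sq: "homotopic_paths Z k (c +++ ((\<lambda>y. D (1, y)) \<circ> k) +++ reversepath d)"
    if k: "path k" "path_image k \<subseteq> Y" "pathstart k = pathstart g" "pathfinish k = pathfinish g" for k
  proof -
    have kY: "k s \<in> Y" if "s \<in> {0..1}" for s
      using k(2) that by (auto simp: path_image_def)
    have "continuous_on ({0..1} \<times> {0..1}) (\<lambda>z. D (fst z, k (snd z)))"
    proof (rule continuous_on_compose2[OF cont])
      show "continuous_on ({0..1} \<times> {0..1}) (\<lambda>z. (fst z, k (snd z)))"
        by (intro continuous_intros continuous_on_path_compose[OF k(1)]) auto
    qed (use kY in auto)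
    then have *: "homotopic_paths Z (\<lambda>s. D (0, k s))
           ((\<lambda>t. D (t, k 0)) +++ (\<lambda>s. D (1, k s)) +++ reversepath (\<lambda>t. D (t, k 1)))"
      using homotopic_paths_square[of "\<lambda>z. D (fst z, k (snd z))" Z] sub kY by force
    have "homotopic_paths Z k (\<lambda>s. D (0, k s))"
    proof (rule homotopic_paths_sym, rule homotopic_paths_eq)
      show "path (\<lambda>s. D (0, k s))" "path_image (\<lambda>s. D (0, k s)) \<subseteq> Z"
        using * homotopic_paths_imp_path homotopic_paths_imp_subset by blast+
    qed (use D0 kY in auto)
    then show ?thesis
      using * k(3,4) by (auto simp: c_def d_def pathstart_def pathfinish_def o_def intro: homotopic_paths_trans)
  qed
  have "homotopic_paths Z (c +++ ((\<lambda>y. D (1, y)) \<circ> g) +++ reversepath d)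
                          (c +++ ((\<lambda>y. D (1, y)) \<circ> h) +++ reversepath d)"
  proof (intro homotopic_paths_join hom)
    have gY: "pathstart g \<in> Y" "pathfinish g \<in> Y"
      using g by (auto simp: pathstart_def pathfinish_def path_image_def)
    have "path c" "path d"
      unfolding path_def c_def d_def using gY
      by (auto intro!: continuous_on_compose2[OF cont] continuous_intros)
    moreover have "path_image c \<subseteq> Z" "path_image d \<subseteq> Z"
      using sub gY by (auto simp: path_image_def c_def d_def)
    ultimately show "homotopic_paths Z c c" "homotopic_paths Z (reversepath d) (reversepath d)"
      by (auto simp: homotopic_paths_reversepath)
  qed (auto simp: c_def d_def pathstart_def pathfinish_def reversepath_def joinpaths_def)
  then show ?thesis
    using sq[OF g] sq[OF h ends] by (meson homotopic_paths_sym homotopic_paths_trans)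
qed

text \<open>The radial projection to a circle around \<open>p\<close> deforms \<open>\<Omega> - {p}\<close> within itself, and it turns a homotopy in
  the plane punctured at \<open>p\<close>, which the winding numbers provide, into one in \<open>\<Omega> - {p}\<close>.\<close>
lemma loops_in_punctured_star:
  fixes p :: complex
  assumes star: "\<And>w. w \<in> \<Omega> \<Longrightarrow> closed_segment p w \<subseteq> \<Omega>" and e: "0 < e" "sphere p e \<subseteq> \<Omega>"
    and g: "path g" "path_image g \<subseteq> \<Omega> - {p}" and h: "path h" "path_image h \<subseteq> \<Omega> - {p}"
    and ends: "pathstart h = pathstart g" "pathfinish h = pathfinish g"
    and wn: "winding_number g p = winding_number h p"
  shows "homotopic_paths (\<Omega> - {p}) g h"
proof -
  define \<rho> where "\<rho> = (\<lambda>w. p + of_real (e / cmod (w - p)) * (w - p))"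
  have cont\<rho>: "continuous_on (- {p}) \<rho>"
    unfolding \<rho>_def by (intro continuous_intros) auto
  have \<rho>: "\<rho> w \<in> sphere p e" if "w \<noteq> p" for w
    using that e(1) by (simp add: \<rho>_def dist_norm norm_mult norm_divide)
  have ray: "p + of_real a * (w - p) \<in> \<Omega> - {p}" if "w \<in> \<Omega>" "w \<noteq> p" "0 < a" "a \<le> 1" for a w
  proof -
    have "p + of_real a * (w - p) \<in> closed_segment p w"
      using that unfolding in_segment by (intro exI[of _ a]) (auto simp: algebra_simps scaleR_conv_of_real)
    then show ?thesis using star[OF that(1)] that by auto
  qed
  define D where "D = (\<lambda>(t, w). p + of_real (1 - t + t * e / cmod (w - p)) * (w - p))"
  show ?thesis
  proof (rule homotopic_paths_deformation[where D = D and Y = "\<Omega> - {p}"])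
    show "continuous_on ({0..1} \<times> (\<Omega> - {p})) D"
      unfolding D_def case_prod_unfold by (intro continuous_intros) auto
    show "D ` ({0..1} \<times> (\<Omega> - {p})) \<subseteq> \<Omega> - {p}"
    proof (rule image_subsetI)
      fix z assume "z \<in> {0..1::real} \<times> (\<Omega> - {p})"
      then obtain t w where z: "z = (t, w)" and t: "t \<in> {0..1::real}" and "w \<in> \<Omega> - {p}" by blast
      then have w: "w \<in> \<Omega>" "w \<noteq> p" by auto
      let ?n = "cmod (w - p)"
      let ?a = "1 - t + t * e / ?n"
      have n: "?n > 0" using w by simp
      have pos: "?a > 0"
        using t n e(1) by (cases "t = 1") (auto intro!: add_pos_nonneg)
      \<comment> \<open>The point lies between \<open>p\<close> and the farther one of \<open>w\<close> and \<open>\<rho> w\<close>.\<close>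
      have "p + of_real ?a * (w - p) \<in> \<Omega> - {p}"
      proof (cases "e \<le> ?n")
        case True
        have "e / ?n \<le> 1" using True n by simp
        then have "t * (e / ?n) \<le> t * 1"
          using t by (intro mult_left_mono) auto
        then have "?a \<le> 1" by simp
        then show ?thesis using ray w pos by blast
      next
        case False
        have s: "\<rho> w \<in> \<Omega>" "\<rho> w \<noteq> p"
          using \<rho>[OF w(2)] e by auto
        have "?a * ?n \<le> e"
        proof -
          have "?a * ?n = (1 - t) * ?n + t * e" using n by (simp add: field_simps)
          also have "\<dots> \<le> (1 - t) * e + t * e"
            using False t by (intro add_right_mono mult_left_mono) auto
          finally show ?thesis by (simp add: algebra_simps)
        qed
        then have "?a * ?n / e \<le> 1" "?a * ?n / e > 0"
          using e(1) pos n by (auto intro!: divide_pos_pos mult_pos_pos)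
        then have "p + of_real (?a * ?n / e) * (\<rho> w - p) \<in> \<Omega> - {p}"
          using ray[OF s] by blast
        also have "of_real (?a * ?n / e) * (\<rho> w - p) = of_real ?a * (w - p)"
          using n e(1) by (simp add: \<rho>_def)
        finally show ?thesis .
      qed
      then show "D z \<in> \<Omega> - {p}"
        by (simp add: D_def z)
    qed
    have "homotopic_paths (- {p}) g h"
      using winding_number_homotopic_paths_eq[of g p h] g h ends wn by auto
    then have "homotopic_paths (\<Omega> - {p}) (\<rho> \<circ> g) (\<rho> \<circ> h)"
      using cont\<rho> \<rho> e by (elim homotopic_paths_continuous_image) force+
    moreover have "(\<lambda>y. D (1, y)) = \<rho>"
      by (simp add: D_def \<rho>_def)
    ultimately show "homotopic_paths (\<Omega> - {p}) ((\<lambda>y. D (1, y)) \<circ> g) ((\<lambda>y. D (1, y)) \<circ> h)"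
      by simp
  qed (use g h ends in \<open>auto simp: D_def\<close>)
qed

text \<open>The ray from \<open>q\<close> away from \<open>p\<close>: what cannot be seen from \<open>p\<close> if \<open>q\<close> is opaque. Its complement is starlike
  about \<open>p\<close>.\<close>
definition shadow :: "complex \<Rightarrow> complex \<Rightarrow> complex set" where
  "shadow p q = {q + of_real t * (q - p) | t. 0 \<le> t}"

lemma loops_avoiding_shadow:
  fixes p q :: complex
  assumes "p \<noteq> q"
    and g: "path g" "path_image g \<subseteq> - shadow p q - {p}" and h: "path h" "path_image h \<subseteq> - shadow p q - {p}"
    and ends: "pathstart h = pathstart g" "pathfinish h = pathfinish g"
    and wn: "winding_number g p = winding_number h p"
  shows "homotopic_paths (- {p, q}) g h"
proof -
  have "homotopic_paths (- shadow p q - {p}) g h"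
  proof (rule loops_in_punctured_star[where e = "cmod (q - p) / 2"])
    fix w assume w: "w \<in> - shadow p q"
    show "closed_segment p w \<subseteq> - shadow p q"
    proof clarify
      fix z assume "z \<in> closed_segment p w" "z \<in> shadow p q"
      then obtain s t where s: "0 \<le> s" "s \<le> 1" "z = (1 - s) *\<^sub>R p + s *\<^sub>R w" and t: "0 \<le> t" "z = q + of_real t * (q - p)"
        by (auto simp: in_segment shadow_def)
      have eq: "of_real s * (w - p) = of_real (1 + t) * (q - p)"
        using s t by (simp add: algebra_simps scaleR_conv_of_real)
      have "s \<noteq> 0"
      proof
        assume "s = 0"
        then have "of_real (1 + t) * (q - p) = 0" using eq by simp
        then have "1 + t = 0" using assms(1) by (metis eq_iff_diff_eq_0 mult_eq_0_iff of_real_eq_0_iff)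
        then show False using t by simp
      qed
      then have "w = p + of_real ((1 + t) / s) * (q - p)"
        using eq by (simp add: field_simps)
      also have "\<dots> = q + of_real ((1 + t) / s - 1) * (q - p)"
        by (simp add: algebra_simps)
      finally have "w \<in> shadow p q"
        unfolding shadow_def using s t \<open>s \<noteq> 0\<close> by (auto intro!: exI[of _ "(1 + t) / s - 1"] simp: field_simps)
      then show False using w by simp
    qed
  next
    show "sphere p (cmod (q - p) / 2) \<subseteq> - shadow p q"
    proof clarify
      fix z assume "z \<in> sphere p (cmod (q - p) / 2)" "z \<in> shadow p q"
      then obtain t where t: "0 \<le> t" "z = q + of_real t * (q - p)" and d: "cmod (z - p) = cmod (q - p) / 2"
        by (auto simp: shadow_def dist_norm norm_minus_commute)
      have "z - p = of_real (1 + t) * (q - p)" using t by (simp add: algebra_simps)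
      then have "cmod (z - p) = (1 + t) * cmod (q - p)" using t by (simp add: norm_mult del: of_real_add)
      then have "(1/2 + t) * cmod (q - p) = 0" using d by (simp add: algebra_simps)
      then show False using t assms(1) by simp
    qed
  qed (use assms in auto)
  then show ?thesis
    by (rule homotopic_paths_subset) (auto simp: shadow_def intro: exI[of _ 0])
qed

lemma D2_alt: "w \<in> D2 \<longleftrightarrow> 0 \<le> Re w \<and> Re w \<le> 1 \<and> 0 \<le> Im w \<and> Im w \<le> 1"
  by (auto simp: D2_def in_cbox_complex_iff)

lemma interior_D2: "w \<in> interior D2 \<longleftrightarrow> 0 < Re w \<and> Re w < 1 \<and> 0 < Im w \<and> Im w < 1"
  by (auto simp: D2_def interior_cbox in_box_complex_iff)

lemma closed_D2: "closed D2" and convex_D2: "convex D2" and compact_D2: "compact D2"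
  by (auto simp: D2_def)

lemma frontier_D2: "w \<in> frontier D2 \<longleftrightarrow> w \<in> D2 \<and> (Re w = 0 \<or> Re w = 1 \<or> Im w = 0 \<or> Im w = 1)"
  using closed_D2 interior_D2[of w] by (auto simp: frontier_def D2_alt)

lemma seg_alt: "0 \<le> Re p \<Longrightarrow> w \<in> seg p \<longleftrightarrow> 0 \<le> Re w \<and> Re w \<le> Re p \<and> Im w = Im p"
proof -
  assume "0 \<le> Re p"
  then show ?thesis
    unfolding seg_def closed_segment_same_Im[of p "Complex 0 (Im p)", simplified]
    by (auto simp: closed_segment_eq_real_ivl)
qed

text \<open>The nearest-point projection to \<open>C\<close> moves no point of \<open>C\<close> and sends the points outside \<open>C\<close> to its boundary,
  hence never to \<open>P\<close>. It allows the unbounded plane to be used in arguments about the square.\<close>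
lemma homotopic_paths_retract_to_convex:
  fixes C :: "'a::euclidean_space set"
  assumes C: "closed C" "convex C" and P: "P \<subseteq> interior C"
    and hom: "homotopic_paths (- P) g h" and im: "path_image g \<subseteq> C" "path_image h \<subseteq> C"
  shows "homotopic_paths (C - P) g h"
proof (cases "C = {}")
  case True
  then show ?thesis using im path_image_nonempty by blast
next
  case False
  let ?r = "closest_point C"
  have "homotopic_paths (C - P) (?r \<circ> g) (?r \<circ> h)"
  proof (rule homotopic_paths_continuous_image[OF hom])
    show "continuous_on (- P) ?r"
      using continuous_on_closest_point[OF C(2,1) False] .
    show "?r \<in> - P \<rightarrow> C - P"
    proof
      fix x assume x: "x \<in> - P"
      show "?r x \<in> C - P"
      proof (cases "x \<in> C")
        case True
        then show ?thesis using x by (simp add: closest_point_self)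
      next
        case x': False
        have "?r x \<notin> interior C"
        proof
          assume *: "?r x \<in> interior C"
          then have "interior C \<noteq> {}" by auto
          then have "rel_interior C = interior C" "affine hull C = UNIV"
            using rel_interior_nonempty_interior affine_hull_nonempty_interior by auto
          then have "x \<in> interior C"
            using closest_point_in_rel_interior[OF C(1) False, of x] * by simp
          then show False using x' interior_subset by blast
        qed
        then show ?thesis
          using P C(1) False closest_point_in_set[of C x] by auto
      qed
    qed
  qed
  moreover have *: "homotopic_paths (C - P) k (?r \<circ> k)" if "path k" "path_image k \<subseteq> C - P" for k
    using that by (intro homotopic_paths_eq) (auto simp: path_image_def closest_point_self image_subset_iff)
  moreover have "homotopic_paths (C - P) g (?r \<circ> g)" "homotopic_paths (C - P) h (?r \<circ> h)"
    using homotopic_paths_imp_path[OF hom] homotopic_paths_imp_subset[OF hom] im by (intro *; blast)+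
  ultimately show ?thesis
    using homotopic_paths_sym homotopic_paths_trans by metis
qed

text \<open>Loops that miss the slit \<open>seg q\<close> are classified by their winding number about \<open>p\<close>. The complement of the
  slit is not starlike about \<open>p\<close>, but a horizontal shear takes it into the complement of the shadow of \<open>q\<close>:
  points are pushed away from the axis by an amount that vanishes at the height of \<open>p\<close>, is \<open>1\<close> at that of \<open>q\<close>,
  and keeps growing beyond \<open>q\<close>.\<close>
lemma loops_around_unique:
  assumes pq: "p \<in> interior D2" "q \<in> interior D2" "Re p = Re q" "Im p \<noteq> Im q"
    and g: "path g" "path_image g \<subseteq> D2 - seg q - {p}" and h: "path h" "path_image h \<subseteq> D2 - seg q - {p}"
    and ends: "pathfinish g = pathstart g" "pathstart h = pathstart g" "pathfinish h = pathstart g"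
    and wn: "winding_number g p = winding_number h p"
  shows "homotopic_paths (D2 - {p, q}) g h"
proof -
  let ?Y = "D2 - seg q - {p}"
  define \<mu> where "\<mu> = (\<lambda>v. max 0 ((v - Im p) / (Im q - Im p)))"
  define D where "D = (\<lambda>(t::real, w). w + of_real (t * \<mu> (Im w)))"
  have bnds: "0 < Re q" "Re q < 1" using pq by (auto simp: interior_D2)
  have \<mu>0: "\<mu> v \<ge> 0" for v by (simp add: \<mu>_def)
  have contD: "continuous_on ({0..1} \<times> ?Y) D"
    unfolding D_def \<mu>_def case_prod_unfold using pq(4) by (intro continuous_intros) auto
  have imD: "D ` ({0..1} \<times> ?Y) \<subseteq> - {p, q}"
  proof (rule image_subsetI, rule ccontr)
    fix z assume z: "z \<in> {0..1::real} \<times> ?Y" "D z \<notin> - {p, q}"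
    then obtain t w where t: "t \<in> {0..1::real}" and w: "w \<in> D2" "w \<notin> seg q" "w \<noteq> p" "D (t, w) \<notin> - {p, q}"
      by (cases z) auto
    have Im: "Im (D (t, w)) = Im w" and Re: "Re (D (t, w)) = Re w + t * \<mu> (Im w)" by (auto simp: D_def)
    have "t * \<mu> (Im w) \<ge> 0" using t \<mu>0 by simp
    from w(4) consider "D (t, w) = p" | "D (t, w) = q" by auto
    then show False
    proof cases
      case 1
      then have "Im w = Im p" using Im by simp
      then have "\<mu> (Im w) = 0" by (simp add: \<mu>_def)
      then show False using 1 w by (simp add: D_def)
    next
      case 2
      then have "Im w = Im q" "Re w \<le> Re q" using Im Re \<open>t * \<mu> (Im w) \<ge> 0\<close> by auto
      then show False using w bnds by (auto simp: seg_alt D2_alt)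
    qed
  qed
  let ?\<rho> = "\<lambda>w. D (1, w)"
  have im\<rho>: "?\<rho> ` ?Y \<subseteq> - shadow p q - {p}"
  proof (rule image_subsetI, rule ccontr)
    fix w assume "w \<in> ?Y" and w4: "?\<rho> w \<notin> - shadow p q - {p}"
    then have w: "w \<in> D2" "w \<notin> seg q" "w \<noteq> p"  "?\<rho> w \<notin> - shadow p q - {p}" by auto
    have Im: "Im (?\<rho> w) = Im w" and Re: "Re (?\<rho> w) = Re w + \<mu> (Im w)" by (auto simp: D_def)
    have "?\<rho> w \<noteq> p" using imD w by force
    then have "?\<rho> w \<in> shadow p q" using w(4) by auto
    then obtain t where t: "t \<ge> 0" "?\<rho> w = q + of_real t * (q - p)"
      by (auto simp: shadow_def)
    have "Re (?\<rho> w) = Re q" "Im w = Im q + t * (Im q - Im p)"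
      using t pq(3) Im by simp_all
    then have "(Im w - Im p) / (Im q - Im p) = 1 + t" using pq(4) by (simp add: divide_simps) (simp add: algebra_simps)
    then have "\<mu> (Im w) = max 0 (1 + t)" by (simp add: \<mu>_def)
    then have "Re (?\<rho> w) \<ge> 1" using Re t w by (simp add: D2_alt)
    then show False using bnds \<open>Re (?\<rho> w) = Re q\<close> by simp
  qed
  have cont\<rho>: "continuous_on ?Y ?\<rho>"
    by (rule continuous_on_compose2[OF contD]) (auto intro!: continuous_intros)
  have wn\<rho>: "winding_number (?\<rho> \<circ> k) p = winding_number k p"
    if k: "path k" "path_image k \<subseteq> ?Y" "pathfinish k = pathstart k" for k
  proof (rule winding_number_homotopic_loops[symmetric])
    have kY: "k s \<in> ?Y" if "s \<in> {0..1}" for s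
      using k(2) that unfolding path_image_def by blast
    have "continuous_on ({0..1} \<times> {0..1}) (\<lambda>z. D (fst z, k (snd z)))"
    proof (rule continuous_on_compose2[OF contD])
      show "continuous_on ({0..1} \<times> {0..1}) (\<lambda>z. (fst z, k (snd z)))"
        by (intro continuous_intros continuous_on_path_compose[OF k(1)]) auto
      show "(\<lambda>z. (fst z, k (snd z))) ` ({0..1} \<times> {0..1}) \<subseteq> {0..1} \<times> ?Y"
        by (intro image_subsetI SigmaI kY) auto
    qed
    then show "homotopic_loops (- {p}) k (?\<rho> \<circ> k)"
      unfolding homotopic_loops
    proof (intro exI[of _ "\<lambda>z. D (fst z, k (snd z))"] conjI ballI Pi_I)
      fix z assume z: "z \<in> {0..1::real} \<times> {0..1::real}"
      then have "D (fst z, k (snd z)) \<in> D ` ({0..1} \<times> ?Y)"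
        by (intro imageI SigmaI kY) auto
      then show "D (fst z, k (snd z)) \<in> - {p}" using imD by blast
    qed (use k(3) in \<open>auto simp: D_def pathstart_def pathfinish_def\<close>)
  qed
  have "homotopic_paths (- {p, q}) (?\<rho> \<circ> g) (?\<rho> \<circ> h)"
  proof (rule loops_avoiding_shadow)
    show "path (?\<rho> \<circ> g)" "path (?\<rho> \<circ> h)"
      using g h cont\<rho> by (auto intro!: path_continuous_image intro: continuous_on_subset)
    show "path_image (?\<rho> \<circ> g) \<subseteq> - shadow p q - {p}" "path_image (?\<rho> \<circ> h) \<subseteq> - shadow p q - {p}"
      using g h im\<rho> unfolding path_image_compose by blast+
    show "winding_number (?\<rho> \<circ> g) p = winding_number (?\<rho> \<circ> h) p"
      using wn\<rho> g h ends wn by simp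
  qed (use pq ends in \<open>auto simp: pathstart_compose pathfinish_compose\<close>)
  then have "homotopic_paths (- {p, q}) g h"
    using homotopic_paths_deformation[OF contD imD _ g h] ends by (auto simp: D_def)
  then show ?thesis
    using g h pq by (intro homotopic_paths_retract_to_convex closed_D2 convex_D2) auto
qed

text \<open>The point reflection is a rotation by \<open>\<pi>\<close>, and rotating gradually is a homotopy of loops.\<close>
lemma winding_number_point_reflection:
  assumes "path g" "p \<notin> path_image g" "pathfinish g = pathstart g"
  shows "winding_number (\<lambda>s. q - (g s - p)) q = winding_number g p"
proof -
  let ?h = "\<lambda>s. g s - p"
  have "homotopic_loops (- {0}) ?h (\<lambda>s. - ?h s)"
    unfolding homotopic_loops
  proof (intro exI conjI ballI)
    show "continuous_on ({0..1} \<times> {0..1}) (\<lambda>z. exp (\<i> * of_real (pi * fst z)) * ?h (snd z))"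
      by (intro continuous_intros continuous_on_path_compose[OF assms(1)]) auto
    show "(\<lambda>z. exp (\<i> * of_real (pi * fst z)) * ?h (snd z)) \<in> {0..1} \<times> {0..1} \<rightarrow> - {0}"
      using assms(2) by (auto simp: path_image_def)
  qed (use assms(3) in \<open>auto simp: pathstart_def pathfinish_def mult.commute\<close>)
  then have "winding_number ?h 0 = winding_number (\<lambda>s. - ?h s) 0"
    by (rule winding_number_homotopic_loops)
  then show ?thesis
    using winding_number_offset[of g p] winding_number_offset[of "\<lambda>s. q - (g s - p)" q] by simp
qed

text \<open>The half-twist seen from the moving pair of points. At time \<open>t\<close> the affine map that takes the positions of
  \<open>p1\<close> and \<open>p2\<close> to their final positions \<open>p2\<close> and \<open>p1\<close> is applied to the moving loop; this keeps it off both
  points. At time \<open>1\<close> this affine map is the identity, at time \<open>0\<close> it is the point reflection in the midpoint. The image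
  of \<open>b\<close> never meets the ray from \<open>p2\<close> through \<open>p1\<close>, because in the affine picture that would put \<open>p2\<close> on the
  same side of \<open>p1\<close> as \<open>b\<close>.\<close>
lemma half_twist_loop:
  assumes p: "p1 \<in> interior D2" "p2 \<in> interior D2" "Re p1 = Re p2" "Im p1 \<noteq> Im p2"
    and b: "b \<in> D2" "Re b = 1"
    and contH: "continuous_on ({0..1} \<times> D2) (\<lambda>(t, w). H t w)"
    and homeo: "\<And>t. t \<in> {0..1} \<Longrightarrow> H t \<in> homeos D2 {}"
    and H0: "\<And>w. w \<in> D2 \<Longrightarrow> H 0 w = w" and H1: "H 1 p1 = p2" "H 1 p2 = p1"
    and side: "\<And>t::real. t \<in> {0<..<1} \<Longrightarrow> Re (H t p2) < Re (H t p1)"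
    and l: "path l" "pathstart l = b" "pathfinish l = b" "path_image l \<subseteq> D2 - shadow p1 p2 - {p1}"
      "winding_number l p1 = w"
    and k: "path k" "pathstart k = b" "pathfinish k = b" "path_image k \<subseteq> D2 - shadow p2 p1 - {p2}"
      "winding_number k p2 = w"
  shows "homotopic_paths (D2 - {p1, p2}) (H 1 \<circ> l) k"
proof -
  have pD: "p1 \<in> D2" "p2 \<in> D2" using p interior_subset by blast+
  have ne: "p1 \<noteq> p2" using p(4) by auto
  have bfr: "b \<in> frontier D2" using b by (simp add: frontier_D2)
  define v where "v = (\<lambda>t. H t p2 - H t p1)"
  have inj: "inj_on (H t) D2" and maps: "H t ` D2 = D2" and fixed: "\<And>z. z \<in> frontier D2 \<Longrightarrow> H t z = z"
    if "t \<in> {0..1}" for t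
    using homeo[OF that] unfolding homeos_def homeomorphism_def by (auto intro: inj_on_inverseI)
  have contHz: "continuous_on S (\<lambda>x. H (f x) (z x))"
    if "continuous_on S f" "continuous_on S z" "\<And>x. x \<in> S \<Longrightarrow> f x \<in> {0..1}" "\<And>x. x \<in> S \<Longrightarrow> z x \<in> D2"
    for S :: "(real \<times> real) set" and f z
  proof -
    have "continuous_on S (\<lambda>x. (\<lambda>(t, w). H t w) (f x, z x))"
      by (rule continuous_on_compose2[OF contH]) (use that in \<open>auto intro!: continuous_on_Pair\<close>)
    then show ?thesis by simp
  qed
  have int: "Re (H t p1) < 1" if "t \<in> {0..1}" for t
  proof -
    have "H t p1 \<notin> frontier D2"
    proof
      assume fr: "H t p1 \<in> frontier D2"
      then have "H t (H t p1) = H t p1" using fixed[OF that] by simp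
      then have "H t p1 = p1" using inj[OF that] pD fr by (auto simp: frontier_D2 dest: inj_onD)
      then show False using fr p(1) by (simp add: frontier_def)
    qed
    moreover have "H t p1 \<in> D2" using maps[OF that] pD by auto
    ultimately show ?thesis by (auto simp: frontier_D2 D2_alt)
  qed
  have v: "v t \<noteq> 0" "Re (v t) \<le> 0" if t: "t \<in> {0..1}" for t
  proof -
    consider "t = 0" | "t = 1" | "t \<in> {0<..<1}" using t by (cases "t = 0"; cases "t = 1") auto
    then have "v t \<noteq> 0 \<and> Re (v t) \<le> 0"
    proof cases
      case 3 then show ?thesis using side[OF 3] by (auto simp: v_def)
    qed (use H0 H1 pD p ne in \<open>auto simp: v_def\<close>)
    then show "v t \<noteq> 0" "Re (v t) \<le> 0" by auto
  qed
  have lD: "l s \<in> D2" "l s \<noteq> p1" "l s \<noteq> p2" "l s \<notin> shadow p1 p2" if "s \<in> {0..1}" for s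
  proof -
    have "p2 \<in> shadow p1 p2" by (auto simp: shadow_def intro: exI[of _ 0])
    then show "l s \<in> D2" "l s \<noteq> p1" "l s \<noteq> p2" "l s \<notin> shadow p1 p2"
      using l(4) that unfolding path_image_def by blast+
  qed
  \<comment> \<open>Time runs backwards, so that \<open>F (0, s)\<close> runs through the image under the half-twist.\<close>
  define F where "F = (\<lambda>z. p2 + (p1 - p2) * (H (1 - fst z) (l (snd z)) - H (1 - fst z) p1) / v (1 - fst z))"
  have contF: "continuous_on ({0..1} \<times> {0..1}) F"
    unfolding F_def v_def using lD v pD unfolding v_def
    by (intro continuous_intros contHz continuous_on_path_compose[OF l(1)]) auto
  have imF: "F ` ({0..1} \<times> {0..1}) \<subseteq> - {p1, p2}"
  proof (rule image_subsetI, rule ccontr)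
    fix z assume "z \<in> {0..1::real} \<times> {0..1::real}" "F z \<notin> - {p1, p2}"
    then obtain t s where ts: "t \<in> {0..1::real}" "s \<in> {0..1::real}" and F: "F (t, s) \<notin> - {p1, p2}"
      by (cases z) auto
    have t': "1 - t \<in> {0..1}" using ts by simp
    have "H (1 - t) (l s) \<noteq> H (1 - t) p1" "H (1 - t) (l s) \<noteq> H (1 - t) p2"
      using inj[OF t'] lD[OF ts(2)] pD by (auto dest: inj_onD)
    moreover have "F (t, s) = p1 \<longleftrightarrow> H (1 - t) (l s) - H (1 - t) p1 = v (1 - t)"
    proof -
      have "F (t, s) = p1 \<longleftrightarrow> (p1 - p2) * (H (1 - t) (l s) - H (1 - t) p1) = (p1 - p2) * v (1 - t)"
        using v(1)[OF t'] by (auto simp: F_def field_simps)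
      then show ?thesis using ne by simp
    qed
    moreover have "F (t, s) = p2 \<longleftrightarrow> H (1 - t) (l s) = H (1 - t) p1"
      using v(1)[OF t'] ne by (auto simp: F_def)
    ultimately show False using F by (auto simp: v_def)
  qed
  define c where "c = (\<lambda>t. F (t, 0))"
  define r where "r = (\<lambda>s. p2 - (l s - p1))"
  have l01: "l 0 = b" "l 1 = b" using l by (auto simp: pathstart_def pathfinish_def)
  have F0: "F (0, s) = H 1 (l s)" for s
    using ne H1 by (auto simp: F_def v_def)
  have F1: "F (1, s) = r s" if "s \<in> {0..1}" for s
  proof -
    have "F (1, s) = p2 + (p1 - p2) * ((l s - p1) / (p2 - p1))"
      using H0 pD lD[OF that] by (simp add: F_def v_def)
    also have "(p1 - p2) * ((l s - p1) / (p2 - p1)) = - (l s - p1)"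
      using ne by (simp add: divide_simps) (simp add: algebra_simps)
    finally show ?thesis by (simp add: r_def)
  qed
  have "homotopic_paths (- {p1, p2}) (\<lambda>s. F (0, s))
           ((\<lambda>t. F (t, 0)) +++ (\<lambda>s. F (1, s)) +++ reversepath (\<lambda>t. F (t, 1)))"
    by (rule homotopic_paths_square[OF contF imF])
  moreover have "(\<lambda>t. F (t, 1)) = c" by (simp add: c_def F_def l01)
  ultimately have hom1: "homotopic_paths (- {p1, p2}) (H 1 \<circ> l) (c +++ (\<lambda>s. F (1, s)) +++ reversepath c)"
    by (simp add: c_def F0 o_def)
  have pathc: "path c" unfolding path_def c_def
    by (rule continuous_on_compose2[OF contF]) (auto intro!: continuous_intros)
  have pathr: "path r" using l(1) unfolding r_def path_def by (intro continuous_intros)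
  have hom2: "homotopic_paths (- {p1, p2}) (c +++ (\<lambda>s. F (1, s)) +++ reversepath c) (c +++ r +++ reversepath c)"
  proof (intro homotopic_paths_join)
    have "path (\<lambda>s. F (1, s))" unfolding path_def
      by (rule continuous_on_compose2[OF contF]) (auto intro!: continuous_intros)
    moreover have "path_image (\<lambda>s. F (1, s)) \<subseteq> F ` ({0..1} \<times> {0..1})"
      by (auto simp: path_image_def)
    ultimately show "homotopic_paths (- {p1, p2}) (\<lambda>s. F (1, s)) r"
      using imF F1 by (intro homotopic_paths_eq) auto
    have "path_image c \<subseteq> F ` ({0..1} \<times> {0..1})"
      by (auto simp: path_image_def c_def)
    then have "path_image c \<subseteq> - {p1, p2}" using imF by blast
    then show "homotopic_paths (- {p1, p2}) c c" "homotopic_paths (- {p1, p2}) (reversepath c) (reversepath c)"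
      using pathc by auto
  qed (auto simp: c_def pathstart_def pathfinish_def reversepath_def joinpaths_def F_def l01)
  have c_im: "path_image c \<subseteq> - shadow p2 p1 - {p2}"
  proof (rule subsetI, rule ccontr)
    fix z assume z: "z \<in> path_image c" "z \<notin> - shadow p2 p1 - {p2}"
    then obtain t where t: "t \<in> {0..1}" "z = F (t, 0)" unfolding path_image_def c_def by auto
    have t': "1 - t \<in> {0..1}" using t by simp
    have "z \<noteq> p2" using imF t by force
    then obtain \<tau> where \<tau>: "\<tau> \<ge> 0" "z = p1 + of_real \<tau> * (p1 - p2)"
      using z(2) by (auto simp: shadow_def)
    have "(p1 - p2) * (b - H (1 - t) p1) = (p1 - p2) * (of_real (1 + \<tau>) * v (1 - t))"
      using \<tau> t v(1)[OF t'] fixed[OF t' bfr] l01 unfolding F_def by (simp add: field_simps)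
    then have "b - H (1 - t) p1 = of_real (1 + \<tau>) * v (1 - t)"
      using ne by simp
    \<comment> \<open>The left side is positive, as \<open>H\<close> keeps \<open>p1\<close> inside the square; the right side is not.\<close>
    then have "1 - Re (H (1 - t) p1) = (1 + \<tau>) * Re (v (1 - t))"
      using b(2) by (metis Re_complex_of_real complex_Re_le_cmod minus_complex.sel(1) times_complex.sel(1) Im_complex_of_real mult_zero_left diff_zero)
    moreover have "(1 + \<tau>) * Re (v (1 - t)) \<le> 0" using \<tau> v(2)[OF t'] by (simp add: mult_nonneg_nonpos)
    ultimately show False using int[OF t'] by linarith
  qed
  have r_im: "path_image r \<subseteq> - shadow p2 p1 - {p2}"
  proof (rule subsetI, rule ccontr)
    fix z assume z: "z \<in> path_image r" "z \<notin> - shadow p2 p1 - {p2}"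
    then obtain s where s: "s \<in> {0..1}" "z = r s" unfolding path_image_def by auto
    have "z \<noteq> p2" using s lD by (auto simp: r_def)
    then obtain \<tau> where \<tau>: "\<tau> \<ge> 0" "z = p1 + of_real \<tau> * (p1 - p2)"
      using z(2) by (auto simp: shadow_def)
    then have "l s = p2 + of_real \<tau> * (p2 - p1)" using s by (simp add: r_def algebra_simps)
    then show False using lD(4)[OF s(1)] \<tau> by (auto simp: shadow_def)
  qed
  have ends: "pathfinish c = pathstart r" "pathfinish r = pathfinish c" "pathstart c = b"
    using F1[of 0] l01 F0[of 0] fixed[OF _ bfr] by (auto simp: c_def r_def pathstart_def pathfinish_def)
  have "homotopic_paths (- {p2, p1}) (c +++ r +++ reversepath c) k"
  proof (rule loops_avoiding_shadow)
    have c2: "p2 \<notin> path_image c" "p2 \<notin> path_image r" using c_im r_im by blast+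
    have wr: "winding_number r p2 = w"
      unfolding r_def using l by (subst winding_number_point_reflection) auto
    have "winding_number (r +++ reversepath c) p2 = w - winding_number c p2"
      using pathc pathr c2 ends wr by (simp add: winding_number_join winding_number_reversepath)
    then show "winding_number (c +++ r +++ reversepath c) p2 = winding_number k p2"
      using pathc pathr c2 ends k(5)
      by (subst winding_number_join) (auto simp: not_in_path_image_join)
    show "path_image (c +++ r +++ reversepath c) \<subseteq> - shadow p2 p1 - {p2}"
      using c_im r_im by (intro subset_path_image_join) auto
    show "path_image k \<subseteq> - shadow p2 p1 - {p2}" using k by auto
  qed (use ne pathc pathr k ends in auto)
  then have "homotopic_paths (- {p1, p2}) (H 1 \<circ> l) k"
    using hom1 hom2 by (metis homotopic_paths_trans insert_commute)
  show ?thesis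
  proof (rule homotopic_paths_retract_to_convex[OF closed_D2 convex_D2 _ \<open>homotopic_paths (- {p1, p2}) (H 1 \<circ> l) k\<close>])
    show "path_image (H 1 \<circ> l) \<subseteq> D2"
      using maps[of 1] l(4) unfolding path_image_compose by auto
  qed (use p k in auto)
qed

text \<open>A segment from \<open>b\<close> to a small circle around \<open>p\<close>, the circle, and the way back. This loop avoids both the
  slit and the shadow of \<open>q\<close>, and thereby links the two classifications by winding number.\<close>
lemma exists_lollipop:
  assumes p: "p \<in> interior D2" "Re p = Re q" "Im p \<noteq> Im q" "0 < Re q" and b: "b \<in> D2" "Re b = 1"
  obtains l where "path l" "pathstart l = b" "pathfinish l = b"
    "path_image l \<subseteq> D2 - shadow p q - seg q - {p}" "winding_number l p = 1"
proof -
  obtain e where e: "e > 0" "ball p e \<subseteq> D2"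
    using p(1) mem_interior by blast
  define \<rho> where "\<rho> = min e \<bar>Im p - Im q\<bar> / 2"
  have \<rho>: "0 < \<rho>" "\<rho> < e" "\<rho> < \<bar>Im p - Im q\<bar>" using e p by (auto simp: \<rho>_def min_def)
  have bad: "\<bar>Im z - Im p\<bar> \<ge> \<bar>Im p - Im q\<bar>" "Re z \<le> Re q" if "z \<in> shadow p q \<union> seg q" for z
  proof -
    have "\<bar>Im z - Im p\<bar> \<ge> \<bar>Im p - Im q\<bar> \<and> Re z \<le> Re q"
    proof (cases "z \<in> seg q")
      case True then show ?thesis using seg_alt[of q z] p by auto
    next
      case False
      then have "z \<in> shadow p q" using that by simp
      then obtain t where t: "t \<ge> 0" "z = q + of_real t * (q - p)" by (auto simp: shadow_def)
      have "Re z = Re q" using t p(2) by simp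
      have "Im z - Im p = (1 + t) * (Im q - Im p)" unfolding t(2) by (simp add: algebra_simps)
      then have "\<bar>Im z - Im p\<bar> = (1 + t) * \<bar>Im q - Im p\<bar>" using t(1) by (simp add: abs_mult)
      moreover have "(1 + t) * \<bar>Im q - Im p\<bar> \<ge> 1 * \<bar>Im q - Im p\<bar>" using t(1) by (intro mult_right_mono) auto
      ultimately show ?thesis using \<open>Re z = Re q\<close> by (simp add: abs_minus_commute)
    qed
    then show "\<bar>Im z - Im p\<bar> \<ge> \<bar>Im p - Im q\<bar>" "Re z \<le> Re q" by auto
  qed
  let ?a = "linepath b (p + \<rho>)" and ?c = "circlepath p \<rho>"
  have p\<rho>: "p + \<rho> \<in> D2" using e(2) \<rho> by (intro subsetD[OF e(2)]) (simp add: dist_norm)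
  have c_im: "path_image ?c = sphere p \<rho>" using \<rho> by simp
  have cD: "path_image ?c \<subseteq> D2 - shadow p q - seg q - {p}"
  proof
    fix z assume "z \<in> path_image ?c"
    then have d: "cmod (z - p) = \<rho>" unfolding c_im by (simp add: dist_norm norm_minus_commute)
    then have "z \<in> D2" using \<rho> e(2) by (auto simp: dist_norm norm_minus_commute subset_iff)
    moreover have "\<bar>Im z - Im p\<bar> \<le> \<rho>" using abs_Im_le_cmod[of "z - p"] d by simp
    then have "z \<notin> shadow p q \<union> seg q" using bad(1)[of z] \<rho> by linarith
    ultimately show "z \<in> D2 - shadow p q - seg q - {p}" using d \<rho> by auto
  qed
  have aD: "path_image ?a \<subseteq> D2 - shadow p q - seg q - {p}"
  proof
    fix z assume "z \<in> path_image ?a"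
    then have z: "z \<in> closed_segment b (p + \<rho>)" by simp
    have "z \<in> D2" using z b p\<rho> convex_D2 by (meson convex_contains_segment subsetD)
    moreover have "Re z > Re q"
    proof -
      obtain u where u: "0 \<le> u" "u \<le> 1" "z = (1 - u) *\<^sub>R b + u *\<^sub>R (p + \<rho>)" using z by (auto simp: in_segment)
      have "Re z - Re q = (1 - u) * (1 - Re q) + u * \<rho>" unfolding u(3) using b(2) p(2) by (simp add: algebra_simps)
      moreover have "Re q < 1" using p by (auto simp: interior_D2)
      ultimately show ?thesis using u \<rho> by (smt (verit) mult_nonneg_nonneg mult_pos_pos)
    qed
    ultimately show "z \<in> D2 - shadow p q - seg q - {p}" using bad(2)[of z] p by force
  qed
  let ?l = "?a +++ ?c +++ reversepath ?a"
  have "winding_number ?l p = winding_number ?a p + (winding_number ?c p + winding_number (reversepath ?a) p)"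
  proof -
    have pn: "p \<notin> path_image ?a" "p \<notin> path_image ?c" using aD cD by blast+
    then have "p \<notin> path_image (?c +++ reversepath ?a)" by (intro not_in_path_image_join) (auto simp: closed_segment_commute simp del: reversepath_linepath)
    then have "winding_number ?l p = winding_number ?a p + winding_number (?c +++ reversepath ?a) p"
      using pn by (intro winding_number_join) auto
    also have "winding_number (?c +++ reversepath ?a) p = winding_number ?c p + winding_number (reversepath ?a) p"
      using pn by (intro winding_number_join) (auto simp: closed_segment_commute)
    finally show ?thesis .
  qed
  also have "winding_number (reversepath ?a) p = - winding_number ?a p"
    using aD by (intro winding_number_reversepath) auto
  finally have "winding_number ?l p = 1"
    using \<rho> by (simp add: winding_number_circlepath_centre)
  moreover have "path_image ?l \<subseteq> D2 - shadow p q - seg q - {p}"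
    using aD cD by (intro subset_path_image_join) (simp_all only: path_image_reversepath)
  ultimately show ?thesis by (intro that[of ?l]) auto
qed

text \<open>By \<open>loops_around_unique\<close> both loops may be replaced by lollipops, which miss the shadows as well as the slits
  and so fall under \<open>half_twist_loop\<close>.\<close>
theorem half_twist_generator:
  assumes p: "p1 \<in> interior D2" "p2 \<in> interior D2" "Re p1 = Re p2" "Im p1 \<noteq> Im p2"
    and b: "b \<in> D2" "Re b = 1"
    and contH: "continuous_on ({0..1} \<times> D2) (\<lambda>(t, w). H t w)"
    and homeo: "\<And>t. t \<in> {0..1} \<Longrightarrow> H t \<in> homeos D2 {}"
    and H0: "\<And>w. w \<in> D2 \<Longrightarrow> H 0 w = w" and H1: "H 1 p1 = p2" "H 1 p2 = p1"
    and side: "\<And>t::real. t \<in> {0<..<1} \<Longrightarrow> Re (H t p2) < Re (H t p1)"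
    and g1: "path g1" "pathstart g1 = b" "pathfinish g1 = b" "path_image g1 \<subseteq> D2 - seg p2 - {p1}"
      "winding_number g1 p1 = 1"
    and g2: "path g2" "pathstart g2 = b" "pathfinish g2 = b" "path_image g2 \<subseteq> D2 - seg p1 - {p2}"
      "winding_number g2 p2 = 1"
  shows "homotopic_paths (D2 - {p1, p2}) (H 1 \<circ> g1) g2"
proof -
  have pos: "0 < Re p1" "0 < Re p2" using p by (auto simp: interior_D2)
  obtain l1 where l1: "path l1" "pathstart l1 = b" "pathfinish l1 = b"
    "path_image l1 \<subseteq> D2 - shadow p1 p2 - seg p2 - {p1}" "winding_number l1 p1 = 1"
    using exists_lollipop[OF p(1,3,4) pos(2) b] by metis
  obtain l2 where l2: "path l2" "pathstart l2 = b" "pathfinish l2 = b"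
    "path_image l2 \<subseteq> D2 - shadow p2 p1 - seg p1 - {p2}" "winding_number l2 p2 = 1"
    using exists_lollipop[OF p(2) p(3)[symmetric] p(4)[symmetric] pos(1) b] by metis
  have g1l1: "homotopic_paths (D2 - {p1, p2}) g1 l1"
    by (rule loops_around_unique[OF p]) (use g1 l1 in auto)
  have g2l2: "homotopic_paths (D2 - {p1, p2}) l2 g2"
    unfolding insert_commute[of p1]
    by (rule loops_around_unique[OF p(2,1) p(3)[symmetric] p(4)[symmetric]]) (use g2 l2 in auto)
  have "homotopic_paths (D2 - {p1, p2}) (H 1 \<circ> g1) (H 1 \<circ> l1)"
  proof (rule homotopic_paths_continuous_image[OF g1l1])
    obtain f where f: "homeomorphism D2 D2 (H 1) f" using homeo[of 1] by (auto simp: homeos_def)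
    then show "continuous_on (D2 - {p1, p2}) (H 1)"
      by (meson Diff_subset continuous_on_subset homeomorphism_cont1)
    have "inj_on (H 1) D2" "H 1 ` D2 = D2"
      using f unfolding homeomorphism_def by (auto intro: inj_on_inverseI)
    moreover have "p1 \<in> D2" "p2 \<in> D2" using p interior_subset by blast+
    ultimately show "H 1 \<in> D2 - {p1, p2} \<rightarrow> D2 - {p1, p2}"
      using H1 by (auto dest: inj_onD)
  qed
  also have "homotopic_paths (D2 - {p1, p2}) (H 1 \<circ> l1) l2"
    by (rule half_twist_loop[OF p b contH homeo H0 H1 side, where w = 1]) (use l1 l2 in auto)
  also note g2l2
  finally show ?thesis .
qed


section \<open>Spheroids and their reparametrisations\<close>
lemma mem_square: "w \<in> square \<longleftrightarrow> sqnorm w \<le> 1"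
  by (auto simp: square_def in_cbox_complex_iff sqnorm_def)

lemma frontier_square: "w \<in> frontier square \<longleftrightarrow> sqnorm w = 1"
proof -
  have "interior square = box (Complex (-1) (-1)) (Complex 1 1)" "closed square"
    by (auto simp: square_def interior_cbox)
  then have "w \<in> frontier square \<longleftrightarrow> w \<in> square \<and> w \<notin> box (Complex (-1) (-1)) (Complex 1 1)"
    by (auto simp: frontier_def)
  then show ?thesis by (auto simp: mem_square in_box_complex_iff sqnorm_def)
qed

lemma convex_square: "convex square"
  by (simp add: square_def)

lemma sqnorm_nonneg [simp]: "0 \<le> sqnorm w"
  by (auto simp: sqnorm_def)

lemma sqnorm_scaleR: "sqnorm (k *\<^sub>R w) = \<bar>k\<bar> * sqnorm w"
  by (auto simp: sqnorm_def abs_mult max_mult_distrib_left)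

lemma sqnorm_numeral_mult [simp]: "sqnorm (numeral k * w) = numeral k * sqnorm w"
  using sqnorm_scaleR[of "numeral k" w] by (simp add: scaleR_conv_of_real)

lemma sqnorm_0 [simp]: "sqnorm 0 = 0" and sqnorm_eq_0_iff [simp]: "sqnorm w = 0 \<longleftrightarrow> w = 0"
  by (auto simp: sqnorm_def max_def complex_eq_iff split: if_splits)

lemma continuous_on_sqnorm [continuous_intros]:
  "continuous_on S f \<Longrightarrow> continuous_on S (\<lambda>x. sqnorm (f x))"
  unfolding sqnorm_def by (intro continuous_intros)

lemma spheroidD:
  assumes "spheroid X x f"
  shows "continuous_on square f" "\<And>w. sqnorm w \<le> 1 \<Longrightarrow> f w \<in> X" "\<And>w. sqnorm w = 1 \<Longrightarrow> f w = x"
  using assms by (auto simp: spheroid_def mem_square frontier_square)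

lemma spheroid_base: "spheroid X x f \<Longrightarrow> x \<in> X"
  using spheroidD(2,3)[of X x f 1] by (simp add: sqnorm_def)

lemma homotopic_spheroids_iff:
  "homotopic_spheroids X x f g \<longleftrightarrow>
     (\<exists>h. continuous_on ({0..1::real} \<times> square) h \<and> h ` ({0..1} \<times> square) \<subseteq> X \<and>
        (\<forall>w\<in>square. h (0, w) = f w) \<and> (\<forall>w\<in>square. h (1, w) = g w) \<and>
        (\<forall>t\<in>{0..1}. \<forall>w\<in>frontier square. h (t, w) = x))"
proof -
  have fr: "frontier square \<subseteq> square"
    by (auto simp: mem_square frontier_square)
  have "(\<forall>w\<in>frontier square. h w = x) \<longleftrightarrow> (\<forall>w\<in>frontier square. k w = x)"
    if "\<And>w. w \<in> topspace (top_of_set square) \<Longrightarrow> h w = k w" for h k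
    using fr that by (simp add: subset_iff)
  from homotopic_with[of "top_of_set square" "\<lambda>k. \<forall>w\<in>frontier square. k w = x", OF this] show ?thesis
    unfolding homotopic_spheroids_def by (simp add: image_subset_iff_funcset)
qed

lemma homotopic_spheroidsI:
  assumes "continuous_on ({0..1::real} \<times> square) h"
    and "\<And>t w. t \<in> {0..1} \<Longrightarrow> sqnorm w \<le> 1 \<Longrightarrow> h (t, w) \<in> X"
    and "\<And>w. sqnorm w \<le> 1 \<Longrightarrow> h (0, w) = f w" "\<And>w. sqnorm w \<le> 1 \<Longrightarrow> h (1, w) = g w"
    and "\<And>t w. t \<in> {0..1} \<Longrightarrow> sqnorm w = 1 \<Longrightarrow> h (t, w) = x"
  shows "homotopic_spheroids X x f g"
  unfolding homotopic_spheroids_iff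
  by (rule exI[of _ h]) (use assms in \<open>auto simp: mem_square frontier_square\<close>)

lemma homotopic_spheroidsE:
  assumes "homotopic_spheroids X x f g"
  obtains h where "continuous_on ({0..1::real} \<times> square) h"
    "\<forall>t\<in>{0..1}. \<forall>w. sqnorm w \<le> 1 \<longrightarrow> h (t, w) \<in> X"
    "\<forall>w. sqnorm w \<le> 1 \<longrightarrow> h (0, w) = f w" "\<forall>w. sqnorm w \<le> 1 \<longrightarrow> h (1, w) = g w"
    "\<forall>t\<in>{0..1}. \<forall>w. sqnorm w = 1 \<longrightarrow> h (t, w) = x"
proof -
  obtain h where h: "continuous_on ({0..1::real} \<times> square) h" "h ` ({0..1} \<times> square) \<subseteq> X"
     "\<forall>w\<in>square. h (0, w) = f w" "\<forall>w\<in>square. h (1, w) = g w"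
     "\<forall>t\<in>{0..1}. \<forall>w\<in>frontier square. h (t, w) = x"
    using assms unfolding homotopic_spheroids_iff by (elim exE conjE) (rule that)
  show ?thesis
    by (rule that[OF h(1)]) (use h(2-5) in \<open>auto simp: mem_square frontier_square image_subset_iff\<close>)
qed

lemma homotopic_spheroids_refl: "homotopic_spheroids X x f f \<longleftrightarrow> spheroid X x f"
  by (auto simp: homotopic_spheroids_def spheroid_def image_subset_iff_funcset)

lemma homotopic_spheroids_sym: "homotopic_spheroids X x f g \<Longrightarrow> homotopic_spheroids X x g f"
  unfolding homotopic_spheroids_def by (rule homotopic_with_symD)

lemma homotopic_spheroids_trans [trans]:
  "homotopic_spheroids X x f g \<Longrightarrow> homotopic_spheroids X x g h \<Longrightarrow> homotopic_spheroids X x f h"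
  unfolding homotopic_spheroids_def by (rule homotopic_with_trans)

lemma homotopic_spheroids_imp_spheroid:
  "homotopic_spheroids X x f g \<Longrightarrow> spheroid X x f" "homotopic_spheroids X x f g \<Longrightarrow> spheroid X x g"
  using homotopic_spheroids_refl homotopic_spheroids_sym homotopic_spheroids_trans by blast+

lemma homotopic_spheroids_eq:
  assumes "spheroid X x f" "\<And>w. sqnorm w \<le> 1 \<Longrightarrow> f w = g w"
  shows "homotopic_spheroids X x f g"
proof (rule homotopic_spheroidsI)
  show "continuous_on ({0..1} \<times> square) (\<lambda>z. f (snd z))"
    by (rule continuous_on_compose2[OF spheroidD(1)[OF assms(1)]]) (auto intro!: continuous_intros)
qed (use assms spheroidD[OF assms(1)] in auto)

lemma spheroid_class_eq_iff:
  assumes "spheroid X x f"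
  shows "spheroid_class X x f = spheroid_class X x g \<longleftrightarrow> homotopic_spheroids X x f g"
proof
  assume eq: "spheroid_class X x f = spheroid_class X x g"
  have "f \<in> spheroid_class X x f" using assms by (simp add: spheroid_class_def homotopic_spheroids_refl)
  then have "homotopic_spheroids X x g f" unfolding eq by (simp add: spheroid_class_def)
  then show "homotopic_spheroids X x f g" by (rule homotopic_spheroids_sym)
next
  assume h: "homotopic_spheroids X x f g"
  show "spheroid_class X x f = spheroid_class X x g"
    unfolding spheroid_class_def
    by (intro Collect_cong iffI)
       (erule homotopic_spheroids_trans[OF homotopic_spheroids_sym[OF h]], erule homotopic_spheroids_trans[OF h])
qed

lemma loop_class_eq_iff:
  assumes "path p" "path_image p \<subseteq> X"
  shows "loop_class X p = loop_class X q \<longleftrightarrow> homotopic_paths X p q"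
proof
  assume eq: "loop_class X p = loop_class X q"
  have "p \<in> loop_class X p" using assms by (simp add: loop_class_def)
  then have "homotopic_paths X q p" unfolding eq by (simp add: loop_class_def)
  then show "homotopic_paths X p q" by (rule homotopic_paths_sym)
next
  assume h: "homotopic_paths X p q"
  show "loop_class X p = loop_class X q"
    unfolding loop_class_def
    by (intro Collect_cong iffI)
       (erule homotopic_paths_trans[OF homotopic_paths_sym[OF h]], erule homotopic_paths_trans[OF h])
qed

text \<open>Two spheroids that agree on \<open>N \<le> 1/2\<close> and are obtained from the same spheroid \<open>f\<close> outside that region, by maps
  \<open>\<phi>\<close> and \<open>\<psi>\<close> of the square, are homotopic if the straight-line homotopy from \<open>\<phi>\<close> to \<open>\<psi>\<close> keeps the boundary of
  the square in the fibre of \<open>f\<close> over the base point. On the boundary of the region both maps are \<open>0\<close>, so the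
  straight lines do nothing there. All reparametrisations of spheroids below are instances.\<close>
lemma homotopic_spheroids_patch:
  fixes N :: "complex \<Rightarrow> real"
  assumes f: "spheroid X x f" and N: "continuous_on square N"
    and G: "continuous_on {w \<in> square. N w \<le> 1/2} G" "\<And>w. sqnorm w \<le> 1 \<Longrightarrow> N w \<le> 1/2 \<Longrightarrow> G w \<in> X"
    and \<phi>: "continuous_on square \<phi>" "\<And>w. sqnorm w \<le> 1 \<Longrightarrow> sqnorm (\<phi> w) \<le> 1"
    and \<psi>: "continuous_on square \<psi>" "\<And>w. sqnorm w \<le> 1 \<Longrightarrow> sqnorm (\<psi> w) \<le> 1"
    and eq: "\<And>w. sqnorm w \<le> 1 \<Longrightarrow> N w = 1/2 \<Longrightarrow> \<phi> w = 0 \<and> \<psi> w = 0 \<and> G w = f 0"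
    and fr: "\<And>w. sqnorm w = 1 \<Longrightarrow> N w > 1/2"
    and x: "\<And>w s. sqnorm w = 1 \<Longrightarrow> s \<in> {0..1} \<Longrightarrow> f ((1 - s) *\<^sub>R \<phi> w + s *\<^sub>R \<psi> w) = x"
  shows "homotopic_spheroids X x (\<lambda>w. if N w \<le> 1/2 then G w else f (\<phi> w))
                                 (\<lambda>w. if N w \<le> 1/2 then G w else f (\<psi> w))"
proof (rule homotopic_spheroidsI)
  let ?k = "\<lambda>z. (1 - fst z) *\<^sub>R \<phi> (snd z) + fst z *\<^sub>R \<psi> (snd z)"
  let ?h = "\<lambda>z. if N (snd z) \<le> 1/2 then G (snd z) else f (?k z)"
  have k: "sqnorm (?k z) \<le> 1" if "z \<in> {0..1} \<times> square" for z
    using convexD[OF convex_square, of "\<phi> (snd z)" "\<psi> (snd z)" "1 - fst z" "fst z"] \<phi>(2) \<psi>(2) that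
    by (auto simp: mem_square)
  have cs: "continuous_on ({0..1} \<times> square) (\<lambda>z. c (snd z))" if "continuous_on square c" for c :: "complex \<Rightarrow> 'b::topological_space"
    by (rule continuous_on_compose2[OF that]) (auto intro!: continuous_intros)
  show "continuous_on ({0..1} \<times> square) ?h"
  proof (rule continuous_on_cases_le)
    show "continuous_on {t \<in> {0..1} \<times> square. N (snd t) \<le> 1/2} (\<lambda>z. G (snd z))"
      by (rule continuous_on_compose2[OF G(1)]) (auto intro!: continuous_intros)
    have "continuous_on ({0..1} \<times> square) (\<lambda>z. f (?k z))"
    proof (rule continuous_on_compose2[OF spheroidD(1)[OF f]])
      show "continuous_on ({0..1} \<times> square) ?k"
        by (intro continuous_intros cs \<phi>(1) \<psi>(1))
    qed (use k in \<open>auto simp: mem_square\<close>)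
    then show "continuous_on {t \<in> {0..1} \<times> square. 1/2 \<le> N (snd t)} (\<lambda>z. f (?k z))"
      by (rule continuous_on_subset) auto
    show "continuous_on ({0..1} \<times> square) (\<lambda>z. N (snd z))" by (rule cs[OF N])
    show "\<And>t. t \<in> {0..1} \<times> square \<Longrightarrow> N (snd t) = 1/2 \<Longrightarrow> G (snd t) = f (?k t)"
      using eq by (auto simp: mem_square)
  qed
  show "?h (t, w) \<in> X" if "t \<in> {0..1}" "sqnorm w \<le> 1" for t w
    using spheroidD(2)[OF f k[of "(t, w)"]] G(2) that by (auto simp: mem_square)
  show "?h (t, w) = x" if "t \<in> {0..1}" "sqnorm w = 1" for t w
    using fr[of w] x[of w t] that by auto
qed auto

lemma homotopic_spheroids_precompose:
  assumes f: "spheroid X x f"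
    and \<phi>: "continuous_on square \<phi>" "\<And>w. sqnorm w \<le> 1 \<Longrightarrow> sqnorm (\<phi> w) \<le> 1"
    and \<psi>: "continuous_on square \<psi>" "\<And>w. sqnorm w \<le> 1 \<Longrightarrow> sqnorm (\<psi> w) \<le> 1"
    and x: "\<And>w s. sqnorm w = 1 \<Longrightarrow> s \<in> {0..1} \<Longrightarrow> f ((1 - s) *\<^sub>R \<phi> w + s *\<^sub>R \<psi> w) = x"
  shows "homotopic_spheroids X x (\<lambda>w. f (\<phi> w)) (\<lambda>w. f (\<psi> w))"
  using homotopic_spheroids_patch[OF f, of "\<lambda>_. 1" "\<lambda>_. x" \<phi> \<psi>] assms by simp

text \<open>A map of the square that sends each edge into itself is joined to the identity by straight lines, and these
  keep the boundary in the boundary.\<close>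
lemma homotopic_spheroids_reparam:
  assumes f: "spheroid X x f"
    and \<phi>: "continuous_on square \<phi>" "\<And>w. sqnorm w \<le> 1 \<Longrightarrow> sqnorm (\<phi> w) \<le> 1"
    and edges: "\<And>w. sqnorm w = 1 \<Longrightarrow> \<bar>Re w\<bar> = 1 \<Longrightarrow> Re (\<phi> w) = Re w"
      "\<And>w. sqnorm w = 1 \<Longrightarrow> \<bar>Im w\<bar> = 1 \<Longrightarrow> Im (\<phi> w) = Im w"
  shows "homotopic_spheroids X x (\<lambda>w. f (\<phi> w)) f"
proof -
  have "homotopic_spheroids X x (\<lambda>w. f (\<phi> w)) (\<lambda>w. f (id w))"
  proof (rule homotopic_spheroids_precompose[OF f \<phi>])
    fix w and s :: real assume w: "sqnorm w = 1" and s: "s \<in> {0..1}"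
    let ?z = "(1 - s) *\<^sub>R \<phi> w + s *\<^sub>R id w"
    have "?z \<in> square"
      using convexD[OF convex_square, of "\<phi> w" w "1 - s" s] \<phi>(2)[of w] w s by (auto simp: mem_square)
    then have le: "sqnorm ?z \<le> 1" by (simp add: mem_square)
    have "\<bar>Re ?z\<bar> = 1 \<or> \<bar>Im ?z\<bar> = 1"
    proof (cases "\<bar>Re w\<bar> = 1")
      case True
      then have "Re ?z = Re w" using edges(1)[OF w] by (simp add: algebra_simps)
      then show ?thesis using True by simp
    next
      case False
      then have *: "\<bar>Im w\<bar> = 1" using w by (auto simp: sqnorm_def max_def split: if_splits)
      then have "Im ?z = Im w" using edges(2)[OF w] by (simp add: algebra_simps)
      then show ?thesis using * by simp
    qed
    then have "sqnorm ?z = 1" using le by (auto simp: sqnorm_def)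
    then show "f ?z = x" by (rule spheroidD(3)[OF f])
  qed auto
  then show ?thesis by simp
qed

lemma continuous_on_Complex [continuous_intros]:
  "continuous_on S f \<Longrightarrow> continuous_on S g \<Longrightarrow> continuous_on S (\<lambda>x. Complex (f x) (g x))"
  unfolding Complex_eq by (intro continuous_intros)

lemma sqnorm_le_iff: "sqnorm w \<le> c \<longleftrightarrow> \<bar>Re w\<bar> \<le> c \<and> \<bar>Im w\<bar> \<le> c"
  by (auto simp: sqnorm_def)

lemma homotopic_spheroids_join:
  assumes "homotopic_spheroids X x f f'" "homotopic_spheroids X x g g'"
  shows "homotopic_spheroids X x (spheroid_join f g) (spheroid_join f' g')"
proof -
  obtain h where h0: "continuous_on ({0..1::real} \<times> square) h"
    "\<forall>t\<in>{0..1}. \<forall>w. sqnorm w \<le> 1 \<longrightarrow> h (t, w) \<in> X"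
    "\<forall>w. sqnorm w \<le> 1 \<longrightarrow> h (0, w) = f w" "\<forall>w. sqnorm w \<le> 1 \<longrightarrow> h (1, w) = f' w"
    "\<forall>t\<in>{0..1}. \<forall>w. sqnorm w = 1 \<longrightarrow> h (t, w) = x"
    by (rule homotopic_spheroidsE[OF assms(1)]) (rule that)
  note h = h0[rule_format]
  obtain k where k0: "continuous_on ({0..1::real} \<times> square) k"
    "\<forall>t\<in>{0..1}. \<forall>w. sqnorm w \<le> 1 \<longrightarrow> k (t, w) \<in> X"
    "\<forall>w. sqnorm w \<le> 1 \<longrightarrow> k (0, w) = g w" "\<forall>w. sqnorm w \<le> 1 \<longrightarrow> k (1, w) = g' w"
    "\<forall>t\<in>{0..1}. \<forall>w. sqnorm w = 1 \<longrightarrow> k (t, w) = x"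
    by (rule homotopic_spheroidsE[OF assms(2)]) (rule that)
  note k = k0[rule_format]
  let ?L = "\<lambda>w. Complex (2 * Re w + 1) (Im w)" and ?R = "\<lambda>w. Complex (2 * Re w - 1) (Im w)"
  have L: "sqnorm (?L w) \<le> 1" if "sqnorm w \<le> 1" "Re w \<le> 0" for w
    using that by (auto simp: sqnorm_le_iff)
  have R: "sqnorm (?R w) \<le> 1" if "sqnorm w \<le> 1" "0 \<le> Re w" for w
    using that by (auto simp: sqnorm_le_iff)
  show ?thesis
  proof (rule homotopic_spheroidsI)
    let ?h = "\<lambda>z. if Re (snd z) \<le> 0 then h (fst z, ?L (snd z)) else k (fst z, ?R (snd z))"
    show "continuous_on ({0..1} \<times> square) ?h"
    proof (rule continuous_on_cases_le)
      show "continuous_on {t \<in> {0..1} \<times> square. Re (snd t) \<le> 0} (\<lambda>z. h (fst z, ?L (snd z)))"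
        by (rule continuous_on_compose2[OF h(1)]) (use L in \<open>auto intro!: continuous_intros simp: mem_square\<close>)
      show "continuous_on {t \<in> {0..1} \<times> square. 0 \<le> Re (snd t)} (\<lambda>z. k (fst z, ?R (snd z)))"
        by (rule continuous_on_compose2[OF k(1)]) (use R in \<open>auto intro!: continuous_intros simp: mem_square\<close>)
      show "h (fst t, ?L (snd t)) = k (fst t, ?R (snd t))" if "t \<in> {0..1} \<times> square" "Re (snd t) = 0" for t
        using h(5)[of "fst t" "?L (snd t)"] k(5)[of "fst t" "?R (snd t)"] that
        by (auto simp: mem_square sqnorm_def)
    qed (intro continuous_intros)
    show "?h (t, w) = x" if "t \<in> {0..1}" "sqnorm w = 1" for t w
    proof (cases "Re w \<le> 0")
      case True
      then have "sqnorm (?L w) = 1" using that(2) by (auto simp: sqnorm_def max_def split: if_splits)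
      then show ?thesis using h(5) that True by simp
    next
      case False
      then have "sqnorm (?R w) = 1" using that(2) by (auto simp: sqnorm_def max_def split: if_splits)
      then show ?thesis using k(5) that False by simp
    qed
  qed (use L R h k in \<open>auto simp: spheroid_join_def\<close>)
qed

lemma homotopic_spheroids_transport:
  assumes \<beta>: "homotopic_paths X \<beta> \<beta>'" and f: "homotopic_spheroids X y f f'"
    and ends: "pathstart \<beta> = x" "pathfinish \<beta> = y"
  shows "homotopic_spheroids X x (transport \<beta> f) (transport \<beta>' f')"
proof -
  obtain h where h0: "continuous_on ({0..1::real} \<times> square) h"
    "\<forall>t\<in>{0..1}. \<forall>w. sqnorm w \<le> 1 \<longrightarrow> h (t, w) \<in> X"
    "\<forall>w. sqnorm w \<le> 1 \<longrightarrow> h (0, w) = f w" "\<forall>w. sqnorm w \<le> 1 \<longrightarrow> h (1, w) = f' w"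
    "\<forall>t\<in>{0..1}. \<forall>w. sqnorm w = 1 \<longrightarrow> h (t, w) = y"
    by (rule homotopic_spheroidsE[OF f]) (rule that)
  note h = h0[rule_format]
  obtain k where k0: "continuous_on ({0..1::real} \<times> {0..1::real}) k" "k \<in> {0..1} \<times> {0..1} \<rightarrow> X"
     "\<forall>s\<in>{0..1}. k (0, s) = \<beta> s" "\<forall>s\<in>{0..1}. k (1, s) = \<beta>' s"
     "\<forall>t\<in>{0..1}. pathstart (k \<circ> Pair t) = pathstart \<beta> \<and> pathfinish (k \<circ> Pair t) = pathfinish \<beta>"
    using \<beta> unfolding homotopic_paths by (elim exE conjE) (rule that)
  note k = k0(1-4)[rule_format]
  have k5: "k (t, 0) = x" and k6: "k (t, 1) = y" if "t \<in> {0..1}" for t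
    using k0(5) that ends by (auto simp: pathstart_def pathfinish_def)
  show ?thesis
  proof (rule homotopic_spheroidsI)
    let ?h = "\<lambda>z. if sqnorm (snd z) \<le> 1/2 then h (fst z, 2 * snd z) else k (fst z, 2 - 2 * sqnorm (snd z))"
    show "continuous_on ({0..1} \<times> square) ?h"
    proof (rule continuous_on_cases_le)
      show "continuous_on {t \<in> {0..1} \<times> square. sqnorm (snd t) \<le> 1/2} (\<lambda>z. h (fst z, 2 * snd z))"
        by (rule continuous_on_compose2[OF h(1)]) (auto intro!: continuous_intros simp: mem_square)
      show "continuous_on {t \<in> {0..1} \<times> square. 1/2 \<le> sqnorm (snd t)} (\<lambda>z. k (fst z, 2 - 2 * sqnorm (snd z)))"
        by (rule continuous_on_compose2[OF k(1)]) (auto intro!: continuous_intros simp: mem_square)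
      fix z :: "real \<times> complex" assume z: "z \<in> {0..1} \<times> square" "sqnorm (snd z) = 1/2"
      have "2 - 2 * sqnorm (snd z) = 1" "sqnorm (2 * snd z) = 1" using z(2) by simp_all
      then show "h (fst z, 2 * snd z) = k (fst z, 2 - 2 * sqnorm (snd z))"
        using h(5)[of "fst z" "2 * snd z"] k6[of "fst z"] z(1) by auto
    qed (intro continuous_intros)
  qed (use h k k5 in \<open>auto simp: transport_def Pi_iff\<close>)
qed

lemma spheroid_transport:
  assumes "path \<beta>" "path_image \<beta> \<subseteq> X" "spheroid X (pathfinish \<beta>) f"
  shows "spheroid X (pathstart \<beta>) (transport \<beta> f)"
  using homotopic_spheroids_transport[of X \<beta> \<beta> "pathfinish \<beta>" f f "pathstart \<beta>"] assms
  by (simp add: homotopic_spheroids_refl)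

text \<open>On both sides the paths are followed radially through collars of the square, and a radial
  reparametrisation takes the collars of one side to those of the other.\<close>
lemma homotopic_spheroids_transport_join:
  assumes \<beta>: "path \<beta>" "path_image \<beta> \<subseteq> X" and \<gamma>: "path \<gamma>" "path_image \<gamma> \<subseteq> X" "pathfinish \<beta> = pathstart \<gamma>"
    and f: "spheroid X (pathfinish \<gamma>) f"
  shows "homotopic_spheroids X (pathstart \<beta>) (transport (\<beta> +++ \<gamma>) f) (transport \<beta> (transport \<gamma> f))"
proof -
  let ?F = "transport \<beta> (transport \<gamma> f)"
  have F: "spheroid X (pathstart \<beta>) ?F"
    using spheroid_transport[OF \<gamma>(1,2) f] spheroid_transport[OF \<beta>, of "transport \<gamma> f"] \<gamma>(3) by simp
  \<comment> \<open>\<open>m \<sigma> * \<sigma>\<close> is the piecewise linear function with slopes 1/2, 1, 2 and breaks at 1/2 and 3/4; the inner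
    maxima with 1/4 avoid the division by zero at the centre.\<close>
  define m where "m = (\<lambda>\<sigma>. max (1/2) (max (1 - 1 / (4 * max \<sigma> (1/4))) (2 - 1 / max \<sigma> (1/4))) :: real)"
  have m1: "m \<sigma> = 1/2" if "\<sigma> \<le> 1/2" for \<sigma>
    using that by (auto simp: m_def max_def field_simps)
  have m_max: "m \<sigma> * \<sigma> = max (\<sigma> / 2) (max (\<sigma> - 1/4) (2 * \<sigma> - 1))" if "1/4 \<le> \<sigma>" for \<sigma>
  proof -
    have "max \<sigma> (1/4) = \<sigma>" using that by simp
    then show ?thesis
      using that by (simp add: m_def max_mult_distrib_right left_diff_distrib)
  qed
  have m2: "m \<sigma> * \<sigma> = \<sigma> - 1/4" if "1/2 \<le> \<sigma>" "\<sigma> \<le> 3/4" for \<sigma>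
    using that m_max[of \<sigma>] by (simp add: max_def)
  have m3: "m \<sigma> * \<sigma> = 2 * \<sigma> - 1" if "3/4 \<le> \<sigma>" for \<sigma>
    using that m_max[of \<sigma>] by (simp add: max_def)
  have m0: "m \<sigma> \<ge> 0" for \<sigma> by (simp add: m_def le_max_iff_disj)
  define \<phi> where "\<phi> = (\<lambda>w. m (sqnorm w) *\<^sub>R w)"
  have s: "sqnorm (\<phi> w) = m (sqnorm w) * sqnorm w" for w
    using m0 by (simp add: \<phi>_def sqnorm_scaleR)
  have "homotopic_spheroids X (pathstart \<beta>) (\<lambda>w. ?F (\<phi> w)) ?F"
  proof (rule homotopic_spheroids_reparam[OF F])
    show "continuous_on square \<phi>"
      unfolding \<phi>_def m_def by (intro continuous_intros) auto
    show "sqnorm (\<phi> w) \<le> 1" if "sqnorm w \<le> 1" for w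
    proof -
      consider "sqnorm w \<le> 1/2" | "1/2 \<le> sqnorm w" "sqnorm w \<le> 3/4" | "3/4 \<le> sqnorm w" by linarith
      then show ?thesis
      proof cases
        case 1
        then show ?thesis unfolding s m1[OF 1] by simp
      next
        case 2
        then show ?thesis unfolding s m2[OF 2] by simp
      next
        case 3
        then show ?thesis unfolding s m3[OF 3] using that by simp
      qed
    qed
    show "Re (\<phi> w) = Re w" "Im (\<phi> w) = Im w" if "sqnorm w = 1" for w
      using m3[of 1] that by (auto simp: \<phi>_def)
  qed
  moreover have "transport (\<beta> +++ \<gamma>) f w = ?F (\<phi> w)" if "sqnorm w \<le> 1" for w
  proof -
    consider "sqnorm w \<le> 1/2" | "1/2 < sqnorm w" "sqnorm w \<le> 3/4" | "3/4 < sqnorm w" by linarith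
    then show ?thesis
    proof cases
      case 1
      have "4 * \<phi> w = 2 * w" unfolding \<phi>_def m1[OF 1] by (simp add: scaleR_conv_of_real)
      moreover have "sqnorm (\<phi> w) = sqnorm w / 2" unfolding s m1[OF 1] by simp
      ultimately show ?thesis using 1 by (simp add: transport_def)
    next
      case 2
      then have a: "sqnorm (\<phi> w) = sqnorm w - 1/4" using m2 by (simp add: s)
      show ?thesis
      proof (cases "sqnorm w = 3/4")
        case True
        then have e: "sqnorm (\<phi> w) = 1/2" using a by simp
        show ?thesis
          using \<gamma>(3) unfolding transport_def joinpaths_def sqnorm_numeral_mult True e pathstart_def pathfinish_def
          by simp
      next
        case False
        then show ?thesis using 2 a by (simp add: transport_def joinpaths_def)
      qed
    next
      case 3
      then have "sqnorm (\<phi> w) = 2 * sqnorm w - 1" using m3 by (simp add: s)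
      then show ?thesis using 3 by (simp add: transport_def joinpaths_def) 
    qed
  qed
  ultimately show ?thesis
    using homotopic_spheroids_eq[of X "pathstart \<beta>" "\<lambda>w. ?F (\<phi> w)" "transport (\<beta> +++ \<gamma>) f"]
      homotopic_spheroids_imp_spheroid homotopic_spheroids_sym homotopic_spheroids_trans by metis
qed

text \<open>On the left, \<open>g\<close> sits in the quarter-size square at the centre, and \<open>f\<close> is spread over the rest after its
  centre has been blown up to a square. On the right, \<open>g\<close> has been pulled out of \<open>f\<close> along the ray from the
  left edge to the centre. Stretching the left-hand map moves \<open>g\<close> into the left half of the square. What
  surrounds \<open>g\<close> is then, on both sides, \<open>f\<close> composed with a map of the square that collapses the boundary of
  the region of \<open>g\<close> to the centre, and such maps are joined by straight lines. This is done in two steps,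
  because on the line between the two halves the radial map \<open>\<psi>R\<close> of the left half is constant, whereas the map
  of the right half runs along a whole edge: the map \<open>\<psi>L\<close> agrees with the right half there, and it is
  afterwards deformed to \<open>\<psi>R\<close> in the left half alone.\<close>
lemma homotopic_spheroids_insert:
  assumes f: "spheroid X x f" and g: "spheroid X (f 0) g"
  shows "homotopic_spheroids X x
      (\<lambda>w. if sqnorm w \<le> 1/4 then g (4 * w) else f (min 1 (2 - 1 / (2 * sqnorm w)) *\<^sub>R w))
      (spheroid_join (transport (\<lambda>t. f (of_real (t - 1))) g) f)"
proof -
  \<comment> \<open>\<kappa> collapses the quarter-size square to the centre and is the identity beyond the half-size square.\<close>
  define \<kappa> where "\<kappa> = (\<lambda>w. max 0 (min 1 (2 - 1 / (2 * max (sqnorm w) (1/4)))) *\<^sub>R w)"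
  define F where "F = (\<lambda>w. if 2 * sqnorm w \<le> 1/2 then g (4 * w) else f (\<kappa> w))"
  have cont\<kappa>: "continuous_on S \<kappa>" for S
    unfolding \<kappa>_def by (intro continuous_intros) auto
  have \<kappa>_le: "sqnorm (\<kappa> w) \<le> sqnorm w" for w
    unfolding \<kappa>_def sqnorm_scaleR using mult_right_mono[of "max 0 (min 1 (2 - 1 / (2 * max (sqnorm w) (1/4))))" 1 "sqnorm w"] by simp
  have \<kappa>0: "\<kappa> w = 0" if "sqnorm w = 1/4" for w
    unfolding \<kappa>_def that by simp
  have \<kappa>1: "\<kappa> w = w" if "sqnorm w = 1" for w
    using that by (simp add: \<kappa>_def)
  have F: "spheroid X x F"
    unfolding F_def homotopic_spheroids_refl[symmetric]
  proof (rule homotopic_spheroids_patch[OF f])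
    show "continuous_on {w \<in> square. 2 * sqnorm w \<le> 1/2} (\<lambda>w. g (4 * w))"
      by (rule continuous_on_compose2[OF spheroidD(1)[OF g]]) (auto intro!: continuous_intros simp: mem_square)
    show "sqnorm (\<kappa> w) \<le> 1" "sqnorm (\<kappa> w) \<le> 1" if "sqnorm w \<le> 1" for w
      using \<kappa>_le[of w] that by auto
    show "f ((1 - s) *\<^sub>R \<kappa> w + s *\<^sub>R \<kappa> w) = x" if "sqnorm w = 1" "s \<in> {0..1}" for w s
      using spheroidD(3)[OF f] \<kappa>1 that by (simp flip: scaleR_add_left)
  qed (use spheroidD[OF g] \<kappa>0 cont\<kappa> in \<open>auto intro!: continuous_intros\<close>)
  \<comment> \<open>The stretching \<phi> takes the rectangle around (-1/2, 0) with \<open>N \<le> 1/2\<close> onto the quarter-size square at the centre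
    and preserves each edge.\<close>
  define \<alpha> where "\<alpha> = (\<lambda>u::real. min (min (u + 1/2) (3 * u + 2)) (3/5 * u + 2/5))"
  define \<eta> where "\<eta> = (\<lambda>v::real. max (min (v/2) (3/2 * v + 1/2)) (3/2 * v - 1/2))"
  define \<phi> where "\<phi> = (\<lambda>w. Complex (\<alpha> (Re w)) (\<eta> (Im w)))"
  define N where "N = (\<lambda>w. sqnorm (Complex (2 * Re w + 1) (Im w)))"
  define G where "G = (\<lambda>w. g (Complex (4 * Re w + 2) (2 * Im w)))"
  have cont\<phi>: "continuous_on S \<phi>" for S
    unfolding \<phi>_def \<alpha>_def \<eta>_def by (intro continuous_intros) auto
  have \<phi>_le: "sqnorm (\<phi> w) \<le> 1" if "sqnorm w \<le> 1" for w
  proof -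
    have "\<bar>\<alpha> u\<bar> \<le> 1" "\<bar>\<eta> u\<bar> \<le> 1" if "\<bar>u\<bar> \<le> 1" for u
      using that unfolding \<alpha>_def \<eta>_def by linarith+
    then show ?thesis using that by (auto simp: sqnorm_le_iff \<phi>_def)
  qed
  have N_iff: "2 * sqnorm (\<phi> w) \<le> 1/2 \<longleftrightarrow> N w \<le> 1/2" for w
  proof -
    have "\<bar>\<alpha> u\<bar> \<le> 1/4 \<longleftrightarrow> \<bar>2 * u + 1\<bar> \<le> 1/2" "\<bar>\<eta> u\<bar> \<le> 1/4 \<longleftrightarrow> \<bar>u\<bar> \<le> 1/2" for u
      unfolding \<alpha>_def \<eta>_def by linarith+
    then have "sqnorm (\<phi> w) \<le> 1/4 \<longleftrightarrow> N w \<le> 1/2"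
      unfolding \<phi>_def N_def sqnorm_le_iff by (simp only: complex.sel)
    then show ?thesis by linarith
  qed
  have \<phi>_in: "\<phi> w = Complex (Re w + 1/2) (Im w / 2)" if "N w \<le> 1/2" for w
  proof -
    have "\<alpha> u = u + 1/2" if "\<bar>2 * u + 1\<bar> \<le> 1/2" for u
      using that unfolding \<alpha>_def by linarith
    moreover have "\<eta> u = u / 2" if "\<bar>u\<bar> \<le> 1/2" for u
      using that unfolding \<eta>_def by linarith
    ultimately show ?thesis
      using that unfolding \<phi>_def N_def sqnorm_le_iff by (simp only: complex.sel)
  qed
  have N_le: "sqnorm (Complex (4 * Re w + 2) (2 * Im w)) \<le> 1" if "N w \<le> 1/2" for w
    using that unfolding N_def sqnorm_le_iff complex.sel by linarith
  have edges: "\<alpha> 1 = 1" "\<alpha> (-1) = -1" "\<eta> 1 = 1" "\<eta> (-1) = -1"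
    by (auto simp: \<alpha>_def \<eta>_def)
  have \<phi>_edge: "\<bar>Re w\<bar> = 1 \<Longrightarrow> Re (\<phi> w) = Re w" "\<bar>Im w\<bar> = 1 \<Longrightarrow> Im (\<phi> w) = Im w" for w
    using edges by (auto simp: \<phi>_def abs_if split: if_splits)
  have step1: "homotopic_spheroids X x (\<lambda>w. F (\<phi> w)) F"
    by (rule homotopic_spheroids_reparam[OF F cont\<phi> \<phi>_le \<phi>_edge])
  have F\<phi>: "F (\<phi> w) = (if N w \<le> 1/2 then G w else f (\<kappa> (\<phi> w)))" for w
  proof (cases "N w \<le> 1/2")
    case True
    have "4 * \<phi> w = Complex (4 * Re w + 2) (2 * Im w)"
      using \<phi>_in[OF True] by (simp add: complex_eq_iff)
    then show ?thesis using True N_iff[of w] by (simp add: F_def G_def)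
  qed (use N_iff[of w] in \<open>simp add: F_def\<close>)
  define l where "l = (\<lambda>w. max 0 (2 * sqnorm w - 1))"
  have l: "0 \<le> l w" "sqnorm w \<le> 1 \<Longrightarrow> l w \<le> 1" "sqnorm w = 1 \<Longrightarrow> l w = 1" "sqnorm w = 1/2 \<Longrightarrow> l w = 0" for w
    by (auto simp: l_def)
  have contl: "continuous_on S k \<Longrightarrow> continuous_on S (\<lambda>x. l (k x))" for S and k :: "complex \<Rightarrow> complex"
    unfolding l_def by (intro continuous_intros)
  have scale: "sqnorm (r *\<^sub>R z) \<le> 1" if "0 \<le> r" "r \<le> 1" "sqnorm z \<le> 1" for r z
    using that mult_mono[of r 1 "sqnorm z" 1] by (simp add: sqnorm_scaleR)
  define \<psi>L where "\<psi>L = (\<lambda>w. l w *\<^sub>R Complex (-1) (Im w))"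
  define \<psi>R where "\<psi>R = (\<lambda>w. l w *\<^sub>R (-1 :: complex))"
  define \<psi>T where "\<psi>T = (\<lambda>w. if Re w \<le> 0 then \<psi>L (Complex (2 * Re w + 1) (Im w)) else Complex (2 * Re w - 1) (Im w))"
  define L where "L = (\<lambda>w. if sqnorm w \<le> 1/2 then g (2 * w) else f (\<psi>L w))"
  have \<psi>L_le: "sqnorm (\<psi>L w) \<le> 1" if "sqnorm w \<le> 1" for w
    unfolding \<psi>L_def using that l by (intro scale) (auto simp: sqnorm_le_iff)
  have \<psi>T_le: "sqnorm (\<psi>T w) \<le> 1" if "sqnorm w \<le> 1" for w
  proof (cases "Re w \<le> 0")
    case True
    have "sqnorm (Complex (2 * Re w + 1) (Im w)) \<le> 1"
      using that True unfolding sqnorm_le_iff complex.sel by linarith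
    then show ?thesis using True \<psi>L_le by (simp add: \<psi>T_def)
  next
    case False
    then show ?thesis using that unfolding \<psi>T_def sqnorm_le_iff by auto
  qed
  have step2: "homotopic_spheroids X x (\<lambda>w. if N w \<le> 1/2 then G w else f (\<kappa> (\<phi> w)))
                                       (\<lambda>w. if N w \<le> 1/2 then G w else f (\<psi>T w))"
  proof (rule homotopic_spheroids_patch[OF f])
    show "continuous_on square N" unfolding N_def by (intro continuous_intros)
    show "continuous_on {w \<in> square. N w \<le> 1/2} G"
      unfolding G_def by (rule continuous_on_compose2[OF spheroidD(1)[OF g]])
        (auto intro!: continuous_intros N_le simp: mem_square)
    show "G w \<in> X" if "sqnorm w \<le> 1" "N w \<le> 1/2" for w
      unfolding G_def by (rule spheroidD(2)[OF g]) (rule N_le[OF that(2)])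
    show "continuous_on square (\<lambda>w. \<kappa> (\<phi> w))"
      by (rule continuous_on_compose2[OF cont\<kappa> cont\<phi>]) auto
    show "sqnorm (\<kappa> (\<phi> w)) \<le> 1" if "sqnorm w \<le> 1" for w
      using \<kappa>_le[of "\<phi> w"] \<phi>_le[OF that] by simp
    show "continuous_on square \<psi>T"
      unfolding \<psi>T_def
    proof (rule continuous_on_cases_le)
      fix w assume "w \<in> square" "Re w = 0"
      then have "l (Complex (2 * Re w + 1) (Im w)) = 1"
        by (intro l(3)) (auto simp: sqnorm_def mem_square)
      then show "\<psi>L (Complex (2 * Re w + 1) (Im w)) = Complex (2 * Re w - 1) (Im w)"
        using \<open>Re w = 0\<close> by (simp add: \<psi>L_def)
    qed (auto simp: \<psi>L_def intro!: continuous_intros contl)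
    show "sqnorm (\<psi>T w) \<le> 1" if "sqnorm w \<le> 1" for w
      by (rule \<psi>T_le[OF that])
    show "\<kappa> (\<phi> w) = 0 \<and> \<psi>T w = 0 \<and> G w = f 0" if "sqnorm w \<le> 1" "N w = 1/2" for w
    proof (intro conjI)
      have "\<phi> w = (1/2) *\<^sub>R Complex (2 * Re w + 1) (Im w)"
        using \<phi>_in[of w] that by (simp add: complex_eq_iff)
      then have "sqnorm (\<phi> w) = 1/4" using that by (simp add: sqnorm_scaleR N_def)
      then show "\<kappa> (\<phi> w) = 0" by (rule \<kappa>0)
      have "\<bar>2 * Re w + 1\<bar> \<le> 1/2" using that(2) unfolding N_def sqnorm_def complex.sel by linarith
      then have "Re w \<le> 0" by linarith
      then show "\<psi>T w = 0" using l(4)[of "Complex (2 * Re w + 1) (Im w)"] that by (simp add: \<psi>T_def \<psi>L_def N_def)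
      have "Complex (4 * Re w + 2) (2 * Im w) = 2 * Complex (2 * Re w + 1) (Im w)"
        by (simp add: complex_eq_iff)
      then have "sqnorm (Complex (4 * Re w + 2) (2 * Im w)) = 1" using that by (simp add: N_def)
      then show "G w = f 0" unfolding G_def by (rule spheroidD(3)[OF g])
    qed
    show "1/2 < N w" if "sqnorm w = 1" for w
      using that unfolding N_def sqnorm_def complex.sel by linarith
    show "f ((1 - s) *\<^sub>R \<kappa> (\<phi> w) + s *\<^sub>R \<psi>T w) = x" if w: "sqnorm w = 1" and s: "s \<in> {0..1}" for w s
    proof -
      have le: "\<bar>Re w\<bar> \<le> 1" "\<bar>Im w\<bar> \<le> 1" using w by (auto simp: sqnorm_def)
      have \<phi>1: "sqnorm (\<phi> w) = 1"
        using \<phi>_edge[of w] w \<phi>_le[of w] by (auto simp: sqnorm_def max_def split: if_splits)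
      let ?z = "(1 - s) *\<^sub>R \<phi> w + s *\<^sub>R \<psi>T w"
      have zle: "sqnorm ?z \<le> 1"
        using convexD[OF convex_square, of "\<phi> w" "\<psi>T w" "1 - s" s] \<phi>1 s w
          \<psi>T_le[of w] by (simp add: mem_square)
      have "\<bar>Re ?z\<bar> = 1 \<or> \<bar>Im ?z\<bar> = 1"
      proof (cases "\<bar>Re w\<bar> = 1")
        case True
        have "Re (\<psi>T w) = Re w"
        proof (cases "Re w \<le> 0")
          case neg: True
          then have "Re w = -1" using True by simp
          moreover from this have "l (Complex (2 * Re w + 1) (Im w)) = 1"
            using le by (intro l(3)) (auto simp: sqnorm_def)
          ultimately show ?thesis by (simp add: \<psi>T_def \<psi>L_def)
        next
          case False
          then show ?thesis using True by (simp add: \<psi>T_def)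
        qed
        then have "Re ?z = Re w" using \<phi>_edge(1)[OF True] by (simp add: algebra_simps)
        then show ?thesis using True by simp
      next
        case False
        then have im: "\<bar>Im w\<bar> = 1" using w by (auto simp: sqnorm_def max_def split: if_splits)
        have "Im (\<psi>T w) = Im w"
        proof (cases "Re w \<le> 0")
          case True
          then have "l (Complex (2 * Re w + 1) (Im w)) = 1"
            using le im by (intro l(3)) (auto simp: sqnorm_def)
          then show ?thesis using True by (simp add: \<psi>T_def \<psi>L_def)
        qed (simp add: \<psi>T_def)
        then have "Im ?z = Im w" using \<phi>_edge(2)[OF im] by (simp add: algebra_simps)
        then show ?thesis using im by simp
      qed
      then have "sqnorm ?z = 1" using zle by (auto simp: sqnorm_def)
      then show ?thesis using spheroidD(3)[OF f, of ?z] \<kappa>1[OF \<phi>1] by simp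
    qed
  qed
  have step3: "(if N w \<le> 1/2 then G w else f (\<psi>T w)) = spheroid_join L f w" for w
  proof (cases "Re w \<le> 0")
    case True
    have "Complex (4 * Re w + 2) (2 * Im w) = 2 * Complex (2 * Re w + 1) (Im w)"
      by (simp add: complex_eq_iff)
    then show ?thesis using True by (simp add: N_def G_def L_def spheroid_join_def \<psi>T_def)
  next
    case False
    then have "\<not> N w \<le> 1/2" unfolding N_def sqnorm_le_iff complex.sel by linarith
    then show ?thesis using False by (simp add: spheroid_join_def \<psi>T_def)
  qed
  have step4: "homotopic_spheroids X x L (\<lambda>w. if sqnorm w \<le> 1/2 then g (2 * w) else f (\<psi>R w))"
    unfolding L_def
  proof (rule homotopic_spheroids_patch[OF f])
    show "continuous_on {w \<in> square. sqnorm w \<le> 1/2} (\<lambda>w. g (2 * w))"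
      by (rule continuous_on_compose2[OF spheroidD(1)[OF g]]) (auto intro!: continuous_intros simp: mem_square)
    show "continuous_on square \<psi>L" "continuous_on square \<psi>R" "continuous_on square sqnorm"
      unfolding \<psi>L_def \<psi>R_def l_def by (intro continuous_intros)+
    show "sqnorm (\<psi>R w) \<le> 1" if "sqnorm w \<le> 1" for w
      unfolding \<psi>R_def using that l by (intro scale) (auto simp: sqnorm_le_iff)
    show "f ((1 - s) *\<^sub>R \<psi>L w + s *\<^sub>R \<psi>R w) = x" if w: "sqnorm w = 1" and s: "s \<in> {0..1}" for w s
    proof (rule spheroidD(3)[OF f])
      have *: "(1 - s) *\<^sub>R \<psi>L w + s *\<^sub>R \<psi>R w = Complex (-1) ((1 - s) * Im w)"
        using l(3)[OF w] by (simp add: \<psi>L_def \<psi>R_def complex_eq_iff)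
      have "\<bar>(1 - s) * Im w\<bar> \<le> 1 * 1"
        unfolding abs_mult using w s by (intro mult_mono) (auto simp: sqnorm_def)
      then show "sqnorm ((1 - s) *\<^sub>R \<psi>L w + s *\<^sub>R \<psi>R w) = 1"
        unfolding * by (simp add: sqnorm_def)
    qed
  qed (use spheroidD[OF g] l \<psi>L_le in \<open>auto simp: \<psi>L_def \<psi>R_def\<close>)
  have "(\<lambda>w. if sqnorm w \<le> 1/2 then g (2 * w) else f (\<psi>R w)) = transport (\<lambda>t. f (of_real (t - 1))) g"
  proof
    fix w
    show "(if sqnorm w \<le> 1/2 then g (2 * w) else f (\<psi>R w)) = transport (\<lambda>t. f (of_real (t - 1))) g w"
    proof (cases "sqnorm w \<le> 1/2")
      case False
      then have "\<psi>R w = of_real (2 - 2 * sqnorm w - 1)"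
        by (simp add: \<psi>R_def l_def complex_eq_iff)
      then show ?thesis using False by (simp add: transport_def)
    qed (simp add: transport_def)
  qed
  with step4 have "homotopic_spheroids X x (spheroid_join L f) (spheroid_join (transport (\<lambda>t. f (of_real (t - 1))) g) f)"
    using f by (intro homotopic_spheroids_join) (auto simp: homotopic_spheroids_refl)
  then have "homotopic_spheroids X x F (spheroid_join (transport (\<lambda>t. f (of_real (t - 1))) g) f)"
    using step1 step2 unfolding F\<phi> step3 by (meson homotopic_spheroids_sym homotopic_spheroids_trans)
  moreover have "F = (\<lambda>w. if sqnorm w \<le> 1/4 then g (4 * w) else f (min 1 (2 - 1 / (2 * sqnorm w)) *\<^sub>R w))"
  proof
    fix w
    show "F w = (if sqnorm w \<le> 1/4 then g (4 * w) else f (min 1 (2 - 1 / (2 * sqnorm w)) *\<^sub>R w))"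
    proof (cases "sqnorm w \<le> 1/4")
      case False
      then have "2 - 1 / (2 * sqnorm w) \<ge> 0" by (simp add: field_simps)
      then show ?thesis using False by (simp add: F_def \<kappa>_def max_def)
    qed (simp add: F_def)
  qed
  ultimately show ?thesis by simp
qed


section \<open>The two homotopy groups and the action\<close>
definition loop_at :: "'a::topological_space set \<Rightarrow> 'a \<Rightarrow> (real \<Rightarrow> 'a) \<Rightarrow> bool" where
  "loop_at X x p \<longleftrightarrow> path p \<and> path_image p \<subseteq> X \<and> pathstart p = x \<and> pathfinish p = x"

lemma loop_atD:
  assumes "loop_at X x p"
  shows "path p" "path_image p \<subseteq> X" "pathstart p = x" "pathfinish p = x"
  using assms by (auto simp: loop_at_def)

lemma loop_at_join: "loop_at X x p \<Longrightarrow> loop_at X x q \<Longrightarrow> loop_at X x (p +++ q)"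
  using subset_path_image_join[of p X q] by (auto simp: loop_at_def)

lemma loop_at_reversepath: "loop_at X x p \<Longrightarrow> loop_at X x (reversepath p)"
  by (auto simp: loop_at_def)

lemma loop_at_const: "x \<in> X \<Longrightarrow> loop_at X x (\<lambda>_. x)"
  by (auto simp: loop_at_def path_def path_image_def pathstart_def pathfinish_def)

lemma mem_carrier_pi1: "\<gamma> \<in> carrier (pi1 X x) \<longleftrightarrow> (\<exists>p. loop_at X x p \<and> \<gamma> = loop_class X p)"
  by (auto simp: pi1_def loop_at_def)

lemma loop_class_in_carrier [intro]: "loop_at X x p \<Longrightarrow> loop_class X p \<in> carrier (pi1 X x)"
  by (auto simp: mem_carrier_pi1)

lemma loop_class_eqI: "homotopic_paths X p q \<Longrightarrow> loop_class X p = loop_class X q"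
  using loop_class_eq_iff[of p X q] homotopic_paths_imp_path[of X p q] homotopic_paths_imp_subset[of X p q] by simp

lemma pi1_mult:
  assumes "loop_at X x p" "loop_at X x q"
  shows "loop_class X p \<otimes>\<^bsub>pi1 X x\<^esub> loop_class X q = loop_class X (p +++ q)"
proof -
  have refl: "homotopic_paths X p p" "homotopic_paths X q q" and pq: "pathfinish p = pathstart q"
    using assms by (auto simp: loop_at_def)
  have "(\<exists>p'\<in>loop_class X p. \<exists>q'\<in>loop_class X q. homotopic_paths X (p' +++ q') r)
         \<longleftrightarrow> homotopic_paths X (p +++ q) r" for r
  proof
    assume "\<exists>p'\<in>loop_class X p. \<exists>q'\<in>loop_class X q. homotopic_paths X (p' +++ q') r"
    then obtain p' q' where *: "homotopic_paths X p p'" "homotopic_paths X q q'" "homotopic_paths X (p' +++ q') r"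
      by (auto simp: loop_class_def)
    show "homotopic_paths X (p +++ q) r"
      using homotopic_paths_trans[OF homotopic_paths_join[OF *(1,2) pq] *(3)] .
  next
    assume "homotopic_paths X (p +++ q) r"
    then show "\<exists>p'\<in>loop_class X p. \<exists>q'\<in>loop_class X q. homotopic_paths X (p' +++ q') r"
      using refl by (intro bexI[of _ p] bexI[of _ q]) (simp_all add: loop_class_def)
  qed
  then show ?thesis by (simp add: pi1_def loop_class_def)
qed

lemma pi1_one:
  fixes x :: "'a::real_normed_vector"
  shows "\<one>\<^bsub>pi1 X x\<^esub> = loop_class X (linepath x x)"
  by (simp add: pi1_def linepath_refl)

lemma group_pi1:
  fixes x :: "'a::real_normed_vector"
  assumes x: "x \<in> X"
  shows "group (pi1 X x)"
proof (rule groupI)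
  have one: "loop_at X x (linepath x x)"
    using loop_at_const[OF x] by (simp add: linepath_refl)
  then show "\<one>\<^bsub>pi1 X x\<^esub> \<in> carrier (pi1 X x)"
    by (auto simp: pi1_one)
  fix \<alpha> assume "\<alpha> \<in> carrier (pi1 X x)"
  then obtain p where p: "loop_at X x p" "\<alpha> = loop_class X p" by (auto simp: mem_carrier_pi1)
  note p' = loop_atD[OF p(1)]
  show "\<one>\<^bsub>pi1 X x\<^esub> \<otimes>\<^bsub>pi1 X x\<^esub> \<alpha> = \<alpha>"
    unfolding pi1_one p(2) pi1_mult[OF one p(1)]
    using homotopic_paths_lid'[OF p'(1,2)] p'(3) by (intro loop_class_eqI) simp
  have "loop_class X (reversepath p) \<otimes>\<^bsub>pi1 X x\<^esub> \<alpha> = \<one>\<^bsub>pi1 X x\<^esub>"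
    unfolding p(2) pi1_mult[OF loop_at_reversepath[OF p(1)] p(1)] pi1_one
    using homotopic_paths_linv[OF p'(1,2)] p'(4) by (intro loop_class_eqI) simp
  then show "\<exists>\<beta>\<in>carrier (pi1 X x). \<beta> \<otimes>\<^bsub>pi1 X x\<^esub> \<alpha> = \<one>\<^bsub>pi1 X x\<^esub>"
    using loop_at_reversepath[OF p(1)] by blast
  fix \<beta> assume "\<beta> \<in> carrier (pi1 X x)"
  then obtain q where q: "loop_at X x q" "\<beta> = loop_class X q" by (auto simp: mem_carrier_pi1)
  note q' = loop_atD[OF q(1)]
  show "\<alpha> \<otimes>\<^bsub>pi1 X x\<^esub> \<beta> \<in> carrier (pi1 X x)"
    unfolding p(2) q(2) pi1_mult[OF p(1) q(1)] using loop_at_join[OF p(1) q(1)] by blast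
  fix \<gamma> assume "\<gamma> \<in> carrier (pi1 X x)"
  then obtain r where r: "loop_at X x r" "\<gamma> = loop_class X r" by (auto simp: mem_carrier_pi1)
  note r' = loop_atD[OF r(1)]
  have "homotopic_paths X (p +++ (q +++ r)) ((p +++ q) +++ r)"
    by (rule homotopic_paths_assoc) (use p' q' r' in auto)
  then show "\<alpha> \<otimes>\<^bsub>pi1 X x\<^esub> \<beta> \<otimes>\<^bsub>pi1 X x\<^esub> \<gamma> = \<alpha> \<otimes>\<^bsub>pi1 X x\<^esub> (\<beta> \<otimes>\<^bsub>pi1 X x\<^esub> \<gamma>)"
    unfolding p(2) q(2) r(2) pi1_mult[OF p(1) q(1)] pi1_mult[OF q(1) r(1)]
      pi1_mult[OF loop_at_join[OF p(1) q(1)] r(1)] pi1_mult[OF p(1) loop_at_join[OF q(1) r(1)]]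
    by (rule loop_class_eqI[symmetric])
qed

lemma pi1_inv:
  fixes x :: "'a::real_normed_vector"
  assumes p: "loop_at X x p"
  shows "inv\<^bsub>pi1 X x\<^esub> (loop_class X p) = loop_class X (reversepath p)"
proof (rule group.inv_equality)
  have "x \<in> X" using loop_atD[OF p] pathstart_in_path_image by blast
  then show "group (pi1 X x)" by (rule group_pi1)
  show "loop_class X (reversepath p) \<otimes>\<^bsub>pi1 X x\<^esub> loop_class X p = \<one>\<^bsub>pi1 X x\<^esub>"
    unfolding pi1_mult[OF loop_at_reversepath[OF p] p] pi1_one
    using homotopic_paths_linv[OF loop_atD(1,2)[OF p]] loop_atD(4)[OF p] by (intro loop_class_eqI) simp
qed (use p loop_at_reversepath[OF p] in blast)+

lemma mem_carrier_pi2: "\<kappa> \<in> carrier (pi2 X x) \<longleftrightarrow> (\<exists>f. spheroid X x f \<and> \<kappa> = spheroid_class X x f)"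
  by (auto simp: pi2_def)

lemma spheroid_class_in_carrier [intro]: "spheroid X x f \<Longrightarrow> spheroid_class X x f \<in> carrier (pi2 X x)"
  by (auto simp: mem_carrier_pi2)

lemma spheroid_class_eqI:
  "homotopic_spheroids X x f g \<Longrightarrow> spheroid_class X x f = spheroid_class X x g"
  using homotopic_spheroids_imp_spheroid(1)[of X x f g] spheroid_class_eq_iff[of X x f g] by simp

lemma spheroid_join: "spheroid X x f \<Longrightarrow> spheroid X x g \<Longrightarrow> spheroid X x (spheroid_join f g)"
  using homotopic_spheroids_join[of X x f f g g] by (simp add: homotopic_spheroids_refl)

lemma spheroid_const: "x \<in> X \<Longrightarrow> spheroid X x (\<lambda>_. x)"
  by (auto simp: spheroid_def)

lemma pi2_mult:
  assumes "spheroid X x f" "spheroid X x g"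
  shows "spheroid_class X x f \<otimes>\<^bsub>pi2 X x\<^esub> spheroid_class X x g = spheroid_class X x (spheroid_join f g)"
proof -
  have "(\<exists>f'\<in>spheroid_class X x f. \<exists>g'\<in>spheroid_class X x g. homotopic_spheroids X x (spheroid_join f' g') r)
         \<longleftrightarrow> homotopic_spheroids X x (spheroid_join f g) r" for r
  proof
    assume "\<exists>f'\<in>spheroid_class X x f. \<exists>g'\<in>spheroid_class X x g. homotopic_spheroids X x (spheroid_join f' g') r"
    then obtain f' g' where *: "homotopic_spheroids X x f f'" "homotopic_spheroids X x g g'"
        "homotopic_spheroids X x (spheroid_join f' g') r"
      by (auto simp: spheroid_class_def)
    show "homotopic_spheroids X x (spheroid_join f g) r"
      using homotopic_spheroids_trans[OF homotopic_spheroids_join[OF *(1,2)] *(3)] .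
  next
    assume "homotopic_spheroids X x (spheroid_join f g) r"
    then show "\<exists>f'\<in>spheroid_class X x f. \<exists>g'\<in>spheroid_class X x g. homotopic_spheroids X x (spheroid_join f' g') r"
      using assms by (intro bexI[of _ f] bexI[of _ g]) (simp_all add: spheroid_class_def homotopic_spheroids_refl)
  qed
  then show ?thesis by (simp add: pi2_def spheroid_class_def)
qed

text \<open>The group laws of the second homotopy group only involve the first coordinate of the square, on which they
  are the reparametrisations known from loops.\<close>
lemma homotopic_spheroids_reparam_Re:
  fixes \<phi> \<psi> :: "real \<Rightarrow> real"
  assumes f: "spheroid X x f" and cont: "continuous_on {-1..1} \<phi>" "continuous_on {-1..1} \<psi>"
    and bound: "\<And>u. \<bar>u\<bar> \<le> 1 \<Longrightarrow> \<bar>\<phi> u\<bar> \<le> 1" "\<And>u. \<bar>u\<bar> \<le> 1 \<Longrightarrow> \<bar>\<psi> u\<bar> \<le> 1"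
    and ends: "\<And>u. \<bar>u\<bar> = 1 \<Longrightarrow> \<phi> u = \<psi> u \<and> \<bar>\<psi> u\<bar> = 1"
  shows "homotopic_spheroids X x (\<lambda>w. f (Complex (\<phi> (Re w)) (Im w))) (\<lambda>w. f (Complex (\<psi> (Re w)) (Im w)))"
proof (rule homotopic_spheroids_precompose[OF f])
  have *: "continuous_on square (\<lambda>w. Complex (k (Re w)) (Im w))" if "continuous_on {-1..1} k" for k
  proof -
    have "continuous_on square (\<lambda>w. k (Re w))"
      by (rule continuous_on_compose2[OF that]) (auto intro!: continuous_intros simp: mem_square sqnorm_le_iff abs_le_iff)
    then show ?thesis by (intro continuous_intros)
  qed
  show "continuous_on square (\<lambda>w. Complex (\<phi> (Re w)) (Im w))" "continuous_on square (\<lambda>w. Complex (\<psi> (Re w)) (Im w))"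
    using * cont by blast+
  show "sqnorm (Complex (\<phi> (Re w)) (Im w)) \<le> 1" "sqnorm (Complex (\<psi> (Re w)) (Im w)) \<le> 1" if "sqnorm w \<le> 1" for w
    using bound that by (auto simp: sqnorm_le_iff)
  fix w and s :: real assume w: "sqnorm w = 1" and s: "s \<in> {0..1}"
  let ?z = "(1 - s) *\<^sub>R Complex (\<phi> (Re w)) (Im w) + s *\<^sub>R Complex (\<psi> (Re w)) (Im w)"
  have le: "\<bar>Re w\<bar> \<le> 1" "\<bar>Im w\<bar> \<le> 1" using w by (auto simp: sqnorm_def)
  have "\<bar>Re ?z\<bar> \<le> (1 - s) * \<bar>\<phi> (Re w)\<bar> + s * \<bar>\<psi> (Re w)\<bar>"
    using s abs_triangle_ineq[of "(1 - s) * \<phi> (Re w)" "s * \<psi> (Re w)"] by (simp add: abs_mult)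
  also have "\<dots> \<le> (1 - s) * 1 + s * 1"
    using s bound le by (intro add_mono mult_left_mono) auto
  finally have re: "\<bar>Re ?z\<bar> \<le> 1" by simp
  have im: "Im ?z = Im w" by (simp add: algebra_simps)
  show "f ?z = x"
  proof (rule spheroidD(3)[OF f])
    show "sqnorm ?z = 1"
    proof (cases "\<bar>Im w\<bar> = 1")
      case True
      then show ?thesis using re im unfolding sqnorm_def by simp
    next
      case False
      then have "\<bar>Re w\<bar> = 1" using w unfolding sqnorm_def by linarith
      then have "Re ?z = \<psi> (Re w)" "\<bar>\<psi> (Re w)\<bar> = 1" using ends[of "Re w"] by (auto simp: algebra_simps)
      then show ?thesis using im le unfolding sqnorm_def by simp
    qed
  qed
qed

lemma spheroid_join_assoc:
  assumes f: "spheroid X x f" and g: "spheroid X x g" and h: "spheroid X x h"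
  shows "homotopic_spheroids X x (spheroid_join (spheroid_join f g) h) (spheroid_join f (spheroid_join g h))"
proof -
  let ?F = "spheroid_join f (spheroid_join g h)"
  define \<phi> where "\<phi> = (\<lambda>u::real. min (2 * u + 1) (min (u + 1/2) (u/2 + 1/2)))"
  have F: "spheroid X x ?F" using f g h by (intro spheroid_join)
  have "homotopic_spheroids X x (\<lambda>w. ?F (Complex (\<phi> (Re w)) (Im w))) (\<lambda>w. ?F (Complex (Re w) (Im w)))"
  proof (rule homotopic_spheroids_reparam_Re[OF F])
    show "continuous_on {-1..1} \<phi>" unfolding \<phi>_def by (intro continuous_intros) auto
    show "\<bar>\<phi> u\<bar> \<le> 1" if "\<bar>u\<bar> \<le> 1" for u using that unfolding \<phi>_def by linarith
    show "\<phi> u = u \<and> \<bar>u\<bar> = 1" if "\<bar>u\<bar> = 1" for u using that unfolding \<phi>_def by linarith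
  qed auto
  moreover have "?F (Complex (\<phi> (Re w)) (Im w)) = spheroid_join (spheroid_join f g) h w" for w
  proof -
    consider "Re w \<le> -1/2" | "-1/2 < Re w" "Re w \<le> 0" | "0 < Re w" by linarith
    then show ?thesis
    proof cases
      case 1
      then have "\<phi> (Re w) = 2 * Re w + 1" unfolding \<phi>_def by linarith
      then show ?thesis using 1 by (simp add: spheroid_join_def)
    next
      case 2
      then have "\<phi> (Re w) = Re w + 1/2" unfolding \<phi>_def by linarith
      then show ?thesis using 2 by (simp add: spheroid_join_def add.commute)
    next
      case 3
      then have "\<phi> (Re w) = Re w / 2 + 1/2" unfolding \<phi>_def by linarith
      then show ?thesis using 3 by (simp add: spheroid_join_def)
    qed
  qed
  ultimately show ?thesis by simp
qed

lemma spheroid_join_const: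
  assumes f: "spheroid X x f"
  shows "homotopic_spheroids X x (spheroid_join (\<lambda>_. x) f) f"
proof -
  have "homotopic_spheroids X x (\<lambda>w. f (Complex (max (-1) (2 * Re w - 1)) (Im w))) (\<lambda>w. f (Complex (Re w) (Im w)))"
    by (rule homotopic_spheroids_reparam_Re[OF f, of "\<lambda>u. max (-1) (2 * u - 1)"]) (auto intro!: continuous_intros)
  moreover have "spheroid_join (\<lambda>_. x) f w = f (Complex (max (-1) (2 * Re w - 1)) (Im w))" if "sqnorm w \<le> 1" for w
  proof (cases "Re w \<le> 0")
    case True
    then have m: "max (-1) (2 * Re w - 1) = -1" by simp
    have "sqnorm (Complex (-1) (Im w)) = 1" using that by (simp add: sqnorm_def)
    then show ?thesis unfolding m using spheroidD(3)[OF f] True by (simp add: spheroid_join_def)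
  qed (simp add: spheroid_join_def)
  ultimately show ?thesis
    using homotopic_spheroids_eq homotopic_spheroids_imp_spheroid homotopic_spheroids_sym homotopic_spheroids_trans
    by (metis (no_types, lifting) complex_surj)
qed

text \<open>The product is \<open>f\<close> composed with a folding of the square along its middle, which can be pulled back to the
  right edge.\<close>
lemma spheroid_join_reflection:
  assumes f: "spheroid X x f"
  defines "f' \<equiv> \<lambda>w. f (Complex (- Re w) (Im w))"
  shows "spheroid X x f'" "homotopic_spheroids X x (spheroid_join f' f) (\<lambda>_. x)"
proof -
  show "spheroid X x f'"
    unfolding f'_def spheroid_def
  proof (intro conjI ballI)
    show "continuous_on square (\<lambda>w. f (Complex (- Re w) (Im w)))"
      by (rule continuous_on_compose2[OF spheroidD(1)[OF f]])
         (auto intro!: continuous_intros simp: mem_square sqnorm_def)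
  qed (use spheroidD(2,3)[OF f] in \<open>auto simp: mem_square frontier_square sqnorm_def\<close>)
  have "homotopic_spheroids X x (\<lambda>w. f (Complex (2 * \<bar>Re w\<bar> - 1) (Im w))) (\<lambda>w. f (Complex 1 (Im w)))"
    by (rule homotopic_spheroids_reparam_Re[OF f, of "\<lambda>u. 2 * \<bar>u\<bar> - 1" "\<lambda>_. 1"]) (auto intro!: continuous_intros)
  moreover have "(\<lambda>w. f (Complex (2 * \<bar>Re w\<bar> - 1) (Im w))) = spheroid_join f' f"
    by (auto simp: fun_eq_iff spheroid_join_def f'_def)
  moreover have "homotopic_spheroids X x (\<lambda>_. x) (\<lambda>w. f (Complex 1 (Im w)))"
  proof (rule homotopic_spheroids_eq[OF spheroid_const[OF spheroid_base[OF f]]])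
    fix w :: complex assume "sqnorm w \<le> 1"
    then have "sqnorm (Complex 1 (Im w)) = 1" by (simp add: sqnorm_def)
    then show "x = f (Complex 1 (Im w))" using spheroidD(3)[OF f] by simp
  qed
  ultimately show "homotopic_spheroids X x (spheroid_join f' f) (\<lambda>_. x)"
    using homotopic_spheroids_sym homotopic_spheroids_trans by metis
qed

lemma group_pi2:
  assumes x: "x \<in> X"
  shows "group (pi2 X x)"
proof (rule groupI)
  have one: "\<one>\<^bsub>pi2 X x\<^esub> = spheroid_class X x (\<lambda>_. x)" by (simp add: pi2_def)
  have sone: "spheroid X x (\<lambda>_. x)" by (rule spheroid_const[OF x])
  show "\<one>\<^bsub>pi2 X x\<^esub> \<in> carrier (pi2 X x)" using sone by (auto simp: one)
  fix \<alpha> assume "\<alpha> \<in> carrier (pi2 X x)"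
  then obtain f where f: "spheroid X x f" "\<alpha> = spheroid_class X x f" by (auto simp: mem_carrier_pi2)
  show "\<one>\<^bsub>pi2 X x\<^esub> \<otimes>\<^bsub>pi2 X x\<^esub> \<alpha> = \<alpha>"
    unfolding one f(2) pi2_mult[OF sone f(1)] by (rule spheroid_class_eqI[OF spheroid_join_const[OF f(1)]])
  note refl = spheroid_join_reflection[OF f(1)]
  have "spheroid_class X x (\<lambda>w. f (Complex (- Re w) (Im w))) \<otimes>\<^bsub>pi2 X x\<^esub> \<alpha> = \<one>\<^bsub>pi2 X x\<^esub>"
    unfolding one f(2) pi2_mult[OF refl(1) f(1)] by (rule spheroid_class_eqI[OF refl(2)])
  then show "\<exists>\<beta>\<in>carrier (pi2 X x). \<beta> \<otimes>\<^bsub>pi2 X x\<^esub> \<alpha> = \<one>\<^bsub>pi2 X x\<^esub>"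
    using refl(1) by blast
  fix \<beta> assume "\<beta> \<in> carrier (pi2 X x)"
  then obtain g where g: "spheroid X x g" "\<beta> = spheroid_class X x g" by (auto simp: mem_carrier_pi2)
  show "\<alpha> \<otimes>\<^bsub>pi2 X x\<^esub> \<beta> \<in> carrier (pi2 X x)"
    unfolding f(2) g(2) pi2_mult[OF f(1) g(1)] using spheroid_join[OF f(1) g(1)] by blast
  fix \<gamma> assume "\<gamma> \<in> carrier (pi2 X x)"
  then obtain h where h: "spheroid X x h" "\<gamma> = spheroid_class X x h" by (auto simp: mem_carrier_pi2)
  show "\<alpha> \<otimes>\<^bsub>pi2 X x\<^esub> \<beta> \<otimes>\<^bsub>pi2 X x\<^esub> \<gamma> = \<alpha> \<otimes>\<^bsub>pi2 X x\<^esub> (\<beta> \<otimes>\<^bsub>pi2 X x\<^esub> \<gamma>)"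
    unfolding f(2) g(2) h(2) pi2_mult[OF f(1) g(1)] pi2_mult[OF g(1) h(1)]
      pi2_mult[OF spheroid_join[OF f(1) g(1)] h(1)] pi2_mult[OF f(1) spheroid_join[OF g(1) h(1)]]
    by (rule spheroid_class_eqI[OF spheroid_join_assoc[OF f(1) g(1) h(1)]])
qed

lemma act_class:
  assumes p: "loop_at X x p" and f: "spheroid X x f"
  shows "act (pi12 X x) (loop_class X p) (spheroid_class X x f) = spheroid_class X x (transport p f)"
proof -
  note p' = loop_atD[OF p]
  have "(\<exists>p'\<in>loop_class X p. \<exists>f'\<in>spheroid_class X x f. homotopic_spheroids X x (transport p' f') r)
         \<longleftrightarrow> homotopic_spheroids X x (transport p f) r" for r
  proof
    assume "\<exists>p'\<in>loop_class X p. \<exists>f'\<in>spheroid_class X x f. homotopic_spheroids X x (transport p' f') r"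
    then obtain q f' where *: "homotopic_paths X p q" "homotopic_spheroids X x f f'"
        "homotopic_spheroids X x (transport q f') r"
      by (auto simp: spheroid_class_def loop_class_def)
    show "homotopic_spheroids X x (transport p f) r"
      using homotopic_spheroids_trans[OF homotopic_spheroids_transport[OF *(1,2) p'(3,4)] *(3)] .
  next
    assume "homotopic_spheroids X x (transport p f) r"
    then show "\<exists>p'\<in>loop_class X p. \<exists>f'\<in>spheroid_class X x f. homotopic_spheroids X x (transport p' f') r"
      using f p' by (intro bexI[of _ p] bexI[of _ f]) (simp_all add: spheroid_class_def loop_class_def homotopic_spheroids_refl)
  qed
  then show ?thesis by (simp add: pi12_def spheroid_class_def)
qed

section \<open>Maps induced on the \<open>\<pi>\<close>-module\<close>

lemma loop_at_image:
  assumes "loop_at X x p" "continuous_on X f" "f ` X \<subseteq> Y" "f x = y"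
  shows "loop_at Y y (f \<circ> p)"
  using assms unfolding loop_at_def
  by (auto intro!: path_continuous_image elim: continuous_on_subset simp: path_image_compose pathstart_compose pathfinish_compose)

text \<open>A set of maps that are all homotopic to \<open>f\<close> relative to the base point acts as \<open>f\<close> does. This evaluates the
  action of a mapping class on a representative, and likewise in \<open>pi2_map_class\<close>.\<close>
lemma pi1_map_class:
  assumes f: "f \<in> \<sigma>" and \<sigma>: "\<forall>k\<in>\<sigma>. homotopic_with_canon (\<lambda>h. h x = y) X Y f k"
    and p: "loop_at X x p"
  shows "pi1_map \<sigma> Y (loop_class X p) = loop_class Y (f \<circ> p)"
proof -
  note p' = loop_atD[OF p]
  have hom: "homotopic_paths Y (f \<circ> p) (k \<circ> q)" if k: "k \<in> \<sigma>" and q: "homotopic_paths X p q" for k q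
  proof -
    have "homotopic_paths Y (f \<circ> p) (k \<circ> p)"
      unfolding homotopic_paths_def
    proof (rule homotopic_with_compose_continuous_right)
      have "f x = y" using homotopic_with_imp_property[OF bspec[OF \<sigma> k]] by simp
      then show "homotopic_with_canon (\<lambda>h. pathstart (h \<circ> p) = pathstart (f \<circ> p) \<and> pathfinish (h \<circ> p) = pathfinish (f \<circ> p)) X Y f k"
        using p'(3,4) by (intro homotopic_with_mono[OF bspec[OF \<sigma> k]]) (auto simp: pathstart_compose pathfinish_compose)
    qed (use p' in \<open>auto simp: path_def path_image_def\<close>)
    also have "homotopic_paths Y (k \<circ> p) (k \<circ> q)"
      using homotopic_with_imp_continuous[OF bspec[OF \<sigma> k]] homotopic_with_imp_subset2[OF bspec[OF \<sigma> k]]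
      by (intro homotopic_paths_continuous_image[OF q]) (auto simp: image_subset_iff_funcset)
    finally show ?thesis .
  qed
  have "(\<exists>k\<in>\<sigma>. \<exists>p'\<in>loop_class X p. homotopic_paths Y (k \<circ> p') r) \<longleftrightarrow> homotopic_paths Y (f \<circ> p) r" for r
  proof
    assume "\<exists>k\<in>\<sigma>. \<exists>p'\<in>loop_class X p. homotopic_paths Y (k \<circ> p') r"
    then obtain k q where *: "k \<in> \<sigma>" "homotopic_paths X p q" "homotopic_paths Y (k \<circ> q) r"
      by (auto simp: loop_class_def)
    show "homotopic_paths Y (f \<circ> p) r" using homotopic_paths_trans[OF hom[OF *(1,2)] *(3)] .
  next
    assume "homotopic_paths Y (f \<circ> p) r"
    then show "\<exists>k\<in>\<sigma>. \<exists>p'\<in>loop_class X p. homotopic_paths Y (k \<circ> p') r"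
      using f p' by (intro bexI[of _ f] bexI[of _ p]) (simp_all add: loop_class_def)
  qed
  then show ?thesis by (simp add: pi1_map_def loop_class_def)
qed

lemma spheroid_image:
  assumes "spheroid X x g" "continuous_on X f" "f ` X \<subseteq> Y" "f x = y"
  shows "spheroid Y y (f \<circ> g)"
  using assms unfolding spheroid_def
  using continuous_on_compose[of square g f] continuous_on_subset[of X f "g ` square"] by auto

lemma homotopic_spheroids_image:
  assumes "homotopic_spheroids X x g h" "continuous_on X f" "f ` X \<subseteq> Y" "f x = y"
  shows "homotopic_spheroids Y y (f \<circ> g) (f \<circ> h)"
  unfolding homotopic_spheroids_def
proof (rule homotopic_with_compose_continuous_left)
  show "homotopic_with_canon (\<lambda>k. \<forall>w\<in>frontier square. (f \<circ> k) w = y) square X g h"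
    using assms(1,4) unfolding homotopic_spheroids_def by (elim homotopic_with_mono) auto
qed (use assms in auto)

lemma pi2_map_class:
  assumes f: "f \<in> \<sigma>" and \<sigma>: "\<forall>k\<in>\<sigma>. homotopic_with_canon (\<lambda>h. h x = y) X Y f k"
    and g: "spheroid X x g"
  shows "pi2_map \<sigma> Y y (spheroid_class X x g) = spheroid_class Y y (f \<circ> g)"
proof -
  have hom: "homotopic_spheroids Y y (f \<circ> g) (k \<circ> h)" if k: "k \<in> \<sigma>" and h: "homotopic_spheroids X x g h" for k h
  proof -
    have "homotopic_spheroids Y y (f \<circ> g) (k \<circ> g)"
      unfolding homotopic_spheroids_def
    proof (rule homotopic_with_compose_continuous_right)
      show "homotopic_with_canon (\<lambda>h. \<forall>w\<in>frontier square. (h \<circ> g) w = y) X Y f k"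
        using g by (intro homotopic_with_mono[OF bspec[OF \<sigma> k]]) (auto simp: spheroid_def)
    qed (use g in \<open>auto simp: spheroid_def\<close>)
    also have "homotopic_spheroids Y y (k \<circ> g) (k \<circ> h)"
      using homotopic_with_imp_continuous[OF bspec[OF \<sigma> k]] homotopic_with_imp_subset2[OF bspec[OF \<sigma> k]]
        homotopic_with_imp_property[OF bspec[OF \<sigma> k]]
      by (intro homotopic_spheroids_image[OF h]) auto
    finally show ?thesis .
  qed
  have "(\<exists>k\<in>\<sigma>. \<exists>g'\<in>spheroid_class X x g. homotopic_spheroids Y y (k \<circ> g') r) \<longleftrightarrow> homotopic_spheroids Y y (f \<circ> g) r" for r
  proof
    assume "\<exists>k\<in>\<sigma>. \<exists>g'\<in>spheroid_class X x g. homotopic_spheroids Y y (k \<circ> g') r"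
    then obtain k h where *: "k \<in> \<sigma>" "homotopic_spheroids X x g h" "homotopic_spheroids Y y (k \<circ> h) r"
      by (auto simp: spheroid_class_def)
    show "homotopic_spheroids Y y (f \<circ> g) r" using homotopic_spheroids_trans[OF hom[OF *(1,2)] *(3)] .
  next
    assume "homotopic_spheroids Y y (f \<circ> g) r"
    then show "\<exists>k\<in>\<sigma>. \<exists>g'\<in>spheroid_class X x g. homotopic_spheroids Y y (k \<circ> g') r"
      using f g by (intro bexI[of _ f] bexI[of _ g]) (simp_all add: spheroid_class_def homotopic_spheroids_refl)
  qed
  then show ?thesis by (simp add: pi2_map_def spheroid_class_def)
qed

lemma comp_spheroid_join: "f \<circ> spheroid_join g h = spheroid_join (f \<circ> g) (f \<circ> h)"
  by (auto simp: fun_eq_iff spheroid_join_def)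

lemma comp_transport: "f \<circ> transport p g = transport (f \<circ> p) (f \<circ> g)"
  by (auto simp: fun_eq_iff transport_def)

lemma induced_pi12_class:
  assumes f: "f \<in> \<sigma>" and \<sigma>: "\<forall>k\<in>\<sigma>. homotopic_with_canon (\<lambda>h. h x = x) X X f k"
  shows "loop_at X x p \<Longrightarrow> fst (induced_pi12 \<sigma> X x) (loop_class X p) = loop_class X (f \<circ> p)"
    and "spheroid X x g \<Longrightarrow> snd (induced_pi12 \<sigma> X x) (spheroid_class X x g) = spheroid_class X x (f \<circ> g)"
  using pi1_map_class[OF f \<sigma>] pi2_map_class[OF f \<sigma>] by (auto simp: induced_pi12_def)

lemma induced_pi12_mor:
  assumes f: "f \<in> \<sigma>" and \<sigma>: "\<forall>k\<in>\<sigma>. homotopic_with_canon (\<lambda>h. h x = x) X X f k"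
  shows "induced_pi12 \<sigma> X x \<in> pi_mor (pi12 X x) (pi12 X x)"
proof -
  let ?I = "induced_pi12 \<sigma> X x"
  note cl = induced_pi12_class[OF f \<sigma>]
  have cont: "continuous_on X f" "f ` X \<subseteq> X" "f x = x"
    using homotopic_with_imp_continuous[OF bspec[OF \<sigma> f]] homotopic_with_imp_subset1[OF bspec[OF \<sigma> f]]
      homotopic_with_imp_property[OF bspec[OF \<sigma> f]] by auto
  have GA: "Grp (pi12 X x) = pi1 X x" "Ab (pi12 X x) = pi2 X x" by (auto simp: pi12_def)
  have lf: "loop_at X x (f \<circ> p)" if "loop_at X x p" for p
    using loop_at_image[OF that cont] .
  have sf: "spheroid X x (f \<circ> g)" if "spheroid X x g" for g
    using spheroid_image[OF that cont] .
  have "fst ?I \<in> hom (pi1 X x) (pi1 X x)"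
  proof (rule homI)
    fix \<alpha> assume "\<alpha> \<in> carrier (pi1 X x)"
    then obtain p where p: "loop_at X x p" "\<alpha> = loop_class X p" by (auto simp: mem_carrier_pi1)
    then show "fst ?I \<alpha> \<in> carrier (pi1 X x)" using cl(1) lf by auto
    fix \<beta> assume "\<beta> \<in> carrier (pi1 X x)"
    then obtain q where q: "loop_at X x q" "\<beta> = loop_class X q" by (auto simp: mem_carrier_pi1)
    show "fst ?I (\<alpha> \<otimes>\<^bsub>pi1 X x\<^esub> \<beta>) = fst ?I \<alpha> \<otimes>\<^bsub>pi1 X x\<^esub> fst ?I \<beta>"
      unfolding p(2) q(2) pi1_mult[OF p(1) q(1)] cl(1)[OF p(1)] cl(1)[OF q(1)] cl(1)[OF loop_at_join[OF p(1) q(1)]]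
        pi1_mult[OF lf[OF p(1)] lf[OF q(1)]] path_compose_join ..
  qed
  moreover have "snd ?I \<in> hom (pi2 X x) (pi2 X x)"
  proof (rule homI)
    fix \<alpha> assume "\<alpha> \<in> carrier (pi2 X x)"
    then obtain p where p: "spheroid X x p" "\<alpha> = spheroid_class X x p" by (auto simp: mem_carrier_pi2)
    then show "snd ?I \<alpha> \<in> carrier (pi2 X x)" using cl(2) sf by auto
    fix \<beta> assume "\<beta> \<in> carrier (pi2 X x)"
    then obtain q where q: "spheroid X x q" "\<beta> = spheroid_class X x q" by (auto simp: mem_carrier_pi2)
    show "snd ?I (\<alpha> \<otimes>\<^bsub>pi2 X x\<^esub> \<beta>) = snd ?I \<alpha> \<otimes>\<^bsub>pi2 X x\<^esub> snd ?I \<beta>"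
      unfolding p(2) q(2) pi2_mult[OF p(1) q(1)] cl(2)[OF p(1)] cl(2)[OF q(1)] cl(2)[OF spheroid_join[OF p(1) q(1)]]
        pi2_mult[OF sf[OF p(1)] sf[OF q(1)]] comp_spheroid_join ..
  qed
  moreover have "snd ?I (act (pi12 X x) \<gamma> \<kappa>) = act (pi12 X x) (fst ?I \<gamma>) (snd ?I \<kappa>)"
    if in_carrier: "\<gamma> \<in> carrier (pi1 X x)" "\<kappa> \<in> carrier (pi2 X x)" for \<gamma> \<kappa>
  proof -
    obtain p where p: "loop_at X x p" "\<gamma> = loop_class X p" using in_carrier by (auto simp: mem_carrier_pi1)
    obtain g where g: "spheroid X x g" "\<kappa> = spheroid_class X x g" using in_carrier by (auto simp: mem_carrier_pi2)
    have tr: "spheroid X x (transport p g)"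
      using spheroid_transport[of p X g] loop_atD[OF p(1)] g(1) by auto
    show ?thesis
      unfolding p(2) g(2) act_class[OF p(1) g(1)] cl(1)[OF p(1)] cl(2)[OF g(1)] cl(2)[OF tr]
        act_class[OF lf[OF p(1)] sf[OF g(1)]] comp_transport ..
  qed
  moreover have "fst ?I \<in> extensional (carrier (pi1 X x))" "snd ?I \<in> extensional (carrier (pi2 X x))"
    by (auto simp: induced_pi12_def)
  ultimately show ?thesis
    unfolding pi_mor_def GA by (simp add: case_prod_unfold)
qed

lemma pi_comp_induced:
  assumes f: "f \<in> \<sigma>" and \<sigma>: "\<forall>k\<in>\<sigma>. homotopic_with_canon (\<lambda>h. h x = x) X X f k"
    and g: "g \<in> \<tau>" and \<tau>: "\<forall>k\<in>\<tau>. homotopic_with_canon (\<lambda>h. h x = x) X X g k"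
    and inv: "\<And>z. z \<in> X \<Longrightarrow> f (g z) = z"
  shows "pi_comp (pi12 X x) (induced_pi12 \<sigma> X x) (induced_pi12 \<tau> X x) = pi_id (pi12 X x)"
proof -
  note clf = induced_pi12_class[OF f \<sigma>] and clg = induced_pi12_class[OF g \<tau>]
  have cont: "continuous_on X g" "g ` X \<subseteq> X" "g x = x"
    using homotopic_with_imp_continuous[OF bspec[OF \<tau> g]] homotopic_with_imp_subset1[OF bspec[OF \<tau> g]]
      homotopic_with_imp_property[OF bspec[OF \<tau> g]] by auto
  have GA: "Grp (pi12 X x) = pi1 X x" "Ab (pi12 X x) = pi2 X x" by (auto simp: pi12_def)
  have "fst (induced_pi12 \<sigma> X x) (fst (induced_pi12 \<tau> X x) \<gamma>) = \<gamma>" if in_carrier: "\<gamma> \<in> carrier (pi1 X x)" for \<gamma>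
  proof -
    obtain p where p: "loop_at X x p" "\<gamma> = loop_class X p" using in_carrier by (auto simp: mem_carrier_pi1)
    note p' = loop_atD[OF p(1)]
    have "homotopic_paths X p (f \<circ> (g \<circ> p))"
      by (rule homotopic_paths_eq[OF p'(1,2)]) (use p'(2) inv in \<open>simp add: path_image_def image_subset_iff\<close>)
    then show ?thesis
      unfolding p(2) clg(1)[OF p(1)] clf(1)[OF loop_at_image[OF p(1) cont]] by (rule loop_class_eqI[symmetric])
  qed
  moreover have "snd (induced_pi12 \<sigma> X x) (snd (induced_pi12 \<tau> X x) \<kappa>) = \<kappa>" if in_carrier: "\<kappa> \<in> carrier (pi2 X x)" for \<kappa>
  proof -
    obtain p where p: "spheroid X x p" "\<kappa> = spheroid_class X x p" using in_carrier by (auto simp: mem_carrier_pi2)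
    have "homotopic_spheroids X x p (f \<circ> (g \<circ> p))"
      by (rule homotopic_spheroids_eq[OF p(1)]) (use spheroidD(2)[OF p(1)] inv in auto)
    then show ?thesis
      unfolding p(2) clg(2)[OF p(1)] clf(2)[OF spheroid_image[OF p(1) cont]] by (rule spheroid_class_eqI[symmetric])
  qed
  ultimately show ?thesis
    unfolding pi_comp_def pi_id_def GA by (auto simp: compose_def restrict_def fun_eq_iff)
qed

lemma induced_pi12_in_pi_Aut:
  assumes f: "f \<in> \<sigma>" and \<sigma>: "\<forall>k\<in>\<sigma>. homotopic_with_canon (\<lambda>h. h x = x) X X f k"
    and g: "continuous_on X g" "g ` X \<subseteq> X" "g x = x"
    and inv: "\<And>z. z \<in> X \<Longrightarrow> f (g z) = z" "\<And>z. z \<in> X \<Longrightarrow> g (f z) = z"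
  shows "induced_pi12 \<sigma> X x \<in> carrier (pi_Aut (pi12 X x))"
proof -
  have G: "\<forall>k\<in>{g}. homotopic_with_canon (\<lambda>h. h x = x) X X g k"
    using g by (auto simp: image_subset_iff_funcset)
  have g': "g \<in> {g}" by simp
  show ?thesis
    using induced_pi12_mor[OF f \<sigma>] induced_pi12_mor[OF g' G] pi_comp_induced[OF f \<sigma> g' G inv(1)]
      pi_comp_induced[OF g' G f \<sigma> inv(2)]
    by (auto simp: pi_Aut_def)
qed


section \<open>Unions of simply connected sets\<close>

lemma homotopic_paths_cancel_left:
  fixes X :: "'a::real_normed_vector set"
  assumes c: "path c" "path_image c \<subseteq> X" and g: "path g" "path_image g \<subseteq> X"
    and cg: "pathfinish c = pathstart g"
  shows "homotopic_paths X (reversepath c +++ (c +++ g)) g"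
proof -
  have "homotopic_paths X (reversepath c +++ (c +++ g)) ((reversepath c +++ c) +++ g)"
    using c g cg by (intro homotopic_paths_assoc) auto
  also have "homotopic_paths X ((reversepath c +++ c) +++ g) (linepath (pathfinish c) (pathfinish c) +++ g)"
    using c g cg by (intro homotopic_paths_join homotopic_paths_linv) auto
  also have "homotopic_paths X (linepath (pathfinish c) (pathfinish c) +++ g) g"
    using g cg by (intro homotopic_paths_lid') auto
  finally show ?thesis .
qed

lemma homotopic_paths_left_cancel:
  fixes X :: "'a::real_normed_vector set"
  assumes "homotopic_paths X (c +++ g) (c +++ k)"
    and c: "path c" "path_image c \<subseteq> X" and g: "path g" "path_image g \<subseteq> X" "pathfinish c = pathstart g"
    and k: "path k" "path_image k \<subseteq> X" "pathfinish c = pathstart k"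
  shows "homotopic_paths X g k"
proof -
  have "homotopic_paths X g (reversepath c +++ (c +++ g))"
    using homotopic_paths_cancel_left[OF c g] by (rule homotopic_paths_sym)
  also have "homotopic_paths X (reversepath c +++ (c +++ g)) (reversepath c +++ (c +++ k))"
    by (rule homotopic_paths_join) (use assms(1) c g in auto)
  also have "homotopic_paths X (reversepath c +++ (c +++ k)) k"
    by (rule homotopic_paths_cancel_left[OF c k])
  finally show ?thesis .
qed

lemma simply_connected_homotopic:
  fixes S :: "'a::real_normed_vector set"
  assumes "simply_connected S" "path p" "path_image p \<subseteq> S" "path q" "path_image q \<subseteq> S"
    "pathstart q = pathstart p" "pathfinish q = pathfinish p" "S \<subseteq> T"
  shows "homotopic_paths T p q"
  using assms simply_connected_eq_homotopic_paths[of S] homotopic_paths_subset by metis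

text \<open>The simply connected case of the theorem of Seifert and van Kampen. A path from \<open>x0\<close> is called small if it stays in one
  of the two sets; since the intersection is path connected, small paths with the same end are homotopic.
  For every path \<open>g\<close> the homotopy class of a small path to its start, followed by \<open>g\<close>, is that of a small path
  to its end: this holds for short pieces of \<open>g\<close>, which stay in one of the sets, and it is
  inherited by concatenations. Hence the class of \<open>g\<close> depends on its ends only.\<close>
lemma simply_connected_Un_open:
  fixes A B :: "'a::real_normed_vector set"
  assumes opA: "openin (top_of_set (A \<union> B)) A" and opB: "openin (top_of_set (A \<union> B)) B"
    and A: "simply_connected A" and B: "simply_connected B"
    and AB: "path_connected (A \<inter> B)" "A \<inter> B \<noteq> {}"
  shows "simply_connected (A \<union> B)"
proof -
  let ?X = "A \<union> B"
  obtain x0 where x0: "x0 \<in> A" "x0 \<in> B" using AB(2) by blast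
  have pcA: "path_connected A" and pcB: "path_connected B"
    using A B simply_connected_imp_path_connected by auto
  define small where "small = (\<lambda>c. path c \<and> pathstart c = x0 \<and> (path_image c \<subseteq> A \<or> path_image c \<subseteq> B))"
  have mixed: "homotopic_paths ?X u w"
    if u: "path u" "pathstart u = x0" "path_image u \<subseteq> A" and w: "path w" "pathstart w = x0" "path_image w \<subseteq> B"
      and uw: "pathfinish u = pathfinish w" for u w
  proof -
    have "pathfinish u \<in> A \<inter> B" using u w uw pathfinish_in_path_image by fastforce
    then obtain v where v: "path v" "path_image v \<subseteq> A \<inter> B" "pathstart v = x0" "pathfinish v = pathfinish u"
      using AB(1) x0 unfolding path_connected_def by blast
    have "homotopic_paths ?X u v" by (rule simply_connected_homotopic[OF A]) (use u v in auto)
    also have "homotopic_paths ?X v w" by (rule simply_connected_homotopic[OF B]) (use v w uw in auto)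
    finally show ?thesis .
  qed
  have small_unique: "homotopic_paths ?X u w" if u: "small u" and w: "small w" and uw: "pathfinish u = pathfinish w" for u w
  proof -
    consider "path_image u \<subseteq> A" "path_image w \<subseteq> A" | "path_image u \<subseteq> B" "path_image w \<subseteq> B"
      | "path_image u \<subseteq> A" "path_image w \<subseteq> B" | "path_image u \<subseteq> B" "path_image w \<subseteq> A"
      using u w unfolding small_def by blast
    then show ?thesis
    proof cases
      case 1
      show ?thesis by (rule simply_connected_homotopic[OF A]) (use u w uw 1 in \<open>auto simp: small_def\<close>)
    next
      case 2
      show ?thesis by (rule simply_connected_homotopic[OF B]) (use u w uw 2 in \<open>auto simp: small_def\<close>)
    next
      case 3
      then show ?thesis using mixed u w uw unfolding small_def by auto
    next
      case 4
      then show ?thesis using mixed[of w u] u w uw homotopic_paths_sym unfolding small_def by auto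
    qed
  qed
  have "\<exists>c. small c \<and> pathfinish c = z" if "z \<in> ?X" for z
    using that x0 pcA pcB unfolding path_connected_def small_def by blast
  then obtain s where s: "\<And>z. z \<in> ?X \<Longrightarrow> small (s z)" "\<And>z. z \<in> ?X \<Longrightarrow> pathfinish (s z) = z"
    by metis
  have smallD: "path c" "pathstart c = x0" "path_image c \<subseteq> ?X" if "small c" for c
    using that unfolding small_def by auto
  have key: "homotopic_paths ?X (s (g 0) +++ g) (s (g 1))"
    if g: "path g" "path_image g \<subseteq> ?X" for g :: "real \<Rightarrow> 'a"
  proof -
    have gX: "g t \<in> ?X" if "t \<in> {0..1}" for t using g(2) that unfolding path_image_def by blast
    define P where "P = (\<lambda>a b. 0 \<le> a \<and> a \<le> b \<and> b \<le> 1 \<longrightarrow>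
        homotopic_paths ?X (s (g a) +++ subpath a b g) (s (g b)))"
    have sub: "path (subpath a b g)" "path_image (subpath a b g) \<subseteq> ?X" if "0 \<le> a" "a \<le> b" "b \<le> 1" for a b
      using g that path_image_subpath_subset[of a b g] by auto
    have "P 0 1"
    proof (rule Bolzano)
      show "(0::real) \<le> 1" by simp
    next
      fix a b c :: real assume P: "P a b" "P b c" and abc: "a \<le> b" "b \<le> c"
      show "P a c"
        unfolding P_def
      proof (intro impI)
        assume r: "0 \<le> a \<and> a \<le> c \<and> c \<le> 1"
        note sa = smallD[OF s(1)[OF gX[of a]]] s(2)[OF gX[of a]]
        have "homotopic_paths ?X (s (g a) +++ subpath a c g) (s (g a) +++ (subpath a b g +++ subpath b c g))"
          using r abc sa g sub
          by (intro homotopic_paths_join homotopic_paths_sym[OF homotopic_join_subpaths]) auto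
        also have "homotopic_paths ?X (s (g a) +++ (subpath a b g +++ subpath b c g)) ((s (g a) +++ subpath a b g) +++ subpath b c g)"
          using r abc sa sub by (intro homotopic_paths_assoc) auto
        also have "homotopic_paths ?X ((s (g a) +++ subpath a b g) +++ subpath b c g) (s (g b) +++ subpath b c g)"
          using r abc sa sub P(1) by (intro homotopic_paths_join) (auto simp: P_def)
        also have "homotopic_paths ?X (s (g b) +++ subpath b c g) (s (g c))"
          using P(2) r abc by (auto simp: P_def)
        finally show "homotopic_paths ?X (s (g a) +++ subpath a c g) (s (g c))" .
      qed
    next
      fix t :: real assume t: "0 \<le> t" "t \<le> 1"
      have loc: "\<exists>d>0. \<forall>a b. a \<le> t \<and> t \<le> b \<and> b - a < d \<longrightarrow> P a b"
        if gt: "g t \<in> C" and op: "openin (top_of_set ?X) C" and pc: "path_connected C" "x0 \<in> C"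
          and sm: "\<And>c. path c \<Longrightarrow> pathstart c = x0 \<Longrightarrow> path_image c \<subseteq> C \<Longrightarrow> small c" for C
      proof -
        obtain U where U: "open U" "C = ?X \<inter> U" using op by (auto simp: openin_open)
        have "continuous_on {0..1} g" using g(1) by (simp add: path_def)
        then have "\<exists>T. open T \<and> t \<in> T \<and> (\<forall>y\<in>{0..1}. y \<in> T \<longrightarrow> g y \<in> U)"
          using U gt t unfolding continuous_on_topological by (metis Int_iff atLeastAtMost_iff)
        then obtain T where T: "open T" "t \<in> T" "\<And>y. y \<in> {0..1} \<Longrightarrow> y \<in> T \<Longrightarrow> g y \<in> U" by blast
        obtain d where d: "d > 0" "ball t d \<subseteq> T" using T(1,2) openE by blast
        have "P a b" if ab: "a \<le> t" "t \<le> b" "b - a < d" for a b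
          unfolding P_def
        proof (intro impI)
          assume r: "0 \<le> a \<and> a \<le> b \<and> b \<le> 1"
          have gC: "g y \<in> C" if "y \<in> {a..b}" for y
          proof -
            have "y \<in> ball t d" using that ab by (auto simp: dist_real_def)
            then show ?thesis using d(2) T(3)[of y] gX[of y] U(2) r that by auto
          qed
          obtain u where u: "path u" "path_image u \<subseteq> C" "pathstart u = x0" "pathfinish u = g a"
            using pc gC[of a] r unfolding path_connected_def by (metis atLeastAtMost_iff order_refl)
          have su: "small u" using sm u by blast
          have subC: "path_image (subpath a b g) \<subseteq> C"
            using gC r by (auto simp: path_image_subpath_gen closed_segment_eq_real_ivl)
          have ga: "g a \<in> ?X" "g b \<in> ?X" using gX r by auto
          have "homotopic_paths ?X (s (g a) +++ subpath a b g) (u +++ subpath a b g)"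
            using sub r small_unique[OF s(1)[OF ga(1)] su] s(2)[OF ga(1)] u
            by (intro homotopic_paths_join) auto
          also have "homotopic_paths ?X (u +++ subpath a b g) (s (g b))"
          proof (rule small_unique)
            show "small (u +++ subpath a b g)"
              using sub r u subC by (intro sm subset_path_image_join) auto
          qed (use s ga in auto)
          finally show "homotopic_paths ?X (s (g a) +++ subpath a b g) (s (g b))" .
        qed
        then show ?thesis using d(1) by blast
      qed
      have "g t \<in> A \<or> g t \<in> B" using gX[of t] t by auto
      then show "\<exists>d>0. \<forall>a b. a \<le> t \<and> t \<le> b \<and> b - a < d \<longrightarrow> P a b"
        using loc[of A] loc[of B] opA opB pcA pcB x0 unfolding small_def by blast
    qed
    then show ?thesis by (simp add: P_def)
  qed
  show ?thesis
    unfolding simply_connected_eq_homotopic_paths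
  proof (intro conjI allI impI)
    show "path_connected ?X" using pcA pcB AB(2) by (intro path_connected_Un)
    fix g k assume gk: "path g \<and> path_image g \<subseteq> ?X \<and> path k \<and> path_image k \<subseteq> ?X \<and>
       pathstart k = pathstart g \<and> pathfinish k = pathfinish g"
    then have eq: "k 0 = g 0" "k 1 = g 1" by (auto simp: pathstart_def pathfinish_def)
    have "pathstart g \<in> ?X" using gk pathstart_in_path_image by blast
    then have g0: "g 0 \<in> ?X" by (simp add: pathstart_def)
    have "homotopic_paths ?X (s (g 0) +++ g) (s (g 0) +++ k)"
      using key[of g] key[of k] gk eq by (metis homotopic_paths_sym homotopic_paths_trans)
    then show "homotopic_paths ?X g k"
      by (rule homotopic_paths_left_cancel) (use smallD[OF s(1)[OF g0]] s(2)[OF g0] gk eq in \<open>auto simp: pathstart_def\<close>)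
  qed
qed

section \<open>The square slit along two segments\<close>

lemma contractible_two_step:
  fixes S :: "'a::real_normed_vector set"
  assumes cont: "continuous_on S \<pi>" and seg1: "\<And>x. x \<in> S \<Longrightarrow> closed_segment x (\<pi> x) \<subseteq> S"
    and seg2: "\<And>x. x \<in> S \<Longrightarrow> closed_segment (\<pi> x) a \<subseteq> S"
  shows "contractible S"
proof -
  have "homotopic_with_canon (\<lambda>x. True) S S id \<pi>"
    using cont seg1 by (intro homotopic_with_linear) auto
  moreover have "homotopic_with_canon (\<lambda>x. True) S S \<pi> (\<lambda>x. a)"
    using cont seg2 by (intro homotopic_with_linear) auto
  ultimately show ?thesis
    unfolding contractible_def by (meson homotopic_with_trans)
qed

text \<open>The slits start at the left edge, so the horizontal projection to the right edge never crosses them.\<close>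
lemma simply_connected_slit_square:
  assumes "p \<in> interior D2" "q \<in> interior D2"
  shows "simply_connected (D2 - (seg p \<union> seg q))"
proof (rule contractible_imp_simply_connected, rule contractible_two_step[where \<pi> = "\<lambda>w. Complex 1 (Im w)" and a = 1])
  have bnds: "0 < Re p" "Re p < 1" "0 < Re q" "Re q < 1" using assms by (auto simp: interior_D2)
  have S: "w \<in> D2 - (seg p \<union> seg q) \<longleftrightarrow> w \<in> D2 \<and> (Im w = Im p \<longrightarrow> Re w > Re p) \<and> (Im w = Im q \<longrightarrow> Re w > Re q)" for w
    using bnds by (auto simp: seg_alt D2_alt)
  fix x assume x: "x \<in> D2 - (seg p \<union> seg q)"
  then have xD: "Complex 1 (Im x) \<in> D2" "(1::complex) \<in> D2" by (auto simp: D2_alt)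
  show "closed_segment x (Complex 1 (Im x)) \<subseteq> D2 - (seg p \<union> seg q)"
  proof
    fix z assume z: "z \<in> closed_segment x (Complex 1 (Im x))"
    have "z \<in> D2" using z x xD convex_D2 by (meson DiffD1 convex_contains_segment subsetD)
    moreover have "Im z = Im x" "Re z \<ge> Re x"
    proof -
      obtain u where u: "0 \<le> u" "u \<le> 1" "z = (1 - u) *\<^sub>R x + u *\<^sub>R Complex 1 (Im x)" using z by (auto simp: in_segment)
      have "Im z = (1 - u) * Im x + u * Im x" "Re z = (1 - u) * Re x + u" using u by simp_all
      moreover have "u * Re x \<le> u * 1" using u x by (intro mult_left_mono) (auto simp: D2_alt)
      ultimately show "Im z = Im x" "Re z \<ge> Re x" by (auto simp: algebra_simps)
    qed
    ultimately show "z \<in> D2 - (seg p \<union> seg q)" using x unfolding S by auto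
  qed
  show "closed_segment (Complex 1 (Im x)) 1 \<subseteq> D2 - (seg p \<union> seg q)"
  proof
    fix z assume z: "z \<in> closed_segment (Complex 1 (Im x)) 1"
    have "z \<in> D2" using z xD convex_D2 by (meson convex_contains_segment subsetD)
    moreover have "Re z = 1"
    proof -
      obtain u where u: "z = (1 - u) *\<^sub>R Complex 1 (Im x) + u *\<^sub>R 1" using z by (auto simp: in_segment)
      show ?thesis unfolding u by simp
    qed
    ultimately show "z \<in> D2 - (seg p \<union> seg q)" using bnds unfolding S by auto
  qed
qed (intro continuous_intros)

section \<open>Rotating sets and homeomorphisms\<close>

text \<open>The left inverse of \<open>emb\<close> on the half-plane, which forgets the angle: rotationally symmetric sets are preimages under it.\<close>
definition cyl :: "complex \<times> real \<Rightarrow> complex" where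
  "cyl x = Complex (cmod (fst x)) (snd x)"

lemma continuous_on_cyl [continuous_intros]: "continuous_on S f \<Longrightarrow> continuous_on S (\<lambda>x. cyl (f x))"
  unfolding cyl_def by (intro continuous_intros)

lemma Re_cyl [simp]: "Re (cyl x) = cmod (fst x)" and Im_cyl [simp]: "Im (cyl x) = snd x"
  by (auto simp: cyl_def)

lemma mem_rotate_set:
  assumes "\<And>w. w \<in> S \<Longrightarrow> 0 \<le> Re w"
  shows "x \<in> rotate_set S \<longleftrightarrow> cyl x \<in> S"
proof
  assume "x \<in> rotate_set S"
  then obtain u w where "x = (u * of_real (Re w), Im w)" "cmod u = 1" "w \<in> S"
    unfolding rotate_set_def by blast
  then have "cyl x = w" using assms by (simp add: cyl_def complex_eq_iff norm_mult)
  then show "cyl x \<in> S" using \<open>w \<in> S\<close> by simp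
next
  assume x: "cyl x \<in> S"
  define u where "u = (if fst x = 0 then 1 else sgn (fst x))"
  have "cmod u = 1" by (simp add: u_def norm_sgn)
  moreover have "x = (u * of_real (Re (cyl x)), Im (cyl x))"
    by (cases x) (simp add: u_def sgn_div_norm scaleR_conv_of_real)
  ultimately show "x \<in> rotate_set S" unfolding rotate_set_def using x by blast
qed

lemma mem_D3: "x \<in> D3 \<longleftrightarrow> cyl x \<in> D2"
  unfolding D3_def by (rule mem_rotate_set) (auto simp: D2_alt)

lemma mem_D3_iff: "x \<in> D3 \<longleftrightarrow> cmod (fst x) \<le> 1 \<and> 0 \<le> snd x \<and> snd x \<le> 1"
  by (auto simp: mem_D3 D2_alt)

lemma D3_Times: "D3 = cball 0 1 \<times> {0..1}"
  by (auto simp: mem_D3_iff)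

lemma frontier_D3: "x \<in> frontier D3 \<longleftrightarrow> x \<in> D3 \<and> (cmod (fst x) = 1 \<or> snd x = 0 \<or> snd x = 1)"
proof -
  have "closed D3" unfolding D3_Times by (intro closed_Times) auto
  moreover have "interior D3 = ball 0 1 \<times> {0<..<1}"
    unfolding D3_Times by (simp add: interior_Times interior_cball)
  ultimately show ?thesis by (cases x) (auto simp: frontier_def mem_D3_iff)
qed

lemma rotate_set_Diff:
  assumes "\<And>w. w \<in> S \<Longrightarrow> 0 \<le> Re w" "T \<subseteq> S"
  shows "rotate_set (S - T) = rotate_set S - rotate_set T"
proof -
  have *: "0 \<le> Re w" if "w \<in> S - T \<or> w \<in> T" for w using assms that by auto
  show ?thesis
    using mem_rotate_set[of "S - T"] mem_rotate_set[of T] mem_rotate_set[of S] * assms(1) by blast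
qed

lemma cyl_emb: "0 \<le> Re w \<Longrightarrow> cyl (emb w) = w"
  by (simp add: cyl_def emb_def complex_eq_iff)

lemma continuous_on_emb [continuous_intros]: "continuous_on S f \<Longrightarrow> continuous_on S (\<lambda>x. emb (f x))"
  unfolding emb_def by (intro continuous_intros)

lemma emb_in_rotate_set: "w \<in> S \<Longrightarrow> emb w \<in> rotate_set S"
  unfolding rotate_set_def emb_def by (force intro: exI[of _ 1])

text \<open>The angle \<open>sgn (z x)\<close> jumps on the axis; this does no harm where the distance from the axis vanishes.\<close>
lemma continuous_on_sgn_mult:
  fixes z :: "'a::topological_space \<Rightarrow> complex"
  assumes z: "continuous_on S z" and r: "continuous_on S r" and zero: "\<And>x. x \<in> S \<Longrightarrow> z x = 0 \<Longrightarrow> r x = 0"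
  shows "continuous_on S (\<lambda>x. sgn (z x) * of_real (r x))"
  unfolding continuous_on_def
proof
  fix x assume x: "x \<in> S"
  have zt: "(z \<longlongrightarrow> z x) (at x within S)" and rt: "(r \<longlongrightarrow> r x) (at x within S)"
    using z r x by (auto simp: continuous_on_def)
  show "((\<lambda>x. sgn (z x) * of_real (r x)) \<longlongrightarrow> sgn (z x) * of_real (r x)) (at x within S)"
  proof (cases "z x = 0")
    case True
    then have r0: "(r \<longlongrightarrow> 0) (at x within S)" using rt zero[OF x] by simp
    have "((\<lambda>x. sgn (z x) * of_real (r x)) \<longlongrightarrow> 0) (at x within S)"
      by (rule tendsto_0_le[OF r0, where K = 1]) (auto simp: norm_mult norm_sgn intro!: always_eventually)
    then show ?thesis using zero[OF x True] by simp
  next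
    case False
    then show ?thesis using zt rt by (intro tendsto_intros)
  qed
qed

lemma sgn_mult_cmod: "sgn z * of_real (cmod z) = z"
  by (simp add: sgn_eq)

lemma rotate_map_alt: "rotate_map h x = (sgn (fst x) * of_real (Re (h (cyl x))), Im (h (cyl x)))"
  by (simp add: rotate_map_def cyl_def case_prod_unfold Let_def)

lemma axis_in_frontier: "w \<in> D2 \<Longrightarrow> Re w = 0 \<Longrightarrow> w \<in> frontier D2"
  by (simp add: frontier_D2)

text \<open>The last property holds because the axis is part of the boundary, which is fixed, and the homeomorphism is injective.\<close>
lemma homeosD:
  assumes "h \<in> homeos D2 A"
  shows "continuous_on D2 h" "h ` D2 = D2" "inj_on h D2" "\<And>w. w \<in> D2 \<Longrightarrow> h w \<in> D2"
    "\<And>w. w \<in> frontier D2 \<Longrightarrow> h w = w" "h ` A = A"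
    "\<And>w. w \<in> D2 \<Longrightarrow> Re (h w) = 0 \<longleftrightarrow> Re w = 0"
proof -
  obtain g where g: "homeomorphism D2 D2 h g" using assms by (auto simp: homeos_def)
  then show "continuous_on D2 h" and im: "h ` D2 = D2" and inj: "inj_on h D2"
    unfolding homeomorphism_def by (auto intro: inj_on_inverseI)
  then show mem: "\<And>w. w \<in> D2 \<Longrightarrow> h w \<in> D2" by blast
  show fr: "\<And>w. w \<in> frontier D2 \<Longrightarrow> h w = w" and "h ` A = A" using assms by (auto simp: homeos_def)
  fix w assume w: "w \<in> D2"
  show "Re (h w) = 0 \<longleftrightarrow> Re w = 0"
  proof
    assume "Re w = 0"
    then show "Re (h w) = 0" using fr axis_in_frontier[OF w] by simp
  next
    assume 0: "Re (h w) = 0"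
    then have "h (h w) = h w" using fr axis_in_frontier mem[OF w] by blast
    then have "h w = w" using inj mem[OF w] w by (auto dest: inj_onD)
    then show "Re w = 0" using 0 by simp
  qed
qed

lemma cyl_rotate_map:
  assumes "h \<in> homeos D2 A" "x \<in> D3"
  shows "cyl (rotate_map h x) = h (cyl x)"
proof -
  have w: "cyl x \<in> D2" using assms(2) by (simp add: mem_D3)
  have "Re (h (cyl x)) \<ge> 0" using homeosD(4)[OF assms(1) w] by (simp add: D2_alt)
  moreover have "fst x = 0 \<Longrightarrow> Re (h (cyl x)) = 0" using homeosD(7)[OF assms(1) w] by simp
  ultimately show ?thesis
    by (auto simp: complex_eq_iff rotate_map_alt norm_mult norm_sgn)
qed

lemma rotate_map_in_D3: "h \<in> homeos D2 A \<Longrightarrow> x \<in> D3 \<Longrightarrow> rotate_map h x \<in> D3"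
  using cyl_rotate_map homeosD(4) by (metis mem_D3)

lemma rotate_map_inverse:
  assumes h: "h \<in> homeos D2 A" and gh: "\<And>w. w \<in> D2 \<Longrightarrow> g (h w) = w" and x: "x \<in> D3"
  shows "rotate_map g (rotate_map h x) = x"
proof -
  have w: "cyl x \<in> D2" using x by (simp add: mem_D3)
  have c: "g (cyl (rotate_map h x)) = cyl x" using cyl_rotate_map[OF h x] gh[OF w] by simp
  show ?thesis
  proof (cases "fst x = 0")
    case True
    then show ?thesis unfolding rotate_map_alt[of g] c by (cases x) simp
  next
    case False
    then have "Re (h (cyl x)) > 0"
      using homeosD(4,7)[OF h w] by (auto simp: D2_alt less_le)
    then have "sgn (fst (rotate_map h x)) = sgn (fst x)"
      by (simp add: rotate_map_alt sgn_mult sgn_of_real)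
    then show ?thesis
      unfolding rotate_map_alt[of g] c by (cases x) (simp add: sgn_mult_cmod)
  qed
qed

lemma continuous_on_rotate_family:
  assumes cont: "continuous_on (T \<times> D2) (\<lambda>(t, w). H t w)" and H: "\<And>t. t \<in> T \<Longrightarrow> H t \<in> homeos D2 A"
  shows "continuous_on (T \<times> D3) (\<lambda>z. rotate_map (H (fst z)) (snd z))"
proof -
  have c: "continuous_on (T \<times> D3) (\<lambda>z. H (fst z) (cyl (snd z)))"
  proof -
    have "continuous_on (T \<times> D3) (\<lambda>z. (\<lambda>(t, w). H t w) (fst z, cyl (snd z)))"
      by (rule continuous_on_compose2[OF cont]) (auto intro!: continuous_intros simp: mem_D3)
    then show ?thesis by simp
  qed
  have "Re (H t (cyl x)) = 0" if "t \<in> T" "x \<in> D3" "fst x = 0" for t x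
    using homeosD(7)[OF H[OF that(1)], of "cyl x"] that by (simp add: mem_D3)
  then show ?thesis
    unfolding rotate_map_alt using c
    by (intro continuous_on_Pair continuous_on_sgn_mult) (auto intro!: continuous_intros)
qed

lemma rotate_map_homeos:
  assumes h: "h \<in> homeos D2 A" and A: "A \<subseteq> D2"
  shows "rotate_map h \<in> homeos D3 (rotate_set A)"
proof -
  obtain g where g: "homeomorphism D2 D2 h g" using h by (auto simp: homeos_def)
  have gh: "g (h w) = w" "h (g w) = w" "g w \<in> D2" if "w \<in> D2" for w
    using g that unfolding homeomorphism_def by auto
  have gA: "g ` A = A"
    using homeosD(6)[OF h] gh(1) A by (metis (mono_tags, lifting) image_cong image_image image_ident subsetD)
  have gfr: "g w = w" if "w \<in> frontier D2" for w
    using homeosD(5)[OF h that] gh(1)[of w] that by (auto simp: frontier_D2)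
  have g': "g \<in> homeos D2 A"
    using homeomorphism_sym[of D2 D2 h g] g gA gfr by (auto simp: homeos_def)
  have cont: "continuous_on D3 (rotate_map k)" if "k \<in> homeos D2 A" for k
  proof -
    have "continuous_on ({0::real} \<times> D3) (\<lambda>z. rotate_map k (snd z))"
    proof (rule continuous_on_rotate_family[of "{0::real}" "\<lambda>_. k" A])
      show "continuous_on ({0::real} \<times> D2) (\<lambda>(t, w). k w)"
        unfolding case_prod_unfold
        by (rule continuous_on_compose2[OF homeosD(1)[OF that]]) (auto intro!: continuous_intros)
    qed (use that in auto)
    then have "continuous_on D3 (\<lambda>x. (\<lambda>z. rotate_map k (snd z)) (0::real, x))"
      by (rule continuous_on_compose2) (auto intro!: continuous_intros)
    then show ?thesis by simp
  qed
  have A0: "0 \<le> Re w" if "w \<in> A" for w using A that by (auto simp: D2_alt)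
  have RD: "x \<in> D3" if "x \<in> rotate_set A" for x
    using that A by (auto simp: mem_rotate_set[OF A0] mem_D3)
  have RA: "rotate_map k x \<in> rotate_set A" if "k \<in> homeos D2 A" "x \<in> rotate_set A" for k x
    using that cyl_rotate_map[OF that(1) RD[OF that(2)]] homeosD(6)[OF that(1)]
    by (auto simp: mem_rotate_set[OF A0])
  have inv: "rotate_map g (rotate_map h x) = x" "rotate_map h (rotate_map g x) = x" if "x \<in> D3" for x
    using rotate_map_inverse[OF h _ that, of g] rotate_map_inverse[OF g' _ that, of h] gh by auto
  have "homeomorphism D3 D3 (rotate_map h) (rotate_map g)"
    by (rule homeomorphismI) (use cont h g' rotate_map_in_D3 inv in auto)
  moreover have "rotate_map h x = x" if x: "x \<in> frontier D3" for x
  proof -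
    have "cyl x \<in> frontier D2" using x by (auto simp: frontier_D3 frontier_D2 mem_D3)
    then have "h (cyl x) = cyl x" using homeosD(5)[OF h] by blast
    then show ?thesis unfolding rotate_map_alt by (cases x) (simp add: sgn_mult_cmod)
  qed
  moreover have "rotate_map h ` rotate_set A = rotate_set A"
  proof (intro equalityI subsetI)
    fix x assume x: "x \<in> rotate_set A"
    then show "x \<in> rotate_map h ` rotate_set A"
      using RA[OF g' x] inv(2)[OF RD[OF x]] by (metis imageI)
  qed (use RA[OF h] in auto)
  ultimately show ?thesis unfolding homeos_def by blast
qed

lemma isotopic_rotate_map:
  assumes iso: "isotopic D2 A h k" and A: "A \<subseteq> D2"
  shows "isotopic D3 (rotate_set A) (rotate_map h) (rotate_map k)"
proof -
  obtain H where H: "continuous_on ({0..1::real} \<times> D2) H" "\<forall>x. H (0, x) = h x" "\<forall>x. H (1, x) = k x"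
      "\<forall>t\<in>{0..1}. (\<lambda>x. H (t, x)) \<in> homeos D2 A"
    using iso unfolding isotopic_def homotopic_with_def by auto
  define G where "G = (\<lambda>z. rotate_map (\<lambda>w. H (fst z, w)) (snd z))"
  have "continuous_on ({0..1} \<times> D3) G"
    unfolding G_def using H(1,4)
    by (intro continuous_on_rotate_family[where H = "\<lambda>t w. H (t, w)"]) auto
  moreover have "G \<in> {0..1} \<times> D3 \<rightarrow> D3"
    unfolding G_def using H(4) rotate_map_in_D3 by fastforce
  moreover have "(\<lambda>x. G (t, x)) \<in> homeos D3 (rotate_set A)" if "t \<in> {0..1}" for t
    unfolding G_def using rotate_map_homeos[OF _ A] H(4) that by auto
  moreover have "G (0, x) = rotate_map h x" "G (1, x) = rotate_map k x" for x
    using H(2,3) by (auto simp: G_def)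
  ultimately show ?thesis
    unfolding isotopic_def homotopic_with_def by (intro exI[of _ G]) auto
qed

text \<open>An isotopy through homeomorphisms that preserve \<open>A\<close> restricts to the complement of \<open>A\<close>, and it fixes base
  points on the boundary; so all members of a mapping class induce the same map of homotopy groups.\<close>
lemma isotopic_imp_homotopic_complement:
  assumes iso: "isotopic X A f k" and A: "A \<subseteq> X" and x: "x \<in> frontier X"
  shows "homotopic_with_canon (\<lambda>h. h x = x) (X - A) (X - A) f k"
proof -
  obtain H where H: "continuous_on ({0..1::real} \<times> X) H" "\<forall>x. H (0, x) = f x" "\<forall>x. H (1, x) = k x"
      "\<forall>t\<in>{0..1}. (\<lambda>x. H (t, x)) \<in> homeos X A"
    using iso unfolding isotopic_def homotopic_with_def by auto
  have "H (t, y) \<in> X - A" if ty: "t \<in> {0..1}" "y \<in> X - A" for t y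
  proof -
    have hom: "(\<lambda>x. H (t, x)) \<in> homeos X A" using H(4) ty by blast
    then obtain g where "homeomorphism X X (\<lambda>x. H (t, x)) g" by (auto simp: homeos_def)
    then have gH: "\<And>z. z \<in> X \<Longrightarrow> g (H (t, z)) = z" and mem: "H (t, y) \<in> X"
      using ty unfolding homeomorphism_def by auto
    have "H (t, y) \<notin> A"
    proof
      assume "H (t, y) \<in> A"
      then obtain a where a: "a \<in> A" "H (t, y) = H (t, a)" using hom by (auto simp: homeos_def)
      then have "y = a" using gH[of y] gH[of a] ty A by auto
      then show False using a ty by simp
    qed
    then show ?thesis using mem by simp
  qed
  moreover have "H (t, x) = x" if "t \<in> {0..1}" for t
    using H(4) that x by (auto simp: homeos_def)
  moreover have "continuous_on ({0..1} \<times> (X - A)) H"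
    using H(1) by (rule continuous_on_subset) auto
  ultimately show ?thesis
    unfolding homotopic_with_def using H(2,3) by (intro exI[of _ H]) auto
qed


section \<open>The complement of the two discs\<close>

text \<open>The ball minus two discs of radius \<open>r\<close> is the union of three such sets, namely for the sets \<open>J\<close> of heights
  above, between and below the discs. Any two of them meet in the shell \<open>slab r {}\<close>.\<close>
definition slab :: "real \<Rightarrow> real set \<Rightarrow> (complex \<times> real) set" where
  "slab r J = {x \<in> D3. r < cmod (fst x) \<or> snd x \<in> J}"

lemma openin_slab:
  assumes "open J" "slab r J \<subseteq> S" "S \<subseteq> D3"
  shows "openin (top_of_set S) (slab r J)"
proof -
  have "open ({x. r < cmod (fst x)} \<union> (snd -` J))"
    by (intro open_Un open_vimage_snd assms(1) open_Collect_less continuous_intros)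
  moreover have "slab r J = S \<inter> ({x. r < cmod (fst x)} \<union> (snd -` J))"
    using assms(2,3) by (auto simp: slab_def)
  ultimately show ?thesis by (auto simp: openin_open)
qed

text \<open>Moving vertically to the height \<open>c\<close> and then radially to the axis contracts the slab.\<close>
lemma simply_connected_slab:
  assumes J: "convex J" and c: "c \<in> J" "0 \<le> c" "c \<le> 1"
  shows "simply_connected (slab r J)"
proof (rule contractible_imp_simply_connected, rule contractible_two_step[where \<pi> = "\<lambda>x. (fst x, c)" and a = "(0, c)"])
  fix x assume x: "x \<in> slab r J"
  show "closed_segment x (fst x, c) \<subseteq> slab r J"
  proof
    fix z assume "z \<in> closed_segment x (fst x, c)"
    then obtain u where u: "0 \<le> u" "u \<le> 1" "z = (1 - u) *\<^sub>R x + u *\<^sub>R (fst x, c)" by (auto simp: in_segment)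
    have f: "fst z = fst x" unfolding u(3) by (simp add: algebra_simps flip: scaleR_add_left)
    have s: "snd z = (1 - u) * snd x + u * c" unfolding u(3) by simp
    have "snd z \<in> closed_segment (snd x) c"
      unfolding in_segment using u s by (intro exI[of _ u]) simp
    moreover have "closed_segment (snd x) c \<subseteq> {0..1}"
      using x c by (intro closed_segment_subset) (auto simp: slab_def mem_D3_iff)
    moreover have "closed_segment (snd x) c \<subseteq> J" if "snd x \<in> J"
      using that c J by (intro closed_segment_subset) auto
    ultimately show "z \<in> slab r J" using x f by (auto simp: slab_def mem_D3_iff)
  qed
  show "closed_segment (fst x, c) (0, c) \<subseteq> slab r J"
  proof
    fix z assume "z \<in> closed_segment (fst x, c) (0, c)"
    then obtain u where u: "0 \<le> u" "u \<le> 1" "z = (1 - u) *\<^sub>R (fst x, c) + u *\<^sub>R (0, c)" by (auto simp: in_segment)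
    have "cmod (fst z) = (1 - u) * cmod (fst x)"
      unfolding u(3) using u(1,2) by simp
    moreover have "snd z = c"
      unfolding u(3) by (simp add: algebra_simps)
    moreover have "(1 - u) * cmod (fst x) \<le> 1 * 1"
      using u x by (intro mult_mono) (auto simp: slab_def mem_D3_iff)
    ultimately show "z \<in> slab r J" using c by (auto simp: slab_def mem_D3_iff)
  qed
qed (intro continuous_intros)

lemma path_connected_slab_empty:
  assumes "r < 1"
  shows "path_connected (slab r {})" "slab r {} \<noteq> {}"
proof -
  have "slab r {} = {z. r < cmod z \<and> cmod z \<le> 1} \<times> {0..1}"
    by (auto simp: slab_def mem_D3_iff)
  moreover have "path_connected {z::complex. r < cmod z \<and> cmod z \<le> 1}"
    using path_connected_annulus(2)[of r "0::complex" 1] by simp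
  ultimately show "path_connected (slab r {})"
    by (simp add: path_connected_Times)
  have "(1, 0) \<in> slab r {}" using assms by (auto simp: slab_def mem_D3_iff)
  then show "slab r {} \<noteq> {}" by blast
qed

lemma slab_Int: "slab r I \<inter> slab r J = slab r (I \<inter> J)" and slab_Un: "slab r I \<union> slab r J = slab r (I \<union> J)"
  by (auto simp: slab_def)

lemma simply_connected_disc_complement:
  assumes p: "p \<in> interior D2" and q: "q \<in> interior D2" and re: "Re p = Re q" and im: "Im q < Im p"
  shows "simply_connected (D3 - (rotate_set (seg p) \<union> rotate_set (seg q)))"
proof -
  have bp: "0 < Re p" "Re p < 1" "Im p < 1" and bq: "0 < Re q" "0 < Im q" using p q by (auto simp: interior_D2)
  have seg: "x \<in> rotate_set (seg z) \<longleftrightarrow> cmod (fst x) \<le> Re z \<and> snd x = Im z" if "0 < Re z" for x z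
    using that mem_rotate_set[of "seg z" x] seg_alt[of z] by auto
  define m where "m = (Im p + Im q) / 2"
  let ?A = "slab (Re p) {Im p<..}" and ?C = "slab (Re p) {Im q<..<Im p}" and ?B = "slab (Re p) {..<Im q}"
  have eq: "D3 - (rotate_set (seg p) \<union> rotate_set (seg q)) = (?A \<union> ?C) \<union> ?B"
    using bp bq re im by (auto simp: seg slab_def)
  have sA: "simply_connected ?A" using bp im bq by (intro simply_connected_slab[where c = 1]) auto
  have sC: "simply_connected ?C"
    using bp im bq by (intro simply_connected_slab[where c = m]) (auto simp: m_def convex_real_interval)
  have sB: "simply_connected ?B" using bp im bq by (intro simply_connected_slab[where c = 0]) auto
  have sub: "slab r J \<subseteq> D3" for r J by (auto simp: slab_def)
  have pc: "path_connected (slab (Re p) {})" "slab (Re p) {} \<noteq> {}"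
    using path_connected_slab_empty[OF bp(2)] by auto
  have sAC: "simply_connected (?A \<union> ?C)"
  proof (rule simply_connected_Un_open[OF _ _ sA sC])
    have "?A \<inter> ?C = slab (Re p) {}" unfolding slab_Int by (rule arg_cong[where f = "slab (Re p)"]) auto
    then show "path_connected (?A \<inter> ?C)" "?A \<inter> ?C \<noteq> {}" using pc by auto
  qed (use sub in \<open>auto intro!: openin_slab\<close>)
  show ?thesis unfolding eq
  proof (rule simply_connected_Un_open[OF _ _ sAC sB])
    have "(?A \<union> ?C) \<inter> ?B = slab (Re p) {}"
      unfolding slab_Int slab_Un using im by (intro arg_cong[where f = "slab (Re p)"]) auto
    then show "path_connected ((?A \<union> ?C) \<inter> ?B)" "(?A \<union> ?C) \<inter> ?B \<noteq> {}" using pc by auto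
    show "openin (top_of_set (?A \<union> ?C \<union> ?B)) (?A \<union> ?C)"
      unfolding slab_Un using sub by (intro openin_slab) (auto simp: slab_def)
    show "openin (top_of_set (?A \<union> ?C \<union> ?B)) ?B"
      using sub by (intro openin_slab) auto
  qed
qed

section \<open>Spheres swept out by arcs\<close>

lemma sqnorm_bounds: "sqnorm w \<le> 1 \<Longrightarrow> 1 - sqnorm w \<in> {0..1}"
  by simp

lemma cyl_rotated: "cmod u = 1 \<or> Re z = 0 \<Longrightarrow> 0 \<le> Re z \<Longrightarrow> cyl (u * of_real (Re z), Im z) = z"
  by (auto simp: cyl_def complex_eq_iff norm_mult)

text \<open>The start of the path is the base point of the sphere and stays fixed; its end, the image of the centre of
  the square, may move along the axis.\<close>
lemma homotopic_rotate_arc: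
  assumes cont: "continuous_on ({0..1} \<times> {0..1}) h"
    and Y: "\<And>z. z \<in> {0..1} \<times> {0..1} \<Longrightarrow> h z \<in> Y" "\<And>w. w \<in> Y \<Longrightarrow> 0 \<le> Re w"
    and start: "\<And>t. t \<in> {0..1} \<Longrightarrow> h (t, 0) = c" "Re c = 0"
    and finish: "\<And>t. t \<in> {0..1} \<Longrightarrow> Re (h (t, 1)) = 0"
  shows "homotopic_spheroids (rotate_set Y) (emb c) (rotate_arc (\<lambda>s. h (0, s))) (rotate_arc (\<lambda>s. h (1::real, s)))"
proof (rule homotopic_spheroidsI)
  let ?k = "\<lambda>z. h (fst z, 1 - sqnorm (snd z))"
  let ?h = "\<lambda>z. (sgn (snd z) * of_real (Re (?k z)), Im (?k z))"
  have k: "continuous_on ({0..1} \<times> square) ?k"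
    by (rule continuous_on_compose2[OF cont]) (auto intro!: continuous_intros simp: mem_square)
  show "continuous_on ({0..1} \<times> square) ?h"
    using k finish by (intro continuous_on_Pair continuous_on_sgn_mult) (auto intro!: continuous_intros)
  show "?h (t, w) \<in> rotate_set Y" if "t \<in> {0..1}" "sqnorm w \<le> 1" for t w
  proof -
    have in_Y: "?k (t, w) \<in> Y" using Y(1)[of "(t, 1 - sqnorm w)"] that by simp
    have "cmod (sgn w) = 1 \<or> Re (?k (t, w)) = 0"
      using finish[OF that(1)] by (cases "w = 0") (auto simp: norm_sgn)
    then have "cyl (?h (t, w)) = ?k (t, w)"
      using cyl_rotated[of "sgn w" "?k (t, w)"] Y(2)[OF in_Y] by simp
    then show ?thesis using mem_rotate_set[of Y "?h (t, w)"] Y(2) in_Y by auto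
  qed
  show "?h (t, w) = emb c" if "t \<in> {0..1}" "sqnorm w = 1" for t w
    using start that by (simp add: emb_def)
qed (simp_all add: rotate_arc_def)

lemma homotopic_rotate_arc_paths:
  assumes hom: "homotopic_paths Y a a'" and Y: "\<And>w. w \<in> Y \<Longrightarrow> 0 \<le> Re w"
    and axis: "Re (pathstart a) = 0" "Re (pathfinish a) = 0"
  shows "homotopic_spheroids (rotate_set Y) (emb (pathstart a)) (rotate_arc a) (rotate_arc a')"
proof -
  obtain h where h: "continuous_on ({0..1::real} \<times> {0..1::real}) h" "h \<in> {0..1} \<times> {0..1} \<rightarrow> Y"
     "\<forall>s\<in>{0..1}. h (0, s) = a s" "\<forall>s\<in>{0..1}. h (1, s) = a' s"
     "\<forall>t\<in>{0..1}. pathstart (h \<circ> Pair t) = pathstart a \<and> pathfinish (h \<circ> Pair t) = pathfinish a"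
    using hom unfolding homotopic_paths by (elim exE conjE) (rule that)
  have ends: "h (t, 0) = pathstart a" "h (t, 1) = pathfinish a" if "t \<in> {0..1}" for t
    using h(5) that by (auto simp: pathstart_def pathfinish_def)
  have *: "homotopic_spheroids (rotate_set Y) (emb (pathstart a)) (rotate_arc (\<lambda>s. h (0, s))) (rotate_arc (\<lambda>s. h (1, s)))"
    by (rule homotopic_rotate_arc[OF h(1)]) (use h(2) Y ends axis in auto)
  have eq: "rotate_arc (\<lambda>s. h (0, s)) w = rotate_arc a w" "rotate_arc (\<lambda>s. h (1, s)) w = rotate_arc a' w"
    if "sqnorm w \<le> 1" for w
    using h(3,4) sqnorm_bounds[OF that] by (simp_all add: rotate_arc_def del: atLeastAtMost_iff)
  show ?thesis
    using homotopic_spheroids_trans[OF homotopic_spheroids_sym[OF homotopic_spheroids_eq[OF homotopic_spheroids_imp_spheroid(1)[OF *] eq(1)]]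
       homotopic_spheroids_trans[OF * homotopic_spheroids_eq[OF homotopic_spheroids_imp_spheroid(2)[OF *] eq(2)]]] .
qed

lemma spheroid_rotate_arc:
  assumes "path a" "path_image a \<subseteq> Y" "\<And>w. w \<in> Y \<Longrightarrow> 0 \<le> Re w" "Re (pathstart a) = 0" "Re (pathfinish a) = 0"
  shows "spheroid (rotate_set Y) (emb (pathstart a)) (rotate_arc a)"
  using homotopic_rotate_arc_paths[of Y a a] assms by (simp add: homotopic_spheroids_refl)

text \<open>Shorten the piece \<open>e\<close> of the axis to its starting point.\<close>
lemma rotate_arc_tail:
  assumes a: "path a" "path_image a \<subseteq> Y" and e: "path e" "path_image e \<subseteq> Y" and ae: "pathfinish a = pathstart e"
    and Y: "\<And>w. w \<in> Y \<Longrightarrow> 0 \<le> Re w" and axis: "Re (pathstart a) = 0" "\<And>w. w \<in> path_image e \<Longrightarrow> Re w = 0"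
  shows "homotopic_spheroids (rotate_set Y) (emb (pathstart a)) (rotate_arc (a +++ e)) (rotate_arc a)"
proof -
  define h where "h = (\<lambda>z. (a +++ (\<lambda>s. e (fst z * s))) (snd z))"
  have ez: "e 0 = a 1" using ae by (simp add: pathstart_def pathfinish_def)
  have eY: "e t \<in> Y \<and> Re (e t) = 0" if "t \<in> {0..1}" for t
    using e(2) axis(2) that by (auto simp: path_image_def)
  have aY: "a t \<in> Y" if "t \<in> {0..1}" for t
    using a(2) that by (auto simp: path_image_def)
  have prod: "t * s \<in> {0..1}" if "t \<in> {0..1}" "s \<in> {0..1}" for t s :: real
    using that mult_mono[of t 1 s 1] by auto
  have cont: "continuous_on ({0..1} \<times> {0..1}) h"
    unfolding h_def
  proof (rule continuous_on_homotopic_join_lemma[where p = "\<lambda>_. a" and q = "\<lambda>t s. e (t * s)"])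
    show "continuous_on ({0..1} \<times> {0..1}) (\<lambda>y. a (snd y))"
      by (rule continuous_on_path_compose[OF a(1)]) (auto intro!: continuous_intros)
    show "continuous_on ({0..1} \<times> {0..1}) (\<lambda>y. e (fst y * snd y))"
      by (rule continuous_on_path_compose[OF e(1)]) (use prod in \<open>auto intro!: continuous_intros\<close>)
  qed (use ez in \<open>simp add: pathstart_def pathfinish_def\<close>)
  have hom: "homotopic_spheroids (rotate_set Y) (emb (pathstart a)) (rotate_arc (\<lambda>s. h (0, s))) (rotate_arc (\<lambda>s. h (1, s)))"
  proof (rule homotopic_rotate_arc[OF cont])
    show "h z \<in> Y" if z: "z \<in> {0..1} \<times> {0..1}" for z
    proof (cases "snd z \<le> 1/2")
      case True
      then show ?thesis using z aY[of "2 * snd z"] by (auto simp: h_def joinpaths_def)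
    next
      case False
      then show ?thesis using z eY[of "fst z * (2 * snd z - 1)"] prod[of "fst z" "2 * snd z - 1"]
        by (auto simp: h_def joinpaths_def)
    qed
  qed (use Y axis eY in \<open>auto simp: h_def joinpaths_def pathstart_def\<close>)
  have h1: "(\<lambda>s. h (1, s)) = a +++ e" by (simp add: h_def)
  have h0: "(\<lambda>s. h (0, s)) = a +++ linepath (pathfinish a) (pathfinish a)"
    using ez by (auto simp: h_def linepath_refl pathfinish_def)
  have "homotopic_paths Y (a +++ linepath (pathfinish a) (pathfinish a)) a"
    by (rule homotopic_paths_rid[OF a])
  from homotopic_rotate_arc_paths[OF this Y] have
    "homotopic_spheroids (rotate_set Y) (emb (pathstart a)) (rotate_arc (\<lambda>s. h (0, s))) (rotate_arc a)"
    unfolding h0 using axis eY[of 0] ez by (simp add: pathfinish_def pathstart_def joinpaths_def)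
  then show ?thesis
    using hom unfolding h1 by (meson homotopic_spheroids_sym homotopic_spheroids_trans)
qed

lemma sgn_pos_scale: "0 < c \<Longrightarrow> sgn (c *\<^sub>R w) = sgn (w::complex)"
  by (simp add: sgn_scaleR)

lemma sgn_numeral_mult [simp]: "sgn (numeral k * w) = sgn (w::complex)"
  using sgn_pos_scale[of "numeral k" w] by (simp add: scaleR_conv_of_real)

text \<open>The rotation does not move points of the axis, so the collar that \<open>e\<close> sweeps out is the one in the
  definition of \<open>transport\<close>.\<close>
lemma rotate_arc_whisker:
  assumes axis: "\<And>w. w \<in> path_image e \<Longrightarrow> Re w = 0" and ea: "pathfinish e = pathstart a"
    and w: "sqnorm w \<le> 1"
  shows "transport (emb \<circ> e) (rotate_arc a) w = rotate_arc (e +++ a) w"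
proof -
  consider "sqnorm w < 1/2" | "sqnorm w = 1/2" | "1/2 < sqnorm w" by linarith
  then show ?thesis
  proof cases
    case 1
    then show ?thesis by (simp add: transport_def rotate_arc_def joinpaths_def right_diff_distrib)
  next
    case 2
    have e1: "e 1 = a 0" using ea by (simp add: pathstart_def pathfinish_def)
    then show ?thesis
      unfolding transport_def rotate_arc_def joinpaths_def sqnorm_numeral_mult 2 by simp
  next
    case 3
    have "e (2 - 2 * sqnorm w) \<in> path_image e" using 3 w by (auto simp: path_image_def)
    then have "Re (e (2 - 2 * sqnorm w)) = 0" by (rule axis)
    then show ?thesis using 3 by (simp add: transport_def rotate_arc_def joinpaths_def emb_def right_diff_distrib)
  qed
qed

text \<open>Turn the half-plane by \<open>\<pi>\<close>; the ends of the path lie on the axis and stay fixed.\<close>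
lemma homotopic_rotated_path:
  assumes a: "path a" "path_image a \<subseteq> Y" and Y: "\<And>w. w \<in> Y \<Longrightarrow> 0 \<le> Re w"
    and axis: "Re (pathstart a) = 0" "Re (pathfinish a) = 0"
  shows "homotopic_paths (rotate_set Y) (\<lambda>t. (- of_real (Re (a t)), Im (a t))) (emb \<circ> a)"
proof -
  let ?h = "\<lambda>z. (exp (\<i> * of_real (pi * (1 - fst z))) * of_real (Re (a (snd z))), Im (a (snd z)))"
  have "continuous_on ({0..1} \<times> {0..1}) (\<lambda>z. a (snd z))"
    by (rule continuous_on_path_compose[OF a(1)]) (auto intro!: continuous_intros)
  then have "continuous_on ({0..1} \<times> {0..1}) ?h"
    by (intro continuous_intros)
  moreover have "?h z \<in> rotate_set Y" if "z \<in> {0..1::real} \<times> {0..1}" for z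
  proof -
    have "a (snd z) \<in> Y" using a(2) that by (auto simp: path_image_def)
    moreover have "cmod (exp (\<i> * of_real (pi * (1 - fst z)))) = 1" by (rule norm_exp_i_times)
    ultimately show ?thesis unfolding rotate_set_def by blast
  qed
  ultimately show ?thesis
    unfolding homotopic_paths using axis
    by (intro exI[of _ ?h]) (auto simp: emb_def pathstart_def pathfinish_def)
qed

text \<open>The path \<open>a +++ c\<close> sweeps out the sphere of \<open>a\<close> with the sphere of \<open>c\<close> attached at the centre of the square, so
  \<open>homotopic_spheroids_insert\<close> applies. The ray in that lemma runs to the left edge, where \<open>rotate_arc\<close> turns
  the half-plane by \<open>\<pi>\<close>; \<open>homotopic_rotated_path\<close> turns it back.\<close>
lemma rotate_arc_join:
  assumes \<beta>: "path \<beta>" "path_image \<beta> \<subseteq> rotate_set Y" "pathfinish \<beta> = emb (pathstart a)"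
    and a: "path a" "path_image a \<subseteq> Y" and c: "path c" "path_image c \<subseteq> Y" and ac: "pathfinish a = pathstart c"
    and Y: "\<And>w. w \<in> Y \<Longrightarrow> 0 \<le> Re w"
    and axis: "Re (pathstart a) = 0" "Re (pathfinish a) = 0" "Re (pathfinish c) = 0"
  shows "homotopic_spheroids (rotate_set Y) (pathstart \<beta>) (transport \<beta> (rotate_arc (a +++ c)))
           (spheroid_join (transport (\<beta> +++ (emb \<circ> a)) (rotate_arc c)) (transport \<beta> (rotate_arc a)))"
proof -
  let ?X = "rotate_set Y"
  have ac0: "a 1 = c 0" using ac by (simp add: pathstart_def pathfinish_def)
  have ra: "spheroid ?X (emb (pathstart a)) (rotate_arc a)"
    by (rule spheroid_rotate_arc[OF a Y axis(1,2)])
  have rc: "spheroid ?X (emb (pathfinish a)) (rotate_arc c)"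
    unfolding ac by (rule spheroid_rotate_arc[OF c Y]) (use axis ac in auto)
  define f where "f = transport \<beta> (rotate_arc a)"
  have f: "spheroid ?X (pathstart \<beta>) f"
    unfolding f_def by (rule spheroid_transport) (use \<beta> ra in auto)
  have f0: "f 0 = emb (pathfinish a)"
    using axis by (simp add: f_def transport_def rotate_arc_def emb_def pathfinish_def)
  define ray where "ray = (\<lambda>t. f (of_real (t - 1)))"
  have ins: "homotopic_spheroids ?X (pathstart \<beta>)
      (\<lambda>w. if sqnorm w \<le> 1/4 then rotate_arc c (4 * w) else f (min 1 (2 - 1 / (2 * sqnorm w)) *\<^sub>R w))
      (spheroid_join (transport ray (rotate_arc c)) f)"
    unfolding ray_def by (rule homotopic_spheroids_insert[OF f]) (use rc f0 in simp)
  have eq: "transport \<beta> (rotate_arc (a +++ c)) w =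
      (if sqnorm w \<le> 1/4 then rotate_arc c (4 * w) else f (min 1 (2 - 1 / (2 * sqnorm w)) *\<^sub>R w))" for w
  proof -
    consider "sqnorm w < 1/4" | "sqnorm w = 1/4" | "1/4 < sqnorm w" "sqnorm w \<le> 1/2" | "1/2 < sqnorm w" by linarith
    then show ?thesis
    proof cases
      case 1
      then show ?thesis by (simp add: transport_def rotate_arc_def joinpaths_def right_diff_distrib)
    next
      case 2
      then show ?thesis
        unfolding transport_def rotate_arc_def joinpaths_def sqnorm_numeral_mult 2 by (simp add: ac0)
    next
      case 3
      let ?k = "2 - 1 / (2 * sqnorm w)"
      have pos: "0 < ?k" and le: "?k \<le> 1" using 3 by (auto simp: field_simps)
      then have min: "min 1 ?k = ?k" by simp
      have sq: "sqnorm (?k *\<^sub>R w) = 2 * sqnorm w - 1/2"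
      proof -
        have "sqnorm (?k *\<^sub>R w) = ?k * sqnorm w"
          using pos by (simp only: sqnorm_scaleR abs_of_pos)
        moreover have "(2 - 1 / (2 * x)) * x = 2 * x - 1/2" if "0 < x" for x :: real
          using that by (simp add: field_simps)
        ultimately show ?thesis using 3 by simp
      qed
      have "2 * (?k *\<^sub>R w) = (2 * ?k) *\<^sub>R w" by (simp add: scaleR_conv_of_real)
      then have sgn: "sgn (2 * (?k *\<^sub>R w)) = sgn w" using pos sgn_pos_scale[of "2 * ?k" w] by simp
      have rhs: "f (?k *\<^sub>R w) = rotate_arc a (2 * (?k *\<^sub>R w))"
        using 3 sq by (simp add: f_def transport_def)
      have one: "1 - sqnorm (2 * (?k *\<^sub>R w)) = 2 - 4 * sqnorm w"
        unfolding sqnorm_numeral_mult sq by simp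
      have rhs': "f (?k *\<^sub>R w) = (sgn w * of_real (Re (a (2 - 4 * sqnorm w))), Im (a (2 - 4 * sqnorm w)))"
        unfolding rhs rotate_arc_def sgn one ..
      show ?thesis
        using 3 unfolding min rhs' by (simp add: transport_def rotate_arc_def joinpaths_def right_diff_distrib)
    next
      case 4
      then have "2 - 1 / (2 * sqnorm w) \<ge> 1" by (simp add: field_simps)
      then show ?thesis using 4 by (simp add: f_def transport_def)
    qed
  qed
  define n where "n = (\<lambda>t. (- of_real (Re (a t)) :: complex, Im (a t)))"
  have n: "homotopic_paths ?X n (emb \<circ> a)"
    unfolding n_def by (rule homotopic_rotated_path[OF a Y axis(1,2)])
  have nstart: "pathstart n = pathfinish \<beta>"
    using axis \<beta>(3) by (simp add: n_def pathstart_def emb_def)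
  have hom1: "homotopic_paths ?X (\<beta> +++ n) (\<beta> +++ (emb \<circ> a))"
    using \<beta> n nstart by (intro homotopic_paths_join) auto
  have ray_eq: "ray t = (\<beta> +++ n) t" if t: "t \<in> {0..1}" for t
  proof -
    have sq: "sqnorm (of_real (t - 1)) = 1 - t" using t by (simp add: sqnorm_def)
    consider "t < 1/2" | "t = 1/2" | "1/2 < t" "t < 1" | "t = 1" using t by fastforce
    then show ?thesis
    proof cases
      case 1
      then show ?thesis using sq by (simp add: ray_def f_def transport_def joinpaths_def)
    next
      case 2
      have half: "sqnorm (of_real (t - 1)) = 1/2" unfolding sq using 2 by simp
      have "ray t = rotate_arc a (2 * of_real (t - 1))"
        unfolding ray_def f_def transport_def half by simp
      also have "\<dots> = (0, Im (a 0))"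
        unfolding rotate_arc_def sqnorm_numeral_mult half using axis(1) by (simp add: pathstart_def)
      also have "\<dots> = \<beta> 1" using \<beta>(3) axis(1) by (simp add: emb_def pathstart_def pathfinish_def)
      also have "\<dots> = (\<beta> +++ n) t" unfolding 2 by (simp add: joinpaths_def)
      finally show ?thesis .
    next
      case 3
      have "2 * complex_of_real (t - 1) = of_real (2 * (t - 1))" by simp
      then have "sgn (2 * complex_of_real (t - 1)) = -1" using 3 by (simp only: sgn_of_real) (simp add: sgn_real_def)
      moreover have "1 - sqnorm (2 * complex_of_real (t - 1)) = 2 * t - 1"
        unfolding sqnorm_numeral_mult sq by simp
      ultimately show ?thesis using sq 3 by (simp add: ray_def f_def transport_def joinpaths_def rotate_arc_def n_def del: of_real_diff)
    next
      case 4
      then show ?thesis using f0 axis by (simp add: ray_def joinpaths_def n_def emb_def pathfinish_def)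
    qed
  qed
  have "homotopic_paths ?X (\<beta> +++ n) ray"
    using homotopic_paths_imp_path[OF hom1] homotopic_paths_imp_subset[OF hom1] ray_eq
    by (intro homotopic_paths_eq) auto
  then have ray_hom: "homotopic_paths ?X ray (\<beta> +++ (emb \<circ> a))"
    using hom1 by (meson homotopic_paths_sym homotopic_paths_trans)
  have "homotopic_spheroids ?X (pathstart \<beta>) (transport ray (rotate_arc c)) (transport (\<beta> +++ (emb \<circ> a)) (rotate_arc c))"
  proof (rule homotopic_spheroids_transport[OF ray_hom])
    show "homotopic_spheroids ?X (emb (pathfinish a)) (rotate_arc c) (rotate_arc c)"
      using rc by (simp add: homotopic_spheroids_refl)
    show "pathstart ray = pathstart \<beta>" "pathfinish ray = emb (pathfinish a)"
      using homotopic_paths_imp_pathstart[OF ray_hom] homotopic_paths_imp_pathfinish[OF ray_hom]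
      by (auto simp: pathfinish_compose)
  qed
  then have "homotopic_spheroids ?X (pathstart \<beta>) (spheroid_join (transport ray (rotate_arc c)) f)
      (spheroid_join (transport (\<beta> +++ (emb \<circ> a)) (rotate_arc c)) f)"
    using f by (intro homotopic_spheroids_join) (auto simp: homotopic_spheroids_refl)
  then show ?thesis
    using ins unfolding eq[symmetric] f_def[symmetric] by (meson homotopic_spheroids_trans)
qed

lemma rotate_map_rotate_arc:
  assumes h: "h \<in> homeos D2 A" and a: "path_image a \<subseteq> D2" "Re (pathfinish a) = 0" and w: "sqnorm w \<le> 1"
  shows "rotate_map h (rotate_arc a w) = rotate_arc (h \<circ> a) w"
proof -
  let ?z = "a (1 - sqnorm w)"
  have z: "?z \<in> D2" using a(1) sqnorm_bounds[OF w] by (auto simp: path_image_def)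
  have c: "cmod (sgn w) = 1 \<or> Re ?z = 0"
    using a(2) by (cases "w = 0") (auto simp: norm_sgn pathfinish_def)
  have cyl: "cyl (rotate_arc a w) = ?z"
    unfolding rotate_arc_def using c z by (intro cyl_rotated) (auto simp: D2_alt)
  show ?thesis
  proof (cases "Re ?z = 0")
    case True
    then have "Re (h ?z) = 0" using homeosD(7)[OF h z] by simp
    then show ?thesis unfolding rotate_map_alt cyl by (simp add: rotate_arc_def)
  next
    case False
    then have "Re ?z > 0" using z by (simp add: D2_alt)
    then have "sgn (fst (rotate_arc a w)) = sgn w"
      by (simp add: rotate_arc_def sgn_mult sgn_of_real)
    then show ?thesis unfolding rotate_map_alt cyl by (simp add: rotate_arc_def)
  qed
qed

lemma rotate_map_emb:
  assumes h: "h \<in> homeos D2 A" and w: "w \<in> D2"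
  shows "rotate_map h (emb w) = emb (h w)"
proof -
  have cyl: "cyl (emb w) = w" using w by (intro cyl_emb) (simp add: D2_alt)
  show ?thesis
  proof (cases "Re w = 0")
    case True
    then have "Re (h w) = 0" using homeosD(7)[OF h w] by simp
    then show ?thesis unfolding rotate_map_alt cyl using True by (simp add: emb_def)
  next
    case False
    then have "Re w > 0" using w by (simp add: D2_alt)
    then show ?thesis unfolding rotate_map_alt cyl by (simp add: emb_def sgn_of_real)
  qed
qed


section \<open>The coaxial configuration\<close>

text \<open>Solving \<open>u k\<inverse> = v\<close> for \<open>k\<close> in the fundamental groupoid.\<close>
lemma homotopic_paths_solve_right:
  fixes X :: "'a::real_normed_vector set"
  assumes hom: "homotopic_paths X (u +++ reversepath k) v"
    and u: "path u" "path_image u \<subseteq> X" and k: "path k" "path_image k \<subseteq> X"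
    and ends: "pathstart u = pathstart k" "pathfinish u = pathfinish k"
  shows "homotopic_paths X k (reversepath v +++ u)"
proof -
  have v: "pathfinish v = pathstart k" "pathstart v = pathstart u"
    using homotopic_paths_imp_pathstart[OF hom] homotopic_paths_imp_pathfinish[OF hom] by auto
  have "homotopic_paths X (reversepath v +++ u) (reversepath (u +++ reversepath k) +++ u)"
    using homotopic_paths_reversepath_D[OF homotopic_paths_sym[OF hom]] u v
    by (intro homotopic_paths_join) auto
  also have "reversepath (u +++ reversepath k) = k +++ reversepath u"
    using ends by (simp add: reversepath_joinpaths)
  also have "homotopic_paths X ((k +++ reversepath u) +++ u) (k +++ (reversepath u +++ u))"
    using u k ends by (intro homotopic_paths_sym[OF homotopic_paths_assoc]) auto
  also have "homotopic_paths X (k +++ (reversepath u +++ u)) (k +++ linepath (pathfinish u) (pathfinish u))"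
    using u k ends by (intro homotopic_paths_join homotopic_paths_linv) auto
  also have "homotopic_paths X (k +++ linepath (pathfinish u) (pathfinish u)) k"
    using k ends by (intro homotopic_paths_rid') auto
  finally show ?thesis by (rule homotopic_paths_sym)
qed

lemma winding_number_linepath_convex:
  assumes "convex S" "a \<in> S" "b \<in> S" "c \<in> S" "z \<notin> S"
  shows "winding_number (linepath a b) z + winding_number (linepath b c) z = winding_number (linepath a c) z"
proof -
  have sub: "closed_segment x y \<subseteq> S" if "x \<in> S" "y \<in> S" for x y
    using assms(1) that by (simp add: closed_segment_subset)
  have z: "z \<notin> closed_segment a b" "z \<notin> closed_segment b c" "z \<notin> closed_segment a c"
    using sub assms by blast+
  have im: "path_image (linepath a b +++ linepath b c) \<subseteq> S" "path_image (linepath a c) \<subseteq> S"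
    using assms sub by (simp_all add: path_image_join)
  have "homotopic_paths (- {z}) (linepath a b +++ linepath b c) (linepath a c)"
    by (rule simply_connected_homotopic[OF convex_imp_simply_connected[OF assms(1)]])
       (use assms(5) im in auto)
  then have "winding_number (linepath a b +++ linepath b c) z = winding_number (linepath a c) z"
    by (rule winding_number_homotopic_paths)
  then show ?thesis using z by (simp add: winding_number_join)
qed

lemma closed_segment_in_vertical_line:
  "Re a = k \<Longrightarrow> Re b = k \<Longrightarrow> z \<in> closed_segment a b \<Longrightarrow> Re z = k"
  by (auto simp: closed_segment_same_Re)

lemma closed_segment_in_horizontal_line:
  "Im a = k \<Longrightarrow> Im b = k \<Longrightarrow> z \<in> closed_segment a b \<Longrightarrow> Im z = k"
  by (auto simp: closed_segment_same_Im)

lemma closed_segment_in_D2: "a \<in> D2 \<Longrightarrow> b \<in> D2 \<Longrightarrow> closed_segment a b \<subseteq> D2"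
  using convex_D2 by (rule closed_segment_subset[rotated 2])

text \<open>The subsets \<open>Y\<close> and \<open>T\<close> of the square are the punctured and the slit square, and \<open>X\<close> is the complement of the
  circles. The paths \<open>low\<close>, \<open>mid\<close> and \<open>up\<close> run along the right edge to the bottom edge, to half height between the
  points, and to the top edge, and then horizontally to the axis. The names \<open>m\<close>, \<open>c\<close>, \<open>d\<close> are those of their
  corners and ends: \<open>m\<close> is the end of \<open>mid\<close>, \<open>c\<close> its corner, and \<open>d\<close> the corner of \<open>up\<close>.\<close>
locale coaxial_pair =
  fixes p1 p2 b :: complex
  assumes p1: "p1 \<in> interior D2" and p2: "p2 \<in> interior D2"
    and Re_eq: "Re p1 = Re p2" and Im_less: "Im p2 < Im p1"
    and b: "b \<in> D2" "Re b = 1"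
begin

abbreviation Y where "Y \<equiv> D2 - {p1, p2}"
abbreviation T where "T \<equiv> D2 - (seg p1 \<union> seg p2)"
abbreviation X where "X \<equiv> D3 - rotate_set {p1, p2}"

definition m :: complex where "m = Complex 0 ((Im p1 + Im p2) / 2)"
definition c :: complex where "c = Complex 1 ((Im p1 + Im p2) / 2)"
definition d :: complex where "d = Complex 1 1"
definition low :: "real \<Rightarrow> complex" where "low = linepath b 1 +++ linepath 1 0"
definition mid :: "real \<Rightarrow> complex" where "mid = linepath b c +++ linepath c m"
definition up :: "real \<Rightarrow> complex" where "up = linepath b d +++ linepath d \<i>"

lemma bounds: "0 < Re p1" "Re p1 < 1" "0 < Re p2" "Re p2 < 1" "0 < Im p2" "Im p1 < 1"
  using p1 p2 by (auto simp: interior_D2)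

lemma mem_T: "w \<in> T \<longleftrightarrow> w \<in> D2 \<and> (Im w = Im p1 \<or> Im w = Im p2 \<longrightarrow> Re p1 < Re w)"
  using bounds Re_eq by (auto simp: seg_alt D2_alt)

lemma T_Y: "T \<subseteq> Y"
proof -
  have "p1 \<in> seg p1" "p2 \<in> seg p2" by (auto simp: seg_def)
  then show ?thesis by auto
qed

lemma Y_nonneg: "w \<in> Y \<Longrightarrow> 0 \<le> Re w"
  by (simp add: D2_alt)

lemma X_eq: "X = rotate_set Y"
  unfolding D3_def
proof (rule rotate_set_Diff[symmetric])
  show "{p1, p2} \<subseteq> D2" using p1 p2 interior_subset by blast
qed (simp add: D2_alt)

lemma simply_connected_T: "simply_connected T"
  by (rule simply_connected_slit_square[OF p1 p2])

lemma corner_D2: "b \<in> D2" "1 \<in> D2" "0 \<in> D2" "c \<in> D2" "d \<in> D2" "m \<in> D2" "\<i> \<in> D2"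
  using b bounds Im_less by (auto simp: D2_alt c_def d_def m_def)

lemma on_right_edge: "w \<in> D2 \<Longrightarrow> Re w = 1 \<Longrightarrow> w \<in> T"
  unfolding mem_T using bounds by simp

lemma off_heights: "w \<in> D2 \<Longrightarrow> Im w \<noteq> Im p1 \<Longrightarrow> Im w \<noteq> Im p2 \<Longrightarrow> w \<in> T"
  unfolding mem_T by simp

lemma right_edge_segment:
  assumes "x \<in> D2" "y \<in> D2" "Re x = 1" "Re y = 1"
  shows "closed_segment x y \<subseteq> T"
proof
  fix z assume z: "z \<in> closed_segment x y"
  show "z \<in> T"
    by (rule on_right_edge[OF subsetD[OF closed_segment_in_D2[OF assms(1,2)] z]
          closed_segment_in_vertical_line[OF assms(3,4) z]])
qed

lemma horizontal_segment:
  assumes "x \<in> D2" "y \<in> D2" "Im x = k" "Im y = k" "k \<noteq> Im p1" "k \<noteq> Im p2"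
  shows "closed_segment x y \<subseteq> T"
proof
  fix z assume z: "z \<in> closed_segment x y"
  show "z \<in> T"
    using off_heights[OF subsetD[OF closed_segment_in_D2[OF assms(1,2)] z]]
      closed_segment_in_horizontal_line[OF assms(3,4) z] assms(5,6) by simp
qed

lemma m_heights: "Im p2 < Im m" "Im m < Im p1" "Re m = 0"
  using Im_less by (auto simp: m_def)

lemma low: "path low" "path_image low \<subseteq> T" "pathstart low = b" "pathfinish low = 0"
  and mid: "path mid" "path_image mid \<subseteq> T" "pathstart mid = b" "pathfinish mid = m"
  and up: "path up" "path_image up \<subseteq> T" "pathstart up = b" "pathfinish up = \<i>"
proof -
  show "path_image low \<subseteq> T"
    unfolding low_def
    by (intro subset_path_image_join; unfold path_image_linepath)
       (rule right_edge_segment horizontal_segment[where k = 0]; use corner_D2 b bounds Im_less in simp)+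
  show "path_image mid \<subseteq> T"
    unfolding mid_def
    by (intro subset_path_image_join; unfold path_image_linepath)
       (rule right_edge_segment horizontal_segment[where k = "Im m"]; use corner_D2 b bounds Im_less in \<open>simp add: c_def m_def\<close>)+
  show "path_image up \<subseteq> T"
    unfolding up_def
    by (intro subset_path_image_join; unfold path_image_linepath)
       (rule right_edge_segment horizontal_segment[where k = 1]; use corner_D2 b bounds Im_less in \<open>simp add: d_def\<close>)+
qed (auto simp: low_def mid_def up_def)

lemma low_frontier: "path_image low \<subseteq> frontier D2" and up_frontier: "path_image up \<subseteq> frontier D2"
proof -
  have v: "closed_segment x y \<subseteq> frontier D2" if "x \<in> D2" "y \<in> D2" "Re x = 1" "Re y = 1" for x y
  proof
    fix z assume z: "z \<in> closed_segment x y"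
    show "z \<in> frontier D2"
      using subsetD[OF closed_segment_in_D2[OF that(1,2)] z] closed_segment_in_vertical_line[OF that(3,4) z]
      by (simp add: frontier_D2)
  qed
  have h: "closed_segment x y \<subseteq> frontier D2" if "x \<in> D2" "y \<in> D2" "Im x = k" "Im y = k" "k = 0 \<or> k = 1" for x y k
  proof
    fix z assume z: "z \<in> closed_segment x y"
    show "z \<in> frontier D2"
      using subsetD[OF closed_segment_in_D2[OF that(1,2)] z] closed_segment_in_horizontal_line[OF that(3,4) z] that(5)
      by (auto simp: frontier_D2)
  qed
  show "path_image low \<subseteq> frontier D2"
    unfolding low_def
    by (intro subset_path_image_join; unfold path_image_linepath)
       (rule v h[where k = 0]; use corner_D2 b in simp)+
  show "path_image up \<subseteq> frontier D2"
    unfolding up_def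
    by (intro subset_path_image_join; unfold path_image_linepath)
       (rule v h[where k = 1]; use corner_D2 b in \<open>simp add: d_def\<close>)+
qed

lemma axis_segment:
  assumes "x \<in> axis2" "y \<in> axis2"
  shows "z \<in> closed_segment x y \<Longrightarrow> z \<in> axis2 \<and> Im z \<in> closed_segment (Im x) (Im y)"
proof -
  assume z: "z \<in> closed_segment x y"
  have "Re x = 0" "Re y = 0" using assms by (auto simp: axis2_def)
  then have "Re z = 0" "Im z \<in> closed_segment (Im x) (Im y)"
    using z closed_segment_same_Re[of x y] by auto
  moreover have "z \<in> D2" using z assms closed_segment_in_D2[of x y] by (auto simp: axis2_def)
  ultimately show ?thesis by (simp add: axis2_def)
qed

lemma axis_corners: "0 \<in> axis2" "m \<in> axis2" "\<i> \<in> axis2"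
  using corner_D2 m_heights by (auto simp: axis2_def)

lemma axis_Y: "axis2 \<subseteq> Y"
  using bounds by (auto simp: axis2_def)

lemma axis_segment_T:
  assumes "x \<in> axis2" "y \<in> axis2" "Im p1 \<notin> closed_segment (Im x) (Im y)" "Im p2 \<notin> closed_segment (Im x) (Im y)"
  shows "closed_segment x y \<subseteq> T"
proof
  fix z assume "z \<in> closed_segment x y"
  then have z: "z \<in> axis2" "Im z \<in> closed_segment (Im x) (Im y)" using axis_segment[OF assms(1,2)] by auto
  show "z \<in> T"
    by (rule off_heights) (use z assms(3,4) in \<open>auto simp: axis2_def\<close>)
qed

lemma axis_path:
  assumes "x \<in> axis2" "y \<in> axis2"
  shows "path_image (linepath x y) \<subseteq> Y" "\<And>w. w \<in> path_image (linepath x y) \<Longrightarrow> Re w = 0"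
  using axis_segment[OF assms] axis_Y by (auto simp: axis2_def)

text \<open>Loops for \<open>x1\<close> and \<open>x2\<close>: out along one path, down the axis, and back along the next path.\<close>
definition l1 where "l1 = up +++ (linepath \<i> m +++ reversepath mid)"
definition l2 where "l2 = mid +++ (linepath m 0 +++ reversepath low)"

lemma l1: "path l1" "pathstart l1 = b" "pathfinish l1 = b" "path_image l1 \<subseteq> D2 - seg p2 - {p1}"
  and l2: "path l2" "pathstart l2 = b" "pathfinish l2 = b" "path_image l2 \<subseteq> D2 - seg p1 - {p2}"
proof -
  have "closed_segment \<i> m \<subseteq> D2 - seg p2 - {p1}"
  proof
    fix z assume "z \<in> closed_segment \<i> m"
    then have "z \<in> axis2" "Im z \<in> closed_segment (Im m) 1"
      using axis_segment[of \<i> m] axis_corners by (auto simp: closed_segment_commute)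
    moreover have "closed_segment (Im m) 1 = {Im m..1}"
      using m_heights bounds by (simp add: closed_segment_eq_real_ivl)
    ultimately show "z \<in> D2 - seg p2 - {p1}"
      using m_heights bounds by (auto simp: axis2_def seg_alt)
  qed
  moreover have "T \<subseteq> D2 - seg p2 - {p1}" "T \<subseteq> D2 - seg p1 - {p2}" using T_Y by auto
  moreover have "closed_segment m 0 \<subseteq> D2 - seg p1 - {p2}"
  proof
    fix z assume "z \<in> closed_segment m 0"
    then have "z \<in> axis2" "Im z \<in> closed_segment 0 (Im m)"
      using axis_segment[of m 0] axis_corners by (auto simp: closed_segment_commute)
    moreover have "closed_segment 0 (Im m) = {0..Im m}"
      using m_heights bounds by (simp add: closed_segment_eq_real_ivl)
    ultimately show "z \<in> D2 - seg p1 - {p2}"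
      using m_heights bounds by (auto simp: axis2_def seg_alt)
  qed
  ultimately show "path_image l1 \<subseteq> D2 - seg p2 - {p1}" "path_image l2 \<subseteq> D2 - seg p1 - {p2}"
    unfolding l1_def l2_def using low(2) mid(2) up(2)
    by (intro subset_path_image_join; simp add: path_image_linepath; blast)+
qed (auto simp: l1_def l2_def low mid up)

text \<open>Up to the detour to \<open>b\<close> on the right edge the loops are boundaries of rectangles, traversed
  counterclockwise.\<close>
lemma winding_l1: "winding_number l1 p1 = 1" and winding_l2: "winding_number l2 p2 = 1"
proof -
  note wc = winding_number_linepath_convex[of "{w. Re w = 1}"]
  have cvx: "convex {w::complex. Re w = 1}"
    using convex_hyperplane[of "1::complex" 1] by (simp add: inner_complex_def)
  have notin: "z \<notin> closed_segment x y" if "closed_segment x y \<subseteq> S" "z \<notin> S" for x y z :: complex and S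
    using that by blast
  have TY: "p1 \<notin> T" "p2 \<notin> T" using T_Y by auto
  have s: "closed_segment b d \<subseteq> T" "closed_segment d \<i> \<subseteq> T" "closed_segment c m \<subseteq> T" "closed_segment b c \<subseteq> T"
     "closed_segment b 1 \<subseteq> T" "closed_segment 1 0 \<subseteq> T"
    using low(2) mid(2) up(2) by (auto simp: low_def mid_def up_def path_image_join)
  have ax: "closed_segment \<i> m \<subseteq> Y" "closed_segment m 0 \<subseteq> Y"
    using axis_path axis_corners by auto
  have ni: "p \<notin> closed_segment b d" "p \<notin> closed_segment d \<i>" "p \<notin> closed_segment c m" "p \<notin> closed_segment b c"
     "p \<notin> closed_segment b 1" "p \<notin> closed_segment 1 0" "p \<notin> closed_segment \<i> m" "p \<notin> closed_segment m 0" if "p = p1 \<or> p = p2" for p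
    using s ax TY that by blast+
  have ni': "p \<notin> closed_segment c d" "p \<notin> closed_segment 1 c" if "p = p1 \<or> p = p2" for p
    using right_edge_segment[of c d] right_edge_segment[of 1 c] corner_D2 TY that by (auto simp: c_def d_def)
  have r: "reversepath mid = linepath m c +++ linepath c b" "reversepath low = linepath 0 1 +++ linepath 1 b"
    by (simp_all add: mid_def low_def reversepath_joinpaths)
  let ?w = "\<lambda>x y p. winding_number (linepath x y) p"
  have "winding_number l1 p1 = (?w b d p1 + ?w d \<i> p1) + (?w \<i> m p1 + (?w m c p1 + ?w c b p1))"
    unfolding l1_def up_def r using ni[of p1]
    by (simp add: winding_number_join not_in_path_image_join closed_segment_commute)
  also have "\<dots> = ?w m c p1 + (?w c b p1 + ?w b d p1) + ?w d \<i> p1 + ?w \<i> m p1" by simp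
  also have "?w c b p1 + ?w b d p1 = ?w c d p1"
    using bounds b by (intro wc cvx) (auto simp: c_def d_def)
  also have "?w m c p1 + ?w c d p1 + ?w d \<i> p1 + ?w \<i> m p1 = winding_number (rectpath m d) p1"
  proof -
    have "Complex (Re d) (Im m) = c" "Complex (Re m) (Im d) = \<i>"
      by (auto simp: m_def c_def d_def complex_eq_iff)
    then have "rectpath m d = linepath m c +++ (linepath c d +++ (linepath d \<i> +++ linepath \<i> m))"
      by (simp add: rectpath_def Let_def)
    then show ?thesis using ni[of p1] ni'[of p1]
      by (simp add: winding_number_join not_in_path_image_join closed_segment_commute)
  qed
  also have "\<dots> = 1"
    by (rule winding_number_rectpath) (use bounds m_heights in \<open>auto simp: in_box_complex_iff d_def\<close>)
  finally show "winding_number l1 p1 = 1" .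
  have "winding_number l2 p2 = (?w b c p2 + ?w c m p2) + (?w m 0 p2 + (?w 0 1 p2 + ?w 1 b p2))"
    unfolding l2_def mid_def[symmetric] r unfolding mid_def using ni[of p2]
    by (simp add: winding_number_join not_in_path_image_join closed_segment_commute)
  also have "\<dots> = ?w 0 1 p2 + (?w 1 b p2 + ?w b c p2) + ?w c m p2 + ?w m 0 p2" by simp
  also have "?w 1 b p2 + ?w b c p2 = ?w 1 c p2"
    using bounds b by (intro wc cvx) (auto simp: c_def)
  also have "?w 0 1 p2 + ?w 1 c p2 + ?w c m p2 + ?w m 0 p2 = winding_number (rectpath 0 c) p2"
  proof -
    have "Complex (Re c) (Im 0) = 1" "Complex (Re 0) (Im c) = m"
      by (auto simp: m_def c_def complex_eq_iff)
    then have "rectpath 0 c = linepath 0 1 +++ (linepath 1 c +++ (linepath c m +++ linepath m 0))"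
      by (simp add: rectpath_def Let_def)
    then show ?thesis using ni[of p2] ni'[of p2]
      by (simp add: winding_number_join not_in_path_image_join closed_segment_commute)
  qed
  also have "\<dots> = 1"
    by (rule winding_number_rectpath) (use bounds m_heights in \<open>auto simp: in_box_complex_iff c_def m_def\<close>)
  finally show "winding_number l2 p2 = 1" .
qed

lemma l_in_Y: "path_image l1 \<subseteq> Y" "path_image l2 \<subseteq> Y"
proof -
  have "p1 \<in> seg p1" "p2 \<in> seg p2" by (auto simp: seg_def)
  then show "path_image l1 \<subseteq> Y" "path_image l2 \<subseteq> Y" using l1(4) l2(4) by blast+
qed

lemma encircling_l1: "encircling_loop b p1 p2 g \<Longrightarrow> homotopic_paths Y g l1"
proof -
  assume "encircling_loop b p1 p2 g"
  then have g: "path g" "pathstart g = b" "pathfinish g = b" "path_image g \<subseteq> D2 - seg p2 - {p1}" "winding_number g p1 = 1"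
    by (auto simp: encircling_loop_def simple_path_imp_path)
  show ?thesis
    by (rule loops_around_unique[OF p1 p2 Re_eq]) (use Im_less g l1 winding_l1 in auto)
qed

lemma encircling_l2: "encircling_loop b p2 p1 g \<Longrightarrow> homotopic_paths Y g l2"
proof -
  assume "encircling_loop b p2 p1 g"
  then have g: "path g" "pathstart g = b" "pathfinish g = b" "path_image g \<subseteq> D2 - seg p1 - {p2}" "winding_number g p2 = 1"
    by (auto simp: encircling_loop_def simple_path_imp_path)
  show ?thesis
    unfolding insert_commute[of p1]
    by (rule loops_around_unique[OF p2 p1 Re_eq[symmetric]]) (use Im_less g l2 winding_l2 in auto)
qed

end

text \<open>The segment \<open>seg p\<close> ends on the axis in a limit of points inside the curve. This end is not itself inside,
  since the inside is open and contained in the square, on whose edge it lies, and it is not on the arc; so it lies on the part of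
  the axis between the ends of the arc. The end of \<open>seg q\<close> does not.\<close>
lemma enclosing_arc_heights:
  assumes a: "enclosing_arc p q a" and p: "0 < Re p" "p \<in> D2" and q: "0 \<le> Re q" "q \<in> D2"
  shows "pathstart a \<in> axis2" "pathfinish a \<in> axis2" "path a" "path_image a \<subseteq> D2 - (seg p \<union> seg q)"
    "Im (pathstart a) < Im p" "Im p < Im (pathfinish a)"
    "Im q < Im (pathstart a) \<or> Im (pathfinish a) < Im q"
proof -
  let ?s = "pathstart a" and ?t = "pathfinish a"
  let ?C = "path_image a \<union> closed_segment ?s ?t"
  have a': "arc a" "path_image a \<subseteq> D2" "path_image a \<inter> axis2 = {?s, ?t}" "Im ?s < Im ?t"
     "path_image a \<inter> (seg p \<union> seg q) = {}" "seg p - axis2 \<subseteq> inside ?C" "seg q \<inter> ?C = {}"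
    using a unfolding enclosing_arc_def Let_def by auto
  show axis: "?s \<in> axis2" "?t \<in> axis2" using a'(3) by auto
  show "path a" using a'(1) by (rule arc_imp_path)
  then have closed: "closed ?C" by (intro closed_Un) (auto simp: closed_path_image)
  show "path_image a \<subseteq> D2 - (seg p \<union> seg q)" using a' by auto
  have Re0: "Re ?s = 0" "Re ?t = 0" using axis by (auto simp: axis2_def)
  have seg_iff: "Complex 0 y \<in> closed_segment ?s ?t \<longleftrightarrow> Im ?s \<le> y \<and> y \<le> Im ?t" for y
    using Re0 a'(4) by (auto simp: closed_segment_same_Re closed_segment_eq_real_ivl)
  have "?C \<subseteq> D2" using a'(2) axis closed_segment_in_D2[of ?s ?t] by (auto simp: axis2_def)
  then have "- D2 \<subseteq> outside ?C" by (rule outside_subset_convex[OF convex_D2])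
  then have inside_D2: "inside ?C \<subseteq> D2" using inside_Int_outside[of ?C] by blast
  define p0 where "p0 = Complex 0 (Im p)"
  have p0seg: "p0 \<in> seg p" by (simp add: p0_def seg_def)
  have "p0 \<in> closure (seg p - axis2)"
  proof (rule closure_approachable[THEN iffD2], intro allI impI)
    fix e :: real assume e: "0 < e"
    define y where "y = Complex (min (Re p) (e/2)) (Im p)"
    have "y \<in> seg p - axis2" using p e by (auto simp: y_def seg_alt axis2_def)
    moreover have "dist y p0 < e"
      using p e by (simp add: y_def p0_def dist_norm complex_diff cmod_eq_Re)
    ultimately show "\<exists>y\<in>seg p - axis2. dist y p0 < e" by blast
  qed
  then have "p0 \<in> closure (inside ?C)" using closure_mono[OF a'(6)] by blast
  moreover have "closure (inside ?C) \<subseteq> inside ?C \<union> ?C"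
    using frontier_inside_subset[OF closed] closure_Un_frontier[of "inside ?C"] by blast
  moreover have "p0 \<notin> inside ?C"
  proof
    assume "p0 \<in> inside ?C"
    then have "p0 \<in> interior D2"
      using open_inside[OF closed] inside_D2 interior_maximal by blast
    then show False by (simp add: interior_D2 p0_def)
  qed
  ultimately have "p0 \<in> closed_segment ?s ?t" using a'(5) p0seg by blast
  then have "Im ?s \<le> Im p" "Im p \<le> Im ?t" unfolding p0_def seg_iff by auto
  moreover have "Im ?s \<noteq> Im p" "Im ?t \<noteq> Im p"
  proof -
    have "?s \<in> path_image a" "?t \<in> path_image a" by auto
    then have "?s \<noteq> p0" "?t \<noteq> p0" using a'(5) p0seg by auto
    then show "Im ?s \<noteq> Im p" "Im ?t \<noteq> Im p" using Re0 by (auto simp: p0_def complex_eq_iff)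
  qed
  ultimately show "Im ?s < Im p" "Im p < Im ?t" by auto
  have "Complex 0 (Im q) \<in> seg q" by (simp add: seg_def)
  then have "Complex 0 (Im q) \<notin> closed_segment ?s ?t" using a'(7) by blast
  then show "Im q < Im ?s \<or> Im ?t < Im q" unfolding seg_iff by auto
qed


context coaxial_pair
begin

lemma emb_path:
  assumes "path g" "path_image g \<subseteq> D2"
  shows "path (emb \<circ> g)" "path_image g \<subseteq> Y \<Longrightarrow> path_image (emb \<circ> g) \<subseteq> X"
proof -
  show "path (emb \<circ> g)"
    by (rule path_continuous_image[OF assms(1)]) (intro continuous_intros)
  show "path_image (emb \<circ> g) \<subseteq> X" if "path_image g \<subseteq> Y"
    unfolding X_eq path_image_compose using that emb_in_rotate_set by blast
qed

lemma homotopic_emb: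
  assumes "homotopic_paths Y g h"
  shows "homotopic_paths X (emb \<circ> g) (emb \<circ> h)"
  by (rule homotopic_paths_continuous_image[OF assms])
     (auto simp: X_eq emb_in_rotate_set intro!: continuous_intros simp del: Diff_iff)

lemma T_homotopic:
  assumes "path g" "path_image g \<subseteq> T" "path h" "path_image h \<subseteq> T"
    "pathstart h = pathstart g" "pathfinish h = pathfinish g"
  shows "homotopic_paths Y g h"
  by (rule simply_connected_homotopic[OF simply_connected_T assms T_Y])

text \<open>In the slit square the given arc \<open>a\<close> is homotopic to the standard arc \<open>A\<close> extended by pieces of the axis at
  both ends. The first piece joins the transporting path and the second one is dropped. In the ball minus the
  two discs all transporting paths with the same ends are homotopic.\<close>
lemma standard_sphere:
  assumes V: "V = D3 - (rotate_set (seg p1) \<union> rotate_set (seg p2))"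
    and a: "path a" "path_image a \<subseteq> T" "pathstart a \<in> axis2" "pathfinish a \<in> axis2"
    and A: "path A" "path_image A \<subseteq> T" "pathstart A \<in> axis2" "pathfinish A \<in> axis2"
    and \<mu>: "path \<mu>" "path_image \<mu> \<subseteq> T" "pathstart \<mu> = b" "pathfinish \<mu> = pathstart A"
    and segs: "closed_segment (pathstart a) (pathstart A) \<subseteq> T" "closed_segment (pathfinish A) (pathfinish a) \<subseteq> T"
    and \<beta>: "path \<beta>" "path_image \<beta> \<subseteq> V" "pathstart \<beta> = emb b" "pathfinish \<beta> = emb (pathstart a)"
  shows "homotopic_spheroids X (emb b) (transport \<beta> (rotate_arc a)) (transport (emb \<circ> \<mu>) (rotate_arc A))"
proof -
  define e where "e = linepath (pathstart a) (pathstart A)"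
  define e' where "e' = linepath (pathfinish A) (pathfinish a)"
  have e: "path e" "path_image e \<subseteq> T" "pathstart e = pathstart a" "pathfinish e = pathstart A"
    "\<And>w. w \<in> path_image e \<Longrightarrow> Re w = 0"
    using segs axis_path(2)[OF a(3) A(3)] by (auto simp: e_def)
  have e': "path e'" "path_image e' \<subseteq> T" "pathstart e' = pathfinish A" "pathfinish e' = pathfinish a"
    "\<And>w. w \<in> path_image e' \<Longrightarrow> Re w = 0"
    using segs axis_path(2)[OF A(4) a(4)] by (auto simp: e'_def)
  have Re0: "Re (pathstart a) = 0" "Re (pathfinish a) = 0" "Re (pathstart A) = 0" "Re (pathfinish A) = 0"
    using a A by (auto simp: axis2_def)
  have T_D2: "T \<subseteq> D2" by blast
  have emb_T: "path_image (emb \<circ> g) \<subseteq> V" if g: "path_image g \<subseteq> T" for g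
  proof
    fix x assume "x \<in> path_image (emb \<circ> g)"
    then obtain w where w: "w \<in> T" "x = emb w" using g by (auto simp: path_image_compose)
    have nonneg: "0 \<le> Re z" if "z \<in> seg p1 \<or> z \<in> seg p2" for z
      using that bounds by (auto simp: seg_alt)
    have "cyl x = w" using w by (auto simp: cyl_emb D2_alt)
    then show "x \<in> V"
      using w mem_rotate_set[of "seg p1" x] mem_rotate_set[of "seg p2" x] nonneg
      unfolding V by (auto simp: mem_D3)
  qed
  have V_X: "V \<subseteq> X"
  proof -
    have "p1 \<in> seg p1" "p2 \<in> seg p2" by (auto simp: seg_def)
    then have "rotate_set {p1, p2} \<subseteq> rotate_set (seg p1) \<union> rotate_set (seg p2)"
      by (auto simp: rotate_set_def)
    then show ?thesis unfolding V by blast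
  qed
  have ce: "path_image (A +++ e') \<subseteq> T" "path_image (e +++ (A +++ e')) \<subseteq> T"
    using e e' A by (simp_all add: path_image_join)
  have hom_a: "homotopic_paths Y a (e +++ (A +++ e'))"
    by (rule T_homotopic) (use a A e e' ce in auto)
  have s1: "homotopic_spheroids X (emb (pathstart a)) (rotate_arc a) (rotate_arc (e +++ (A +++ e')))"
    unfolding X_eq by (rule homotopic_rotate_arc_paths[OF hom_a Y_nonneg Re0(1,2)])
  have s2: "homotopic_spheroids X (emb (pathstart a)) (rotate_arc (e +++ (A +++ e'))) (transport (emb \<circ> e) (rotate_arc (A +++ e')))"
    by (rule homotopic_spheroids_eq[OF homotopic_spheroids_imp_spheroid(2)[OF s1]])
       (use rotate_arc_whisker[OF e(5)] e(4) in auto)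
  have tail: "homotopic_spheroids X (emb (pathstart A)) (rotate_arc (A +++ e')) (rotate_arc A)"
    unfolding X_eq
    by (rule rotate_arc_tail[OF A(1) _ e'(1) _ _ Y_nonneg Re0(3) e'(5)]) (use A e' T_Y in auto)
  have emb_e: "path (emb \<circ> e)" "path_image (emb \<circ> e) \<subseteq> X"
    using emb_path[OF e(1)] e(2) T_D2 T_Y by blast+
  have s3: "homotopic_spheroids X (emb (pathstart a)) (transport (emb \<circ> e) (rotate_arc (A +++ e'))) (transport (emb \<circ> e) (rotate_arc A))"
    by (rule homotopic_spheroids_transport[OF _ tail]) (use emb_e e in \<open>auto simp: pathstart_compose pathfinish_compose\<close>)
  have s4: "homotopic_spheroids X (emb (pathstart a)) (rotate_arc a) (transport (emb \<circ> e) (rotate_arc A))"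
    using homotopic_spheroids_trans[OF s1 homotopic_spheroids_trans[OF s2 s3]] .
  have \<beta>X: "path_image \<beta> \<subseteq> X" using \<beta>(2) V_X by blast
  have s5: "homotopic_spheroids X (emb b) (transport \<beta> (rotate_arc a)) (transport \<beta> (transport (emb \<circ> e) (rotate_arc A)))"
    by (rule homotopic_spheroids_transport[OF _ s4]) (use \<beta> \<beta>X in auto)
  have rA: "spheroid X (emb (pathstart A)) (rotate_arc A)"
    by (rule homotopic_spheroids_imp_spheroid(2)[OF tail])
  have s6: "homotopic_spheroids X (emb b) (transport \<beta> (transport (emb \<circ> e) (rotate_arc A))) (transport (\<beta> +++ (emb \<circ> e)) (rotate_arc A))"
    using homotopic_spheroids_transport_join[of \<beta> X "emb \<circ> e" "rotate_arc A"] \<beta> \<beta>X emb_e e rA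
    by (auto simp: pathstart_compose pathfinish_compose intro: homotopic_spheroids_sym)
  have V_sc: "simply_connected V"
    unfolding V by (rule simply_connected_disc_complement[OF p1 p2 Re_eq Im_less])
  have emb_\<mu>: "path (emb \<circ> \<mu>)" using emb_path(1)[OF \<mu>(1)] \<mu>(2) T_D2 by blast
  have jV: "path_image (\<beta> +++ (emb \<circ> e)) \<subseteq> V"
    using \<beta>(2) emb_T[OF e(2)] by (intro subset_path_image_join)
  have path_hom: "homotopic_paths X (\<beta> +++ (emb \<circ> e)) (emb \<circ> \<mu>)"
    by (rule simply_connected_homotopic[OF V_sc _ jV emb_\<mu> emb_T[OF \<mu>(2)] _ _ V_X])
       (use \<beta> \<mu> e emb_e in \<open>auto simp: pathstart_compose pathfinish_compose\<close>)
  have s7: "homotopic_spheroids X (emb b) (transport (\<beta> +++ (emb \<circ> e)) (rotate_arc A)) (transport (emb \<circ> \<mu>) (rotate_arc A))"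
    by (rule homotopic_spheroids_transport[OF path_hom, of "emb (pathstart A)"])
       (use rA \<beta> e in \<open>auto simp: homotopic_spheroids_refl pathfinish_compose\<close>)
  show ?thesis
    using homotopic_spheroids_trans[OF s5 homotopic_spheroids_trans[OF s6 s7]] .
qed

definition upper_arc where "upper_arc = reversepath mid +++ up"
definition lower_arc where "lower_arc = reversepath low +++ mid"

lemma upper_arc: "path upper_arc" "path_image upper_arc \<subseteq> T" "pathstart upper_arc = m" "pathfinish upper_arc = \<i>"
  and lower_arc: "path lower_arc" "path_image lower_arc \<subseteq> T" "pathstart lower_arc = 0" "pathfinish lower_arc = m"
proof -
  show "path_image upper_arc \<subseteq> T" "path_image lower_arc \<subseteq> T"
    unfolding upper_arc_def lower_arc_def using low(2) mid(2) up(2)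
    by (intro subset_path_image_join; simp only: path_image_reversepath)+
qed (auto simp: upper_arc_def lower_arc_def low mid up)

lemma sphere_class_upper:
  assumes "sphere_around b p1 p2 K"
  shows "K = spheroid_class X (emb b) (transport (emb \<circ> mid) (rotate_arc upper_arc))"
proof -
  obtain a \<beta> where a: "enclosing_arc p1 p2 a"
    and \<beta>: "path \<beta>" "path_image \<beta> \<subseteq> D3 - (rotate_set (seg p1) \<union> rotate_set (seg p2))"
        "pathstart \<beta> = emb b" "pathfinish \<beta> = emb (pathstart a)"
    and K: "K = spheroid_class X (emb b) (transport \<beta> (rotate_arc a))"
    using assms unfolding sphere_around_def by blast
  have "p1 \<in> D2" "p2 \<in> D2" using p1 p2 interior_subset by blast+
  note h = enclosing_arc_heights[OF a bounds(1) this(1) less_imp_le[OF bounds(3)] this(2)]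
  have ord: "Im p2 < Im (pathstart a)" using h(5,6,7) Im_less by linarith
  have "homotopic_spheroids X (emb b) (transport \<beta> (rotate_arc a)) (transport (emb \<circ> mid) (rotate_arc upper_arc))"
  proof (rule standard_sphere[OF refl h(3,4,1,2) upper_arc(1,2) _ _ mid(1,2,3) _ _ _ \<beta>])
    show "closed_segment (pathstart a) (pathstart upper_arc) \<subseteq> T"
      unfolding upper_arc(3)
      by (rule axis_segment_T[OF h(1) axis_corners(2)])
         (use ord h(5) m_heights in \<open>auto simp: closed_segment_eq_real_ivl\<close>)
    show "closed_segment (pathfinish upper_arc) (pathfinish a) \<subseteq> T"
      unfolding upper_arc(4)
      by (rule axis_segment_T[OF axis_corners(3) h(2)])
         (use h(6) Im_less bounds in \<open>auto simp: closed_segment_eq_real_ivl\<close>)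
  qed (use axis_corners in \<open>auto simp: upper_arc mid\<close>)
  then show ?thesis unfolding K by (rule spheroid_class_eqI)
qed

lemma sphere_class_lower:
  assumes "sphere_around b p2 p1 K"
  shows "K = spheroid_class X (emb b) (transport (emb \<circ> low) (rotate_arc lower_arc))"
proof -
  obtain a \<beta> where a: "enclosing_arc p2 p1 a"
    and \<beta>: "path \<beta>" "path_image \<beta> \<subseteq> D3 - (rotate_set (seg p1) \<union> rotate_set (seg p2))"
        "pathstart \<beta> = emb b" "pathfinish \<beta> = emb (pathstart a)"
    and K: "K = spheroid_class X (emb b) (transport \<beta> (rotate_arc a))"
    using assms unfolding sphere_around_def insert_commute[of p2] Un_commute[of "rotate_set (seg p2)"] by blast
  have "p1 \<in> D2" "p2 \<in> D2" using p1 p2 interior_subset by blast+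
  note h = enclosing_arc_heights[OF a bounds(3) this(2) less_imp_le[OF bounds(1)] this(1)]
  have ord: "Im (pathfinish a) < Im p1" using h(5,6,7) Im_less by linarith
  have aT: "path_image a \<subseteq> T" using h(4) by blast
  have "homotopic_spheroids X (emb b) (transport \<beta> (rotate_arc a)) (transport (emb \<circ> low) (rotate_arc lower_arc))"
  proof (rule standard_sphere[OF refl h(3) aT h(1,2) lower_arc(1,2) _ _ low(1,2,3) _ _ _ \<beta>])
    show "closed_segment (pathstart a) (pathstart lower_arc) \<subseteq> T"
      unfolding lower_arc(3)
      by (rule axis_segment_T[OF h(1) axis_corners(1)])
         (use h(5) Im_less bounds in \<open>auto simp: closed_segment_eq_real_ivl\<close>)
    show "closed_segment (pathfinish lower_arc) (pathfinish a) \<subseteq> T"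
      unfolding lower_arc(4)
      by (rule axis_segment_T[OF axis_corners(2) h(2)])
         (use ord h(6) m_heights in \<open>auto simp: closed_segment_eq_real_ivl\<close>)
  qed (use axis_corners in \<open>auto simp: lower_arc low\<close>)
  then show ?thesis unfolding K by (rule spheroid_class_eqI)
qed

lemma spheroid_arcs:
  shows "spheroid X (emb m) (rotate_arc upper_arc)" "spheroid X (emb 0) (rotate_arc lower_arc)"
    "spheroid X (emb b) (transport (emb \<circ> mid) (rotate_arc upper_arc))"
    "spheroid X (emb b) (transport (emb \<circ> low) (rotate_arc lower_arc))"
proof -
  show u: "spheroid X (emb m) (rotate_arc upper_arc)"
    unfolding X_eq upper_arc(3)[symmetric]
    by (rule spheroid_rotate_arc[OF upper_arc(1) _ Y_nonneg]) (use upper_arc T_Y m_heights in auto)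
  show l: "spheroid X (emb 0) (rotate_arc lower_arc)"
    unfolding X_eq lower_arc(3)[symmetric]
    by (rule spheroid_rotate_arc[OF lower_arc(1) _ Y_nonneg]) (use lower_arc T_Y m_heights in auto)
  have D2: "path_image mid \<subseteq> D2" "path_image low \<subseteq> D2" "path_image mid \<subseteq> Y" "path_image low \<subseteq> Y"
    using mid(2) low(2) T_Y by blast+
  show "spheroid X (emb b) (transport (emb \<circ> mid) (rotate_arc upper_arc))"
    using spheroid_transport[of "emb \<circ> mid" X "rotate_arc upper_arc"] emb_path[OF mid(1) D2(1)] D2(3) u mid
    by (simp add: pathstart_compose pathfinish_compose)
  show "spheroid X (emb b) (transport (emb \<circ> low) (rotate_arc lower_arc))"
    using spheroid_transport[of "emb \<circ> low" X "rotate_arc lower_arc"] emb_path[OF low(1) D2(2)] D2(4) l low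
    by (simp add: pathstart_compose pathfinish_compose)
qed

definition boundary_arc where "boundary_arc = reversepath low +++ up"

lemma boundary_arc: "path boundary_arc" "path_image boundary_arc \<subseteq> T" "path_image boundary_arc \<subseteq> frontier D2"
  "pathstart boundary_arc = 0" "pathfinish boundary_arc = \<i>"
proof -
  show "path_image boundary_arc \<subseteq> T" "path_image boundary_arc \<subseteq> frontier D2"
    unfolding boundary_arc_def using low(2) up(2) low_frontier up_frontier
    by (intro subset_path_image_join; simp only: path_image_reversepath)+
qed (auto simp: boundary_arc_def low up)

text \<open>The two arcs meet at \<open>m\<close>, and the path that pulls the upper sphere out of the lower one, \<open>low\<close> followed by the
  lower arc, is homotopic to \<open>mid\<close>. The upper class comes first in the product, as the ray to
  the inserted spheroid starts at the left edge.\<close>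
lemma sum_of_spheres:
  "spheroid_class X (emb b) (transport (emb \<circ> mid) (rotate_arc upper_arc)) \<otimes>\<^bsub>pi2 X (emb b)\<^esub>
   spheroid_class X (emb b) (transport (emb \<circ> low) (rotate_arc lower_arc)) =
   spheroid_class X (emb b) (transport (emb \<circ> low) (rotate_arc boundary_arc))"
  (is "_ = spheroid_class X (emb b) ?B")
proof -
  have TD: "T \<subseteq> D2" by blast
  have Y_im: "path_image low \<subseteq> Y" "path_image mid \<subseteq> Y" "path_image upper_arc \<subseteq> Y" "path_image lower_arc \<subseteq> Y"
    using low(2) mid(2) upper_arc(2) lower_arc(2) T_Y by blast+
  then have D2_im: "path_image low \<subseteq> D2" "path_image mid \<subseteq> D2" "path_image lower_arc \<subseteq> D2" by blast+
  have el: "path (emb \<circ> low)" "path_image (emb \<circ> low) \<subseteq> X" using emb_path[OF low(1) D2_im(1)] Y_im by auto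
  have Re0: "Re 0 = 0" "Re m = 0" "Re \<i> = 0" using m_heights by auto
  let ?U = "transport (emb \<circ> mid) (rotate_arc upper_arc)" and ?L = "transport (emb \<circ> low) (rotate_arc lower_arc)"
  let ?J = "transport (emb \<circ> low) (rotate_arc (lower_arc +++ upper_arc))"
  have 1: "homotopic_spheroids X (emb b) ?J
     (spheroid_join (transport ((emb \<circ> low) +++ (emb \<circ> lower_arc)) (rotate_arc upper_arc)) ?L)"
  proof -
    have "homotopic_spheroids (rotate_set Y) (pathstart (emb \<circ> low)) ?J
       (spheroid_join (transport ((emb \<circ> low) +++ (emb \<circ> lower_arc)) (rotate_arc upper_arc)) ?L)"
      by (rule rotate_arc_join[OF el(1) _ _ lower_arc(1) Y_im(4) upper_arc(1) Y_im(3) _ Y_nonneg])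
         (use el Re0 in \<open>auto simp: lower_arc upper_arc low pathfinish_compose X_eq[symmetric]\<close>)
    then show ?thesis by (simp add: X_eq pathstart_compose low)
  qed
  have "homotopic_paths Y (low +++ lower_arc) mid"
    by (rule T_homotopic) (use low mid lower_arc in \<open>simp_all add: path_image_join\<close>)
  from homotopic_emb[OF this]
  have hm: "homotopic_paths X ((emb \<circ> low) +++ (emb \<circ> lower_arc)) (emb \<circ> mid)"
    by (simp only: path_compose_join)
  have "homotopic_spheroids X (emb b) (transport ((emb \<circ> low) +++ (emb \<circ> lower_arc)) (rotate_arc upper_arc)) ?U"
    by (rule homotopic_spheroids_transport[OF hm, of "emb m"])
       (use spheroid_arcs(1) in \<open>auto simp: homotopic_spheroids_refl pathstart_compose pathfinish_compose low lower_arc\<close>)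
  then have 2: "homotopic_spheroids X (emb b)
     (spheroid_join (transport ((emb \<circ> low) +++ (emb \<circ> lower_arc)) (rotate_arc upper_arc)) ?L) (spheroid_join ?U ?L)"
    by (rule homotopic_spheroids_join) (use spheroid_arcs(4) in \<open>simp add: homotopic_spheroids_refl\<close>)
  have hb: "homotopic_paths Y (lower_arc +++ upper_arc) boundary_arc"
    by (rule T_homotopic) (use lower_arc upper_arc boundary_arc in \<open>simp_all add: path_image_join\<close>)
  have rb: "homotopic_spheroids X (emb 0) (rotate_arc (lower_arc +++ upper_arc)) (rotate_arc boundary_arc)"
    using homotopic_rotate_arc_paths[OF hb Y_nonneg] Re0 by (simp add: X_eq lower_arc upper_arc)
  have 3: "homotopic_spheroids X (emb b) ?J ?B"
    by (rule homotopic_spheroids_transport[OF _ rb]) (use el in \<open>auto simp: pathstart_compose pathfinish_compose low\<close>)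
  have "homotopic_spheroids X (emb b) (spheroid_join ?U ?L) ?B"
    using homotopic_spheroids_trans[OF homotopic_spheroids_sym[OF homotopic_spheroids_trans[OF 1 2]] 3] .
  then show ?thesis
    unfolding pi2_mult[OF spheroid_arcs(3,4)] by (rule spheroid_class_eqI)
qed

text \<open>The homeomorphism fixes the boundary and with it \<open>low\<close>, \<open>up\<close> and the axis, so the hypothesis becomes an
  equation with the image of \<open>mid\<close> as its only unknown.\<close>
lemma image_of_lower_arc:
  assumes h: "h \<in> homeos D2 {p1, p2}" and hl: "homotopic_paths Y (h \<circ> l1) l2"
  shows "homotopic_paths Y (h \<circ> lower_arc) (linepath 0 m +++ (upper_arc +++ linepath \<i> m))"
proof -
  note hD = homeosD[OF h]
  have TD: "T \<subseteq> D2" by blast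
  have contY: "continuous_on Y h" using hD(1) by (rule continuous_on_subset) auto
  have p12: "p1 \<in> D2" "p2 \<in> D2" using p1 p2 interior_subset by blast+
  have hY: "h w \<in> Y" if "w \<in> Y" for w
  proof -
    have "h w \<notin> h ` {p1, p2}" using hD(3) that p12 by (auto dest: inj_onD)
    then show ?thesis using hD(4)[of w] hD(6) that by auto
  qed
  have Y_im: "path_image low \<subseteq> Y" "path_image mid \<subseteq> Y" "path_image up \<subseteq> Y"
    using low(2) mid(2) up(2) T_Y by blast+
  have h_im: "path (h \<circ> g) \<and> path_image (h \<circ> g) \<subseteq> Y" if "path g" "path_image g \<subseteq> Y" for g
  proof
    show "path (h \<circ> g)" using that contY by (intro path_continuous_image) (auto elim: continuous_on_subset)
    show "path_image (h \<circ> g) \<subseteq> Y" unfolding path_image_compose using that hY by blast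
  qed
  have h_fix: "homotopic_paths Y (h \<circ> g) g" if "path g" "path_image g \<subseteq> Y" "path_image g \<subseteq> frontier D2" for g
  proof (rule homotopic_paths_sym, rule homotopic_paths_eq[OF that(1,2)])
    fix t :: real assume "t \<in> {0..1}"
    then have "g t \<in> frontier D2" using that(3) unfolding path_image_def by blast
    then show "g t = (h \<circ> g) t" using hD(5) by simp
  qed
  have h_pt: "h \<i> = \<i>" "h m = m" "h b = b" "h 0 = 0"
    using hD(5) corner_D2 m_heights b by (auto simp: frontier_D2)
  let ?e = "linepath 0 m" and ?e1 = "linepath \<i> m"
  have ax: "path_image ?e \<subseteq> Y" "path_image ?e1 \<subseteq> Y"
    by (rule axis_path(1)[OF axis_corners(1,2)], rule axis_path(1)[OF axis_corners(3,2)])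
  have axf: "path_image ?e1 \<subseteq> frontier D2"
    using axis_segment[OF axis_corners(3,2)] axis_in_frontier by (auto simp: axis2_def)
  let ?hm = "h \<circ> mid"
  have hm: "path ?hm" "path_image ?hm \<subseteq> Y" "pathstart ?hm = b" "pathfinish ?hm = m"
    using h_im[OF mid(1) Y_im(2)] h_pt by (auto simp: pathstart_compose pathfinish_compose mid)
  let ?u = "up +++ ?e1"
  have u: "path ?u" "path_image ?u \<subseteq> Y" "pathstart ?u = b" "pathfinish ?u = m"
    using up ax Y_im by (simp_all add: path_image_join)
  have "homotopic_paths Y (?u +++ reversepath ?hm) l2"
  proof -
    have "homotopic_paths Y (?u +++ reversepath ?hm) (up +++ (?e1 +++ reversepath ?hm))"
      using up ax Y_im hm by (intro homotopic_paths_sym[OF homotopic_paths_assoc]) auto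
    also have "homotopic_paths Y (up +++ (?e1 +++ reversepath ?hm)) ((h \<circ> up) +++ ((h \<circ> ?e1) +++ reversepath ?hm))"
    proof (intro homotopic_paths_join)
      show "homotopic_paths Y up (h \<circ> up)" "homotopic_paths Y ?e1 (h \<circ> ?e1)"
        using h_fix up(1) Y_im(3) up_frontier ax(2) axf by (auto intro!: homotopic_paths_sym[OF h_fix])
    qed (use hm up in auto)
    also have "homotopic_paths Y ((h \<circ> up) +++ ((h \<circ> ?e1) +++ reversepath ?hm)) l2"
      using hl by (simp add: l1_def path_compose_join path_compose_reversepath)
    finally show ?thesis .
  qed
  from homotopic_paths_solve_right[OF this u(1,2) hm(1,2)]
  have hm_eq: "homotopic_paths Y ?hm (reversepath l2 +++ ?u)" using u hm by simp
  have rl2: "reversepath l2 = (low +++ ?e) +++ reversepath mid"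
    by (simp add: l2_def reversepath_joinpaths mid low)
  have ru: "path_image (reversepath mid +++ ?u) \<subseteq> Y"
    by (rule subset_path_image_join) (use Y_im(2) u(2) in simp_all)
  have "homotopic_paths Y (reversepath l2 +++ ?u) ((low +++ ?e) +++ (reversepath mid +++ ?u))"
    unfolding rl2 using low mid Y_im ax u
    by (intro homotopic_paths_sym[OF homotopic_paths_assoc]) (simp_all add: path_image_join)
  also have "homotopic_paths Y ((low +++ ?e) +++ (reversepath mid +++ ?u)) (low +++ (?e +++ (reversepath mid +++ ?u)))"
    using low mid Y_im ax u ru by (intro homotopic_paths_sym[OF homotopic_paths_assoc]) auto
  finally have hm_eq': "homotopic_paths Y ?hm (low +++ (?e +++ (reversepath mid +++ ?u)))"
    using hm_eq homotopic_paths_trans by blast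
  have eru: "path_image (?e +++ (reversepath mid +++ ?u)) \<subseteq> Y"
    by (rule subset_path_image_join[OF ax(1) ru])
  have image_eq: "h \<circ> lower_arc = reversepath (h \<circ> low) +++ ?hm"
    by (simp add: lower_arc_def path_compose_join path_compose_reversepath)
  have "homotopic_paths Y (reversepath (h \<circ> low) +++ ?hm) (reversepath low +++ (low +++ (?e +++ (reversepath mid +++ ?u))))"
    using h_fix[OF low(1) Y_im(1) low_frontier] hm_eq' h_pt
    by (intro homotopic_paths_join homotopic_paths_reversepath_D)
       (auto simp: pathstart_compose pathfinish_compose low mid)
  also have "homotopic_paths Y (reversepath low +++ (low +++ (?e +++ (reversepath mid +++ ?u)))) (?e +++ (reversepath mid +++ ?u))"
    by (rule homotopic_paths_cancel_left) (use low mid Y_im eru u in auto)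
  also have "homotopic_paths Y (?e +++ (reversepath mid +++ ?u)) (?e +++ (upper_arc +++ ?e1))"
  proof (rule homotopic_paths_join)
    show "homotopic_paths Y (reversepath mid +++ ?u) (upper_arc +++ ?e1)"
      unfolding upper_arc_def using mid up Y_im ax by (intro homotopic_paths_assoc) auto
  qed (use ax mid in auto)
  finally show ?thesis unfolding image_eq .
qed

end


section \<open>The elementary braid permutation\<close>
lemma isotopic_sym: "isotopic S A f g \<Longrightarrow> isotopic S A g f"
  unfolding isotopic_def by (rule homotopic_with_symD)

lemma isotopic_trans: "isotopic S A f g \<Longrightarrow> isotopic S A g h \<Longrightarrow> isotopic S A f h"
  unfolding isotopic_def by (rule homotopic_with_trans)

lemma isotopic_imp_homeos: "isotopic S A f g \<Longrightarrow> f \<in> homeos S A" "isotopic S A f g \<Longrightarrow> g \<in> homeos S A"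
  unfolding isotopic_def by (auto dest: homotopic_with_imp_property)

theorem lemma3p10:
  fixes p1 p2 b :: complex
    and \<tau> :: "(complex \<Rightarrow> complex) set"
    and x1 x2 :: "(real \<Rightarrow> complex) set"
    and K1 K2 :: "(complex \<Rightarrow> complex \<times> real) set"
  defines "X \<equiv> D3 - rotate_set {p1, p2}"
  defines "M \<equiv> pi12 X (emb b)"
  defines "y1 \<equiv> pi1_map {emb} X x1"
  defines "y2 \<equiv> pi1_map {emb} X x2"
  defines "S \<equiv> induced_pi12 (rotate_MCG {p1, p2} \<tau>) X (emb b)"
  assumes "p1 \<in> interior D2" and "p2 \<in> interior D2"
    and "Re p1 = Re p2" and "Im p2 < Im p1"
    and "b \<in> D2" and "Re b = 1"
    and "standard_generators b p1 p2 x1 x2"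
    and "sphere_around b p1 p2 K1" and "sphere_around b p2 p1 K2"
    and "half_twist p1 p2 \<tau>"
  shows "S \<in> carrier (pi_Aut M) \<and>
         fst S y2 = inv\<^bsub>Grp M\<^esub> y2 \<otimes>\<^bsub>Grp M\<^esub> y1 \<otimes>\<^bsub>Grp M\<^esub> y2 \<and>
         fst S y1 = y2 \<and>
         snd S K2 = act M (inv\<^bsub>Grp M\<^esub> y2) K1 \<and>
         snd S (K1 \<otimes>\<^bsub>Ab M\<^esub> K2) = K1 \<otimes>\<^bsub>Ab M\<^esub> K2 \<and>
         snd S K1 = K1 \<otimes>\<^bsub>Ab M\<^esub> K2 \<otimes>\<^bsub>Ab M\<^esub> inv\<^bsub>Ab M\<^esub> (act M (inv\<^bsub>Grp M\<^esub> y2) K1)"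
proof -
  interpret coaxial_pair p1 p2 b
    using assms(6-11) by unfold_locales
  let ?x = "emb b"
  have GA: "Grp M = pi1 X ?x" "Ab M = pi2 X ?x" by (auto simp: M_def pi12_def)
  have Y_D2: "Y \<subseteq> D2" and T_D2: "T \<subseteq> D2" by auto
  have p12: "{p1, p2} \<subseteq> D2" using p1 p2 interior_subset by blast
  have bY: "b \<in> Y" using b bounds by auto
  have xX: "?x \<in> X" using X_eq emb_in_rotate_set[OF bY] unfolding X_def by simp
  have x_frontier: "?x \<in> frontier D3"
  proof -
    have "cyl ?x = b" using b by (intro cyl_emb) simp
    then have "?x \<in> D3" using b by (simp add: mem_D3)
    moreover have "cmod (fst ?x) = 1" using b by (simp add: emb_def)
    ultimately show ?thesis by (simp add: frontier_D3)
  qed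
  interpret G: group "pi1 X ?x" by (rule group_pi1[OF xX])
  interpret A: group "pi2 X ?x" by (rule group_pi2[OF xX])

  obtain H where \<tau>: "\<tau> \<in> carrier (MCG D2 {p1, p2})"
    and H: "continuous_on ({0..1} \<times> D2) (\<lambda>(t, w). H t w)" "\<forall>t\<in>{0..1}. H t \<in> homeos D2 {}"
      "\<forall>w\<in>D2. H 0 w = w" "H 1 \<in> \<tau>" "H 1 p1 = p2" "H 1 p2 = p1"
      "\<forall>t\<in>{0<..<1::real}. Re (H t p2) < Re (H t p1)"
    using assms(15) unfolding half_twist_def by (elim conjE exE) (rule that)
  define h where "h = H 1"
  obtain f0 where f0: "\<tau> = {g. isotopic D2 {p1, p2} f0 g}" using \<tau> by (auto simp: MCG_def)
  have iso_h: "isotopic D2 {p1, p2} h k" if "k \<in> \<tau>" for k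
    using that H(4) isotopic_sym isotopic_trans unfolding f0 h_def by blast
  have h: "h \<in> homeos D2 {p1, p2}" using isotopic_imp_homeos(1)[OF iso_h] H(4) by blast
  note hD = homeosD[OF h]
  define f where "f = rotate_map h"
  define \<sigma> where "\<sigma> = rotate_MCG {p1, p2} \<tau>"
  have f\<sigma>: "f \<in> \<sigma>"
    unfolding \<sigma>_def rotate_MCG_def f_def
    using isotopic_rotate_map[OF iso_h p12] H(4) h_def by auto
  have iso_f: "isotopic D3 (rotate_set {p1, p2}) f k" if k: "k \<in> \<sigma>" for k
  proof -
    obtain h' where "h' \<in> \<tau>" "isotopic D3 (rotate_set {p1, p2}) (rotate_map h') k"
      using k unfolding \<sigma>_def rotate_MCG_def by blast
    then show ?thesis
      unfolding f_def using isotopic_rotate_map[OF iso_h p12] isotopic_trans by blast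
  qed
  have RD3: "rotate_set {p1, p2} \<subseteq> D3" unfolding D3_def rotate_set_def using p12 by blast
  have hom_f: "\<forall>k\<in>\<sigma>. homotopic_with_canon (\<lambda>h. h ?x = ?x) X X f k"
    unfolding X_def using isotopic_imp_homotopic_complement[OF iso_f RD3 x_frontier] by blast
  have S: "S = induced_pi12 \<sigma> X ?x" by (simp add: S_def \<sigma>_def)
  note class1 = induced_pi12_class(1)[OF f\<sigma> hom_f, folded S]
    and class2 = induced_pi12_class(2)[OF f\<sigma> hom_f, folded S]
  have f_homeos: "f \<in> homeos D3 (rotate_set {p1, p2})"
    unfolding f_def by (rule rotate_map_homeos[OF h p12])
  then obtain f' where f': "homeomorphism D3 D3 f f'" by (auto simp: homeos_def)
  have Aut: "S \<in> carrier (pi_Aut M)"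
    unfolding S M_def
  proof (rule induced_pi12_in_pi_Aut[OF f\<sigma> hom_f])
    have inv: "\<And>z. z \<in> D3 \<Longrightarrow> f (f' z) = z" "\<And>z. z \<in> D3 \<Longrightarrow> f' (f z) = z" "\<And>z. z \<in> D3 \<Longrightarrow> f' z \<in> D3"
      using f' unfolding homeomorphism_def by auto
    then show "f (f' z) = z" "f' (f z) = z" if "z \<in> X" for z using that by (auto simp: X_def)
    show "continuous_on X f'"
      using f' unfolding homeomorphism_def X_def by (meson Diff_subset continuous_on_subset)
    have fR: "f ` rotate_set {p1, p2} = rotate_set {p1, p2}" using f_homeos by (auto simp: homeos_def)
    show "f' ` X \<subseteq> X"
    proof
      fix y assume "y \<in> f' ` X"
      then obtain z where z: "z \<in> D3" "z \<notin> rotate_set {p1, p2}" "y = f' z" by (auto simp: X_def)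
      then have "y \<notin> rotate_set {p1, p2}" using inv(1)[OF z(1)] fR by force
      then show "y \<in> X" using z inv(3) by (auto simp: X_def)
    qed
    have "f ?x = ?x" using f_homeos x_frontier by (auto simp: homeos_def)
    moreover have "?x \<in> D3" using xX by (simp add: X_def)
    ultimately show "f' ?x = ?x" using inv(2)[of ?x] by simp
  qed

  have f_emb: "f (emb w) = emb (h w)" if "w \<in> D2" for w
    unfolding f_def by (rule rotate_map_emb[OF h that])
  have contY: "continuous_on Y emb" by (intro continuous_intros)
  have emb_Y: "emb ` Y \<subseteq> X"
    unfolding X_def X_eq by (rule image_subsetI) (rule emb_in_rotate_set)
  have emb_hom: "\<forall>k\<in>{emb}. homotopic_with_canon (\<lambda>h. h b = ?x) Y X emb k"
    using contY emb_Y by (simp add: image_subset_iff_funcset)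
  have emb_class: "pi1_map {emb} X (loop_class Y g) = loop_class X (emb \<circ> g)" if "loop_at Y b g" for g
    by (rule pi1_map_class[OF _ emb_hom that]) simp
  have emb_loop: "loop_at X ?x (emb \<circ> g)" if "loop_at Y b g" for g
    by (rule loop_at_image[OF that contY emb_Y]) simp
  have S_emb: "fst S (loop_class X (emb \<circ> g)) = loop_class X (emb \<circ> (h \<circ> g))" if g: "loop_at Y b g" for g
  proof -
    have "loop_at X ?x (f \<circ> (emb \<circ> g))"
      using loop_at_image[OF emb_loop[OF g], of f X ?x] homotopic_with_imp_continuous[OF bspec[OF hom_f f\<sigma>]]
        homotopic_with_imp_subset1[OF bspec[OF hom_f f\<sigma>]] homotopic_with_imp_property[OF bspec[OF hom_f f\<sigma>]] by auto
    then have "homotopic_paths X (f \<circ> (emb \<circ> g)) (emb \<circ> (h \<circ> g))"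
    proof (intro homotopic_paths_eq)
      fix t :: real assume "t \<in> {0..1}"
      then have "g t \<in> D2" using loop_atD(2)[OF g] Y_D2 unfolding path_image_def by blast
      then show "(f \<circ> (emb \<circ> g)) t = (emb \<circ> (h \<circ> g)) t" using f_emb by simp
    qed (auto simp: loop_at_def)
    then show ?thesis unfolding class1[OF emb_loop[OF g]] by (rule loop_class_eqI)
  qed
  have emb_cong: "loop_class X (emb \<circ> g) = loop_class X (emb \<circ> k)" if "homotopic_paths Y g k" for g k
    unfolding X_def by (rule loop_class_eqI[OF homotopic_emb[OF that]])
  obtain g1 g2 d where g1: "encircling_loop b p1 p2 g1" "x1 = loop_class Y g1"
    and g2: "encircling_loop b p2 p1 g2" "x2 = loop_class Y g2"
    and d: "simple_path d" "pathstart d = b" "pathfinish d = b" "path_image d = frontier D2"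
    and prod: "x1 \<otimes>\<^bsub>pi1 Y b\<^esub> x2 = loop_class Y d"
    using assms(12) unfolding standard_generators_def by (elim conjE exE) (rule that)
  have x1: "x1 = loop_class Y l1" and x2: "x2 = loop_class Y l2"
    unfolding g1(2) g2(2)
    by (rule loop_class_eqI[OF encircling_l1[OF g1(1)]], rule loop_class_eqI[OF encircling_l2[OF g2(1)]])
  have L1: "loop_at Y b l1" and L2: "loop_at Y b l2"
    using l1 l2 l_in_Y by (auto simp: loop_at_def)
  have y1: "y1 = loop_class X (emb \<circ> l1)" and y2: "y2 = loop_class X (emb \<circ> l2)"
    unfolding y1_def y2_def x1 x2 by (rule emb_class[OF L1], rule emb_class[OF L2])
  have y1_in: "y1 \<in> carrier (pi1 X ?x)" and y2_in: "y2 \<in> carrier (pi1 X ?x)"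
    unfolding y1 y2 using emb_loop[OF L1] emb_loop[OF L2] by auto
  have hl: "homotopic_paths Y (h \<circ> l1) l2"
    unfolding h_def
    by (rule half_twist_generator[OF p1 p2 Re_eq _ b H(1) _ _ H(5,6) _ l1(1-4) winding_l1 l2(1-4) winding_l2])
       (use H Im_less in auto)
  have Sy1: "fst S y1 = y2"
    unfolding y1 y2 S_emb[OF L1] by (rule emb_cong[OF hl])
  have S_hom1: "fst S \<in> hom (pi1 X ?x) (pi1 X ?x)" and S_hom2: "snd S \<in> hom (pi2 X ?x) (pi2 X ?x)"
    using Aut unfolding pi_Aut_def pi_mor_def GA by (auto simp: case_prod_unfold)
  have S_prod: "fst S (y1 \<otimes>\<^bsub>pi1 X ?x\<^esub> y2) = y1 \<otimes>\<^bsub>pi1 X ?x\<^esub> y2"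
  proof -
    have fr_Y: "frontier D2 \<subseteq> Y" using p1 p2 by (auto simp: frontier_D2 interior_D2)
    have d_loop: "loop_at Y b d" using d fr_Y by (auto simp: loop_at_def simple_path_imp_path)
    have "loop_class Y (l1 +++ l2) = loop_class Y d"
      using prod unfolding x1 x2 pi1_mult[OF L1 L2] .
    then have "homotopic_paths Y (l1 +++ l2) d"
      using loop_at_join[OF L1 L2] by (simp add: loop_class_eq_iff loop_at_def)
    then have y12: "y1 \<otimes>\<^bsub>pi1 X ?x\<^esub> y2 = loop_class X (emb \<circ> d)"
      unfolding y1 y2 pi1_mult[OF emb_loop[OF L1] emb_loop[OF L2]] path_compose_join[symmetric] by (rule emb_cong)
    have "homotopic_paths Y d (h \<circ> d)"
    proof (rule homotopic_paths_eq)
      fix t :: real assume "t \<in> {0..1}"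
      then have "d t \<in> frontier D2" unfolding d(4)[symmetric] path_image_def by blast
      then show "d t = (h \<circ> d) t" using hD(5) by simp
    qed (use d_loop in \<open>auto simp: loop_at_def\<close>)
    then have "loop_class X (emb \<circ> (h \<circ> d)) = loop_class X (emb \<circ> d)"
      by (rule emb_cong[symmetric])
    then show ?thesis unfolding y12 S_emb[OF d_loop] .
  qed
  have Sy2_in: "fst S y2 \<in> carrier (pi1 X ?x)" using hom_in_carrier[OF S_hom1 y2_in] .
  have "y2 \<otimes>\<^bsub>pi1 X ?x\<^esub> fst S y2 = y1 \<otimes>\<^bsub>pi1 X ?x\<^esub> y2"
    using S_prod unfolding hom_mult[OF S_hom1 y1_in y2_in] Sy1 .
  then have Sy2: "fst S y2 = inv\<^bsub>pi1 X ?x\<^esub> y2 \<otimes>\<^bsub>pi1 X ?x\<^esub> y1 \<otimes>\<^bsub>pi1 X ?x\<^esub> y2"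
    using G.inv_solve_left[OF Sy2_in y2_in G.m_closed[OF y1_in y2_in]] G.m_assoc[OF G.inv_closed[OF y2_in] y1_in y2_in] by simp

  let ?U = "transport (emb \<circ> mid) (rotate_arc upper_arc)" and ?L = "transport (emb \<circ> low) (rotate_arc lower_arc)"
  have K1: "K1 = spheroid_class X ?x ?U" unfolding X_def by (rule sphere_class_upper[OF assms(13)])
  have K2: "K2 = spheroid_class X ?x ?L" unfolding X_def by (rule sphere_class_lower[OF assms(14)])
  note sph = spheroid_arcs[folded X_def]
  have low_D2: "path_image low \<subseteq> D2" "path_image low \<subseteq> Y" using low(2) T_Y by blast+
  have mid_D2: "path_image mid \<subseteq> D2" "path_image mid \<subseteq> Y" using mid(2) T_Y by blast+
  have el: "path (emb \<circ> low)" "path_image (emb \<circ> low) \<subseteq> X"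
    using emb_path[OF low(1) low_D2(1)] low_D2(2) by (auto simp: X_def)
  have em: "path (emb \<circ> mid)" "path_image (emb \<circ> mid) \<subseteq> X"
    using emb_path[OF mid(1) mid_D2(1)] mid_D2(2) by (auto simp: X_def)
  have ends: "pathstart (emb \<circ> low) = ?x" "pathfinish (emb \<circ> low) = emb 0"
    "pathstart (emb \<circ> mid) = ?x" "pathfinish (emb \<circ> mid) = emb m"
    by (auto simp: pathstart_compose pathfinish_compose low mid)
  have f_transport: "f (transport (emb \<circ> low) (rotate_arc a) w) = transport (emb \<circ> low) (rotate_arc (h \<circ> a)) w"
    if "path_image a \<subseteq> D2" "Re (pathfinish a) = 0" "sqnorm w \<le> 1" for a w
  proof (cases "sqnorm w \<le> 1/2")
    case True
    then show ?thesis
      using rotate_map_rotate_arc[OF h that(1,2), of "2 * w"] by (simp add: transport_def f_def)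
  next
    case False
    have "low (2 - 2 * sqnorm w) \<in> path_image low" using False that(3) by (auto simp: path_image_def)
    then have "low (2 - 2 * sqnorm w) \<in> frontier D2" using low_frontier by blast
    then have "h (low (2 - 2 * sqnorm w)) = low (2 - 2 * sqnorm w)" "low (2 - 2 * sqnorm w) \<in> D2"
      using hD(5) by (auto simp: frontier_D2)
    then show ?thesis using False f_emb by (simp add: transport_def)
  qed
  have f_spheroid: "spheroid X ?x (f \<circ> g)" if "spheroid X ?x g" for g
    using spheroid_image[OF that, of f X ?x] homotopic_with_imp_continuous[OF bspec[OF hom_f f\<sigma>]]
        homotopic_with_imp_subset1[OF bspec[OF hom_f f\<sigma>]] homotopic_with_imp_property[OF bspec[OF hom_f f\<sigma>]] by auto
  let ?e = "linepath 0 m" and ?e1 = "linepath \<i> m"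
  note ax_e = axis_path[OF axis_corners(1,2)] and ax_e1 = axis_path[OF axis_corners(3,2)]
  have SK2: "snd S K2 = act M (inv\<^bsub>pi1 X ?x\<^esub> y2) K1"
  proof -
    have upper_Y: "path_image upper_arc \<subseteq> Y" using upper_arc(2) T_Y by blast
    have lower_D2: "path_image lower_arc \<subseteq> D2" using lower_arc(2) by blast
    have s1: "homotopic_spheroids X ?x (f \<circ> ?L) (transport (emb \<circ> low) (rotate_arc (h \<circ> lower_arc)))"
      by (rule homotopic_spheroids_eq[OF f_spheroid[OF sph(4)]])
         (use f_transport[OF lower_D2] lower_arc m_heights in auto)
    have h0: "h 0 = 0" using hD(5)[of 0] corner_D2 by (auto simp: frontier_D2)
    have hm: "h m = m" using hD(5)[of m] corner_D2 m_heights by (auto simp: frontier_D2)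
    have r1: "homotopic_spheroids X (emb 0) (rotate_arc (h \<circ> lower_arc)) (rotate_arc (?e +++ (upper_arc +++ ?e1)))"
      using homotopic_rotate_arc_paths[OF image_of_lower_arc[OF h hl] Y_nonneg] h0 hm m_heights
      by (simp add: X_def X_eq pathstart_compose pathfinish_compose lower_arc)
    have r2: "homotopic_spheroids X (emb 0) (rotate_arc (?e +++ (upper_arc +++ ?e1))) (transport (emb \<circ> ?e) (rotate_arc (upper_arc +++ ?e1)))"
      by (rule homotopic_spheroids_eq[OF homotopic_spheroids_imp_spheroid(2)[OF r1]])
         (rule rotate_arc_whisker[symmetric], use ax_e(2) upper_arc in \<open>simp_all del: path_image_linepath\<close>)
    have tail: "homotopic_spheroids X (emb m) (rotate_arc (upper_arc +++ ?e1)) (rotate_arc upper_arc)"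
      using rotate_arc_tail[OF upper_arc(1) upper_Y _ ax_e1(1) _ Y_nonneg _ ax_e1(2)] m_heights
      by (simp add: X_def X_eq upper_arc)
    have ee: "path (emb \<circ> ?e)" "path_image (emb \<circ> ?e) \<subseteq> X"
      using emb_path[of ?e] ax_e(1) Y_D2 unfolding X_def by auto
    have ee_ends: "pathstart (emb \<circ> ?e) = emb 0" "pathfinish (emb \<circ> ?e) = emb m"
      by (auto simp: pathstart_compose pathfinish_compose)
    have r3: "homotopic_spheroids X (emb 0) (transport (emb \<circ> ?e) (rotate_arc (upper_arc +++ ?e1))) (transport (emb \<circ> ?e) (rotate_arc upper_arc))"
      by (rule homotopic_spheroids_transport[OF _ tail]) (use ee ee_ends in auto)
    have r: "homotopic_spheroids X (emb 0) (rotate_arc (h \<circ> lower_arc)) (transport (emb \<circ> ?e) (rotate_arc upper_arc))"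
      using homotopic_spheroids_trans[OF r1 homotopic_spheroids_trans[OF r2 r3]] .
    have s2: "homotopic_spheroids X ?x (transport (emb \<circ> low) (rotate_arc (h \<circ> lower_arc)))
       (transport (emb \<circ> low) (transport (emb \<circ> ?e) (rotate_arc upper_arc)))"
      by (rule homotopic_spheroids_transport[OF _ r]) (use el ends in auto)
    have s3: "homotopic_spheroids X ?x (transport (emb \<circ> low) (transport (emb \<circ> ?e) (rotate_arc upper_arc)))
        (transport ((emb \<circ> low) +++ (emb \<circ> ?e)) (rotate_arc upper_arc))"
      using homotopic_spheroids_transport_join[OF el ee, of "rotate_arc upper_arc"] sph(1) ends ee_ends
      by (simp add: homotopic_spheroids_sym)
    \<comment> \<open>\<open>l2\<close> is \<open>mid\<close> followed by the axis down to \<open>0\<close> and \<open>low\<close> backwards, so \<open>l2\<inverse> mid\<close> is \<open>low\<close> followed by the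
      axis up to \<open>m\<close>.\<close>
    let ?r = "reversepath (emb \<circ> l2)"
    have path_hom: "homotopic_paths X ((emb \<circ> low) +++ (emb \<circ> ?e)) (?r +++ (emb \<circ> mid))"
    proof -
      have rl2: "reversepath l2 = (low +++ ?e) +++ reversepath mid"
        by (simp add: l2_def reversepath_joinpaths mid low)
      have le: "path (low +++ ?e)" "path_image (low +++ ?e) \<subseteq> Y" "pathfinish (low +++ ?e) = m"
        using low low_D2 ax_e(1) by (simp_all add: path_image_join)
      have "homotopic_paths Y (reversepath l2 +++ mid) ((low +++ ?e) +++ (reversepath mid +++ mid))"
        unfolding rl2 using le mid mid_D2 by (intro homotopic_paths_sym[OF homotopic_paths_assoc]) auto
      also have "homotopic_paths Y ((low +++ ?e) +++ (reversepath mid +++ mid)) ((low +++ ?e) +++ linepath (pathfinish mid) (pathfinish mid))"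
      proof (rule homotopic_paths_join)
        show "homotopic_paths Y (reversepath mid +++ mid) (linepath (pathfinish mid) (pathfinish mid))"
          by (rule homotopic_paths_linv[OF mid(1) mid_D2(2)])
      qed (use le mid in auto)
      also have "homotopic_paths Y ((low +++ ?e) +++ linepath (pathfinish mid) (pathfinish mid)) (low +++ ?e)"
        by (rule homotopic_paths_rid') (use le mid in auto)
      finally have "homotopic_paths X (emb \<circ> (low +++ ?e)) (emb \<circ> (reversepath l2 +++ mid))"
        unfolding X_def by (rule homotopic_emb[OF homotopic_paths_sym])
      then show ?thesis by (simp only: path_compose_join path_compose_reversepath)
    qed
    have s4: "homotopic_spheroids X ?x (transport ((emb \<circ> low) +++ (emb \<circ> ?e)) (rotate_arc upper_arc))
        (transport (?r +++ (emb \<circ> mid)) (rotate_arc upper_arc))"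
      by (rule homotopic_spheroids_transport[OF path_hom, of "emb m"])
         (use sph(1) ends ee_ends in \<open>auto simp: homotopic_spheroids_refl\<close>)
    have rl: "loop_at X ?x ?r" by (rule loop_at_reversepath[OF emb_loop[OF L2]])
    have s5: "homotopic_spheroids X ?x (transport (?r +++ (emb \<circ> mid)) (rotate_arc upper_arc)) (transport ?r ?U)"
      using homotopic_spheroids_transport_join[of ?r X "emb \<circ> mid" "rotate_arc upper_arc"] rl em ends sph(1)
      by (simp add: loop_at_def)
    have "homotopic_spheroids X ?x (f \<circ> ?L) (transport ?r ?U)"
      using homotopic_spheroids_trans[OF s1 homotopic_spheroids_trans[OF s2 homotopic_spheroids_trans[OF s3
          homotopic_spheroids_trans[OF s4 s5]]]] .
    then show ?thesis
      unfolding K2 K1 class2[OF sph(4)] y2 pi1_inv[OF emb_loop[OF L2]] M_def act_class[OF rl sph(3)]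
      by (rule spheroid_class_eqI)
  qed
  have K1_in: "K1 \<in> carrier (pi2 X ?x)" and K2_in: "K2 \<in> carrier (pi2 X ?x)"
    unfolding K1 K2 using sph(3,4) by auto
  have SK12: "snd S (K1 \<otimes>\<^bsub>pi2 X ?x\<^esub> K2) = K1 \<otimes>\<^bsub>pi2 X ?x\<^esub> K2"
  proof -
    let ?B = "transport (emb \<circ> low) (rotate_arc boundary_arc)"
    have K12: "K1 \<otimes>\<^bsub>pi2 X ?x\<^esub> K2 = spheroid_class X ?x ?B"
      unfolding K1 K2 X_def by (rule sum_of_spheres)
    have B_Y: "path_image boundary_arc \<subseteq> Y" "path_image boundary_arc \<subseteq> D2" using boundary_arc(2) T_Y by blast+
    have "spheroid X (emb 0) (rotate_arc boundary_arc)"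
      using spheroid_rotate_arc[OF boundary_arc(1) B_Y(1) Y_nonneg] boundary_arc by (simp add: X_def X_eq)
    then have B: "spheroid X ?x ?B" using spheroid_transport[OF el, of "rotate_arc boundary_arc"] ends by simp
    have "homotopic_spheroids X ?x ?B (f \<circ> ?B)"
    proof (rule homotopic_spheroids_eq[OF B])
      fix w assume w: "sqnorm w \<le> 1"
      have eq: "rotate_arc (h \<circ> boundary_arc) z = rotate_arc boundary_arc z" if "sqnorm z \<le> 1" for z
      proof -
        have "boundary_arc (1 - sqnorm z) \<in> path_image boundary_arc"
          unfolding path_image_def using sqnorm_bounds[OF that] by (rule imageI)
        then have "h (boundary_arc (1 - sqnorm z)) = boundary_arc (1 - sqnorm z)" using hD(5) boundary_arc(3) by blast
        then show ?thesis by (simp add: rotate_arc_def)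
      qed
      have "(f \<circ> ?B) w = transport (emb \<circ> low) (rotate_arc (h \<circ> boundary_arc)) w"
        using f_transport[OF B_Y(2) _ w] boundary_arc by simp
      also have "\<dots> = ?B w" using eq[of "2 * w"] by (simp add: transport_def)
      finally show "?B w = (f \<circ> ?B) w" ..
    qed
    then show ?thesis unfolding K12 class2[OF B] by (rule spheroid_class_eqI[symmetric])
  qed
  have SK1: "snd S K1 = K1 \<otimes>\<^bsub>pi2 X ?x\<^esub> K2 \<otimes>\<^bsub>pi2 X ?x\<^esub> inv\<^bsub>pi2 X ?x\<^esub> (act M (inv\<^bsub>pi1 X ?x\<^esub> y2) K1)"
  proof -
    have S_in: "snd S K1 \<in> carrier (pi2 X ?x)" "snd S K2 \<in> carrier (pi2 X ?x)"
      using hom_in_carrier[OF S_hom2] K1_in K2_in by auto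
    have "snd S K1 \<otimes>\<^bsub>pi2 X ?x\<^esub> snd S K2 = K1 \<otimes>\<^bsub>pi2 X ?x\<^esub> K2"
      using SK12 unfolding hom_mult[OF S_hom2 K1_in K2_in] .
    then show ?thesis
      unfolding SK2[symmetric]
      using A.inv_solve_right[OF S_in(1) A.m_closed[OF K1_in K2_in] S_in(2)] by simp
  qed
  show ?thesis
    unfolding GA using Aut Sy1 Sy2 SK2 SK12 SK1 by blast
qed


end
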